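(* Let $\Omega,\Gamma,B,D$, the parameters $b^\varepsilon,d^\varepsilon,h^\varepsilon,\varrho^\varepsilon$, the operator $\mathcal{A}^\varepsilon$ and the limits $q\in[0,\infty]$, $r\in[0,\infty)$ (assumed to exist) be as in the context. Let $\{\lambda_k^\varepsilon\}_{k\in\mathbb{N}}$ be the sequence of eigenvalues of $\mathcal{A}^\varepsilon$ written in ascending order and repeated according to multiplicity. If $q<\infty$, then $$\sup_{k\in\mathbb{N}}\Bigl(\limsup_{\varepsilon\to0}\lambda_k^\varepsilon\Bigr)\le q.$$
   Context: Notation: $n\ge2$; $x=(x',x_n)\in\mathbb{R}^n$ with $x'=(x_1,\dots,x_{n-1})\in\mathbb{R}^{n-1}$; $|\cdot|$ denotes $n$- or $(n-1)$-dimensional volume as appropriate; a domain is a connected open set; $\varepsilon>0$ is a small parameter. The domain: $\Omega\subset\{x_n<0\}$ is a bounded domain in $\mathbb{R}^n$ with Lipschitz boundary; $\Gamma=\partial\Omega\cap\{x_n=0\}$, and $\{x'\in\mathbb{R}^{n-1}:(x',0)\in\Gamma\}$ has non-empty interior in $\mathbb{R}^{n-1}$. Rooms and passages: $B\subset\mathbb{R}^n$ and $D\subset\mathbb{R}^{n-1}$ are bounded domains with Lipschitz boundaries such that $B\subset\{x:\ x'\in(-\frac12,\frac12)^{n-1},\ x_n>0\}$; for some $R\in(0,\frac12)$, $\{x:|x'|<R,\ x_n=0\}\subset\partial B$; and $0\in D\subset\{x'\in\mathbb{R}^{n-1}:|x'|<R\}$. The positive numbers $b^\varepsilon,d^\varepsilon,h^\varepsilon$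 satisfy $d^\varepsilon\le b^\varepsilon\le\varepsilon$, $h^\varepsilon\to0$ as $\varepsilon\to0$, and $\varepsilon^{n-1}\mathbf{D}^\varepsilon\to0$ as $\varepsilon\to0$, where $\mathbf{D}^\varepsilon=|\ln d^\varepsilon|$ if $n=2$ and $\mathbf{D}^\varepsilon=(d^\varepsilon)^{2-n}$ if $n>2$. For $i\in\mathbb{Z}^{n-1}$ let $x^{i,\varepsilon}=(\varepsilon i,0)\in\mathbb{R}^n$ and $$B_i^\varepsilon=\Bigl\{x\in\mathbb{R}^n:\tfrac1{b^\varepsilon}\bigl(x-x^{i,\varepsilon}-(0,h^\varepsilon)\bigr)\in B\Bigr\},\qquad T_i^\varepsilon=\Bigl\{x\in\mathbb{R}^n:\tfrac1{d^\varepsilon}(x'-\varepsilon i)\in D,\ 0\le x_n\le h^\varepsilon\Bigr\}.$$ Let $\mathcal{I}^\varepsilon=\{i\in\mathbb{Z}^{n-1}:\ x^{i,\varepsilon}\in\Gamma,\ \mathrm{dist}(x^{i,\varepsilon},\partial\Omega\setminus\Gamma)\ge\varepsilon\frac{\sqrt n}2\}$ and $\Omega^\varepsilon=\Omega\cup\bigcup_{i\in\mathcal{I}^\varepsilon}(T_i^\varepsilon\cup B_i^\varepsilon)$. The operator $\mathcal{A}^\varepsilon$: let $\varrho^\varepsilon>0$ be constants, $\rho^\varepsilon=\varrho^\varepsilon$ on $\bigcup_{i\in\mathcal{I}^\varepsilon}B_i^\varepsilon$ and $\rho^\varepsilon=1$ on $\Omega\cup\bigcup_{i\in\mathcal{I}^\varepsilon}T_i^\varepsilon$.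 $\mathcal{H}^\varepsilon$ is $L_2(\Omega^\varepsilon)$ with scalar product $(u,v)_{\mathcal{H}^\varepsilon}=\int_{\Omega^\varepsilon}u\bar v\,\rho^\varepsilon\,\mathrm{d}x$, and $\mathcal{A}^\varepsilon$ is the self-adjoint operator in $\mathcal{H}^\varepsilon$ associated with the form $\eta^\varepsilon[u,v]=\int_{\Omega^\varepsilon}\nabla u\cdot\nabla\bar v\,\mathrm{d}x$, $\mathrm{dom}(\eta^\varepsilon)=H^1(\Omega^\varepsilon)$ (i.e. $-\frac1{\rho^\varepsilon}\Delta$ with Neumann boundary conditions). Its spectrum is purely discrete. The limits: $q^\varepsilon=\dfrac{(d^\varepsilon)^{n-1}|D|}{h^\varepsilon\varrho^\varepsilon(b^\varepsilon)^n|B|}$, $r^\varepsilon=\dfrac{\varrho^\varepsilon(b^\varepsilon)^n|B|}{\varepsilon^{n-1}}$; it is assumed that $q=\lim_{\varepsilon\to0}q^\varepsilon\in[0,\infty]$ and $r=\lim_{\varepsilon\to0}r^\varepsilon\in[0,\infty)$ exist. *)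

theory Defs
  imports "HOL-Analysis.Analysis"
begin

section \<open>Domains\<close>

definition domain :: "'a::euclidean_space set \<Rightarrow> bool" where
  "domain S \<longleftrightarrow> open S \<and> connected S"

text \<open>
  Near each boundary point the set is the strict epigraph, in some direction \<open>e\<close>, of a Lipschitz
  function on the hyperplane orthogonal to \<open>e\<close>. On the line this hyperplane is \<open>{0}\<close>, and the
  condition says that the set is a half-line near each boundary point.
\<close>
definition lipschitz_boundary :: "'a::euclidean_space set \<Rightarrow> bool" where
  "lipschitz_boundary S \<longleftrightarrow>
     (\<forall>p\<in>frontier S. \<exists>r>0. \<exists>e L \<phi>. norm e = 1 \<and> L-lipschitz_on {y. y \<bullet> e = 0} \<phi> \<and>
        S \<inter> ball p r = {x \<in> ball p r. \<phi> (x - (x \<bullet> e) *\<^sub>R e) < x \<bullet> e})"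

section \<open>The Sobolev space \<open>H\<^sup>1\<close>\<close>

text \<open>
  Elements of \<open>L\<^sub>2(S)\<close> are represented by functions on the whole space, of which only the values on
  \<open>S\<close> matter, and these only up to null sets.
\<close>
definition L2 :: "'a::euclidean_space set \<Rightarrow> ('a \<Rightarrow> complex) set" where
  "L2 S = {u. u \<in> borel_measurable (lebesgue_on S) \<and>
              integrable (lebesgue_on S) (\<lambda>x. (norm (u x))\<^sup>2)}"

primrec C_diff :: "nat \<Rightarrow> ('a::euclidean_space \<Rightarrow> real) \<Rightarrow> bool" where
  "C_diff 0 f \<longleftrightarrow> continuous_on UNIV f"
| "C_diff (Suc k) f \<longleftrightarrow> (\<forall>x. f differentiable at x) \<and>
     (\<forall>i\<in>Basis. C_diff k (\<lambda>x. frechet_derivative f (at x) i))"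

definition test_function :: "'a::euclidean_space set \<Rightarrow> ('a \<Rightarrow> real) \<Rightarrow> bool" where
  "test_function S \<phi> \<longleftrightarrow> (\<forall>k. C_diff k \<phi>) \<and>
     compact (closure {x. \<phi> x \<noteq> 0}) \<and> closure {x. \<phi> x \<noteq> 0} \<subseteq> S"

definition has_weak_partial ::
  "'a::euclidean_space set \<Rightarrow> 'a \<Rightarrow> ('a \<Rightarrow> complex) \<Rightarrow> ('a \<Rightarrow> complex) \<Rightarrow> bool" where
  "has_weak_partial S i u g \<longleftrightarrow> (\<forall>\<phi>. test_function S \<phi> \<longrightarrow>
     (LINT x|lebesgue_on S. of_real (frechet_derivative \<phi> (at x) i) * u x)
       = - (LINT x|lebesgue_on S. of_real (\<phi> x) * g x))"

definition H1 :: "'a::euclidean_space set \<Rightarrow> ('a \<Rightarrow> complex) set" where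
  "H1 S = {u \<in> L2 S. \<forall>i\<in>Basis. \<exists>g\<in>L2 S. has_weak_partial S i u g}"

text \<open>For open \<open>S\<close> the weak derivative is unique up to null sets, so the choice is immaterial.\<close>
definition weak_partial ::
  "'a::euclidean_space set \<Rightarrow> 'a \<Rightarrow> ('a \<Rightarrow> complex) \<Rightarrow> 'a \<Rightarrow> complex" where
  "weak_partial S i u = (SOME g. g \<in> L2 S \<and> has_weak_partial S i u g)"

section \<open>The weighted Neumann Laplacian and its eigenvalues\<close>

definition weighted_inner ::
  "'a::euclidean_space set \<Rightarrow> ('a \<Rightarrow> real) \<Rightarrow> ('a \<Rightarrow> complex) \<Rightarrow> ('a \<Rightarrow> complex) \<Rightarrow> complex" where
  "weighted_inner S \<rho> u v = (LINT x|lebesgue_on S. u x * cnj (v x) * of_real (\<rho> x))"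

definition dirichlet_form ::
  "'a::euclidean_space set \<Rightarrow> ('a \<Rightarrow> complex) \<Rightarrow> ('a \<Rightarrow> complex) \<Rightarrow> complex" where
  "dirichlet_form S u v =
     (LINT x|lebesgue_on S. (\<Sum>i\<in>Basis. weak_partial S i u x * cnj (weak_partial S i v x)))"

text \<open>
  The graph of the operator associated with the form by the first representation theorem: \<open>u\<close> is in
  the operator domain, with image \<open>f\<close>, iff \<open>\<eta>[u,v] = (f,v)\<close> for all \<open>v\<close> in the form domain.
\<close>
definition neumann_op ::
  "'a::euclidean_space set \<Rightarrow> ('a \<Rightarrow> real) \<Rightarrow> (('a \<Rightarrow> complex) \<times> ('a \<Rightarrow> complex)) set" where
  "neumann_op S \<rho> = {(u, f). u \<in> H1 S \<and> f \<in> L2 S \<and>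
     (\<forall>v\<in>H1 S. dirichlet_form S u v = weighted_inner S \<rho> f v)}"

definition eigenspace ::
  "(('a \<Rightarrow> complex) \<times> ('a \<Rightarrow> complex)) set \<Rightarrow> complex \<Rightarrow> ('a \<Rightarrow> complex) set" where
  "eigenspace A \<mu> = {u. (u, \<lambda>x. \<mu> * u x) \<in> A}"

text \<open>The complex dimension of \<open>E\<close> after identification of functions that agree almost everywhere.\<close>
definition has_dim_ae :: "'a measure \<Rightarrow> ('a \<Rightarrow> complex) set \<Rightarrow> nat \<Rightarrow> bool" where
  "has_dim_ae M E m \<longleftrightarrow> (\<exists>e :: nat \<Rightarrow> 'a \<Rightarrow> complex.
     (\<forall>j<m. e j \<in> E) \<and>
     (\<forall>c. (AE x in M. (\<Sum>j<m. c j * e j x) = 0) \<longrightarrow> (\<forall>j<m. c j = 0)) \<and>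
     (\<forall>u\<in>E. \<exists>c. AE x in M. u x = (\<Sum>j<m. c j * e j x)))"

text \<open>
  \<open>\<Lambda>\<close> lists the eigenvalues in ascending order, each repeated according to its multiplicity. Real
  \<open>\<mu>\<close> suffice because the operator is self-adjoint; \<open>\<mu>\<close> is not an eigenvalue iff its eigenspace has
  dimension \<open>0\<close>.
\<close>
definition eigenvalue_sequence ::
  "'a::euclidean_space set \<Rightarrow> ('a \<Rightarrow> real) \<Rightarrow> (nat \<Rightarrow> real) \<Rightarrow> bool" where
  "eigenvalue_sequence S \<rho> \<Lambda> \<longleftrightarrow> mono \<Lambda> \<and>
     (\<forall>\<mu>. finite {k. \<Lambda> k = \<mu>} \<and>
          has_dim_ae (lebesgue_on S) (eigenspace (neumann_op S \<rho>) (of_real \<mu>))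
            (card {k. \<Lambda> k = \<mu>}))"

section \<open>Rooms and passages\<close>

text \<open>
  A point \<open>x = (x', x\<^sub>n)\<close> of \<open>n\<close>-space is a pair in \<open>(real ^ 'm) \<times> real\<close>, with \<open>n = CARD('m) + 1\<close>;
  the norm and Lebesgue measure of the product type are the Euclidean ones.
\<close>

definition flat_part :: "((real ^ 'm) \<times> real) set \<Rightarrow> ((real ^ 'm) \<times> real) set" where
  "flat_part \<Omega> = frontier \<Omega> \<inter> {x. snd x = 0}"

definition lattice_point :: "real \<Rightarrow> int ^ 'm \<Rightarrow> real ^ 'm" where
  "lattice_point \<epsilon> i = (\<chi> j. \<epsilon> * of_int (i $ j))"

definition room ::
  "((real ^ 'm) \<times> real) set \<Rightarrow> real \<Rightarrow> real \<Rightarrow> real \<Rightarrow> int ^ 'm \<Rightarrow> ((real ^ 'm) \<times> real) set" where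
  "room B \<epsilon> b h i = {x. (1 / b) *\<^sub>R (x - (lattice_point \<epsilon> i, 0) - (0, h)) \<in> B}"

definition passage ::
  "(real ^ 'm) set \<Rightarrow> real \<Rightarrow> real \<Rightarrow> real \<Rightarrow> int ^ 'm \<Rightarrow> ((real ^ 'm) \<times> real) set" where
  "passage D \<epsilon> d h i =
     {x. (1 / d) *\<^sub>R (fst x - lattice_point \<epsilon> i) \<in> D \<and> 0 \<le> snd x \<and> snd x \<le> h}"

text \<open>
  For a nonempty bounded open \<open>\<Omega>\<close> in the lower half-space, \<open>frontier \<Omega> - flat_part \<Omega>\<close> is nonempty,
  so \<open>infdist\<close> is the genuine distance.
\<close>
definition room_indices :: "((real ^ 'm) \<times> real) set \<Rightarrow> real \<Rightarrow> (int ^ 'm) set" where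
  "room_indices \<Omega> \<epsilon> = {i. (lattice_point \<epsilon> i, 0) \<in> flat_part \<Omega> \<and>
     infdist (lattice_point \<epsilon> i, 0) (frontier \<Omega> - flat_part \<Omega>)
       \<ge> \<epsilon> * sqrt (real (CARD('m) + 1)) / 2}"

definition perturbed_domain ::
  "((real ^ 'm) \<times> real) set \<Rightarrow> ((real ^ 'm) \<times> real) set \<Rightarrow> (real ^ 'm) set \<Rightarrow>
     real \<Rightarrow> real \<Rightarrow> real \<Rightarrow> real \<Rightarrow> ((real ^ 'm) \<times> real) set" where
  "perturbed_domain \<Omega> B D \<epsilon> b d h =
     \<Omega> \<union> (\<Union>i\<in>room_indices \<Omega> \<epsilon>. passage D \<epsilon> d h i \<union> room B \<epsilon> b h i)"

definition mass_density ::
  "((real ^ 'm) \<times> real) set \<Rightarrow> ((real ^ 'm) \<times> real) set \<Rightarrow>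
     real \<Rightarrow> real \<Rightarrow> real \<Rightarrow> real \<Rightarrow> (real ^ 'm) \<times> real \<Rightarrow> real" where
  "mass_density \<Omega> B \<epsilon> b h \<sigma> x =
     (if x \<in> (\<Union>i\<in>room_indices \<Omega> \<epsilon>. room B \<epsilon> b h i) then \<sigma> else 1)"

definition passage_scale :: "nat \<Rightarrow> real \<Rightarrow> real" where
  "passage_scale n d = (if n = 2 then \<bar>ln d\<bar> else d powi (2 - int n))"

end

theory Submission
  imports Defs
begin

text \<open>
  Fix a small \<open>\<epsilon>\<close> and, for each room, take the function that equals 1 in the room, vanishes outside the
  room and its passage, and grows linearly along the passage. Its Dirichlet integral is at most
  \<open>d ^ (n - 1) * |D| / h\<close>, its weighted square norm is at least \<open>\<sigma> * b ^ n * |B|\<close>, and functions that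
  belong to different rooms have disjoint supports. Their span is thus a space on which the Rayleigh
  quotient is at most \<open>q\<^sup>\<epsilon> = d ^ (n - 1) * |D| / (h * \<sigma> * b ^ n * |B|)\<close> and whose dimension is the number
  of rooms. Near an interior point of the flat part the Lipschitz domain is a half ball, so the rest of
  the boundary stays away, the number of rooms tends to infinity (\<open>many_rooms\<close>), and the min-max principle gives \<open>\<Lambda> \<epsilon> k \<le> q\<^sup>\<epsilon>\<close> as soon as there are more
  than \<open>k\<close> rooms.

  The substance lies in the min-max principle (\<open>eigenvalue_upper_bound\<close>), because a list of all
  eigenvalues does not by itself exclude other spectrum below \<open>\<mu>\<close>. If there are fewer eigenvalues up
  to \<open>\<mu>\<close> than trial functions, then some combination of the trial functions is orthogonal to all their
  eigenfunctions. A minimiser of the Rayleigh quotient on the orthogonal complement of the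
  eigenfunctions is a further eigenfunction with eigenvalue at most \<open>\<mu>\<close> (\<open>exists_new_eigenvector\<close>),
  which is absurd. Existence of the minimiser is where the geometry enters. Instead of a compact
  embedding, the following inequality is used: for every \<open>\<delta> > 0\<close> there are finitely many sets \<open>Q\<close> with
  \<open>\<integral>|u|\<^sup>2 \<le> \<delta> * \<integral>|\<nabla>u|\<^sup>2 + C * (\<Sum>Q. |\<integral>\<^sub>Q u|\<^sup>2)\<close>
  (\<open>coercive_on\<close>). If \<open>\<delta> * \<mu> < 1\<close>, a minimising sequence along which these finitely many integrals
  converge is a Cauchy sequence, by the parallelogram law.

  The inequality holds on compact subsets of an open set, which are cut into small cubes with a
  Poincare inequality on each, and it extends up to the boundary if a small translation carries the
  points near each boundary point into the set (\<open>inward\<close>). Lipschitz domains admit such translations,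
  and so do products of such sets, hence also the passages. It passes to finite unions up to null
  sets, which covers the perturbed domain in spite of its reentrant edges. All estimates on weak
  derivatives come from one identity, \<open>u (x + v) - u x = \<integral>\<^sub>0\<^sup>1 \<partial>\<^sub>v u (x + t v) dt\<close> for almost every \<open>x\<close>
  (\<open>weak_derivative_translation\<close>), which is proved by duality with test functions.
\<close>

section \<open>Hermitian forms and minimisation of the Rayleigh quotient\<close>

text \<open>
  Elimination: an equation with a nonzero coefficient is solved for the corresponding unknown, which
  removes one equation and one unknown.
\<close>
lemma homogeneous_system_nontrivial:
  fixes a :: "'i \<Rightarrow> 'j \<Rightarrow> 'c::field"
  assumes "finite I" "finite J" "card I < card J"
  shows "\<exists>c. (\<exists>j\<in>J. c j \<noteq> 0) \<and> (\<forall>i\<in>I. (\<Sum>j\<in>J. c j * a i j) = 0)"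
  using assms
proof (induction I arbitrary: J a rule: finite_induct)
  case empty
  then obtain j where "j \<in> J" by (metis card_gt_0_iff card.empty ex_in_conv)
  then show ?case by (intro exI[of _ "\<lambda>_. 1"]) auto
next
  case (insert i I)
  show ?case
  proof (cases "\<forall>j\<in>J. a i j = 0")
    case True
    have "card I < card J" using insert by simp
    from insert.IH[OF insert.prems(1) this, of a] obtain c
      where c: "\<exists>j\<in>J. c j \<noteq> 0" "\<forall>k\<in>I. (\<Sum>j\<in>J. c j * a k j) = 0" by blast
    have "(\<Sum>j\<in>J. c j * a i j) = 0" by (rule sum.neutral) (simp add: True)
    then show ?thesis using c by blast
  next
    case False
    then obtain j0 where j0: "j0 \<in> J" "a i j0 \<noteq> 0" by blast
    define J' where "J' = J - {j0}"
    have J': "finite J'" "card I < card J'" "j0 \<notin> J'" "J = insert j0 J'"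
      using insert j0 by (auto simp: J'_def)
    define a' where "a' k j = a k j - a k j0 * a i j / a i j0" for k j
    obtain c' where c': "\<exists>j\<in>J'. c' j \<noteq> 0" "\<forall>k\<in>I. (\<Sum>j\<in>J'. c' j * a' k j) = 0"
      using insert.IH[OF J'(1,2), of a'] by blast
    define t where "t = - (\<Sum>j\<in>J'. c' j * a i j) / a i j0"
    define c where "c j = (if j = j0 then t else c' j)" for j
    have S: "(\<Sum>j\<in>J. c j * a k j) = t * a k j0 + (\<Sum>j\<in>J'. c' j * a k j)" for k
    proof -
      have "(\<Sum>j\<in>J'. c j * a k j) = (\<Sum>j\<in>J'. c' j * a k j)"
        by (rule sum.cong) (use J' in \<open>auto simp: c_def\<close>)
      then show ?thesis using J' by (simp add: c_def)
    qed
    have "(\<Sum>j\<in>J. c j * a k j) = 0" if "k \<in> insert i I" for k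
    proof (cases "k = i")
      case True
      then show ?thesis using j0 by (simp add: S t_def)
    next
      case False
      then have "0 = (\<Sum>j\<in>J'. c' j * a' k j)" using c' that by auto
      also have "\<dots> = (\<Sum>j\<in>J'. c' j * a k j) - (\<Sum>j\<in>J'. (c' j * a i j) * (a k j0 / a i j0))"
        by (simp add: a'_def algebra_simps sum_subtractf)
      also have "(\<Sum>j\<in>J'. (c' j * a i j) * (a k j0 / a i j0)) = - t * a k j0"
        unfolding sum_distrib_right[symmetric] by (simp add: t_def)
      finally show ?thesis by (simp add: S add.commute)
    qed
    moreover have "\<exists>j\<in>J. c j \<noteq> 0" using c'(1) J' by (auto simp: c_def)
    ultimately show ?thesis by blast
  qed
qed

lemma bounded_family_convergent_subseq:
  fixes a :: "'j \<Rightarrow> nat \<Rightarrow> complex"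
  assumes "finite J" "\<And>j. j \<in> J \<Longrightarrow> bounded (range (a j))"
  shows "\<exists>r. strict_mono r \<and> (\<forall>j\<in>J. convergent (\<lambda>m. a j (r m)))"
  using assms
proof (induction J rule: finite_induct)
  case empty
  then show ?case by (auto intro: exI[of _ id] simp: strict_mono_id)
next
  case (insert j J)
  then obtain r where r: "strict_mono r" "\<forall>j\<in>J. convergent (\<lambda>m. a j (r m))" by auto
  have "bounded (range (\<lambda>m. a j (r m)))"
    using insert.prems[of j] by (auto intro: bounded_subset)
  then obtain l r' where r': "strict_mono r'" "((\<lambda>m. a j (r m)) \<circ> r') \<longlonglongrightarrow> l"
    using bounded_imp_convergent_subsequence by blast
  have "convergent (\<lambda>m. a k ((r \<circ> r') m))" if "k \<in> insert j J" for k
  proof (cases "k = j")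
    case True
    then show ?thesis using r'(2) by (auto simp: o_def convergent_def)
  next
    case False
    then have "convergent (\<lambda>m. a k (r m))" using that r by auto
    then show ?thesis
      using convergent_subseq_convergent[OF _ r'(1), of "\<lambda>m. a k (r m)"] by (simp add: o_def)
  qed
  then show ?case using strict_mono_o[OF r(1) r'(1)] by blast
qed

text \<open>
  The forms are only semidefinite, for two reasons: functions that agree almost everywhere are not
  identified, and the difference of the two forms at the minimum of the Rayleigh quotient has a
  kernel, which is the eigenspace.
\<close>
locale hermitian_form =
  fixes V :: "('a \<Rightarrow> complex) set" and s :: "('a \<Rightarrow> complex) \<Rightarrow> ('a \<Rightarrow> complex) \<Rightarrow> complex"
  assumes zero: "(\<lambda>_. 0) \<in> V"
    and lincomb: "u \<in> V \<Longrightarrow> v \<in> V \<Longrightarrow> (\<lambda>x. u x + c * v x) \<in> V"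
    and lin: "u \<in> V \<Longrightarrow> v \<in> V \<Longrightarrow> w \<in> V \<Longrightarrow> s (\<lambda>x. u x + c * v x) w = s u w + c * s v w"
    and herm: "u \<in> V \<Longrightarrow> v \<in> V \<Longrightarrow> s v u = cnj (s u v)"
    and pos: "u \<in> V \<Longrightarrow> 0 \<le> Re (s u u)"
begin

abbreviation sq where "sq u \<equiv> Re (s u u)"

lemma lin_right: "u \<in> V \<Longrightarrow> v \<in> V \<Longrightarrow> w \<in> V \<Longrightarrow> s w (\<lambda>x. u x + c * v x) = s w u + cnj c * s w v"
  using lin[of u v w c] herm[of "\<lambda>x. u x + c * v x" w] herm[of u w] herm[of v w] lincomb[of u v c]
  by simp

lemma diag: "u \<in> V \<Longrightarrow> s u u = of_real (sq u)"
  using herm[of u u] by (simp add: complex_eq_iff)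

lemma sq_add: "u \<in> V \<Longrightarrow> v \<in> V \<Longrightarrow>
    sq (\<lambda>x. u x + c * v x) = sq u + 2 * Re (cnj c * s u v) + (norm c)\<^sup>2 * sq v"
proof -
  assume *: "u \<in> V" "v \<in> V"
  have "s (\<lambda>x. u x + c * v x) (\<lambda>x. u x + c * v x)
      = s u u + cnj c * s u v + c * (cnj (s u v) + cnj c * s v v)"
    using * lincomb[of u v c] herm[of u v] by (simp add: lin lin_right)
  also have "\<dots> = s u u + (cnj c * s u v + cnj (cnj c * s u v)) + (c * cnj c) * s v v"
    by (simp add: algebra_simps)
  also have "\<dots> = of_real (sq u + 2 * Re (cnj c * s u v) + (norm c)\<^sup>2 * sq v)"
    unfolding complex_add_cnj complex_norm_square[symmetric]
    using diag[OF *(1)] diag[OF *(2)] by simp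
  finally show ?thesis by simp
qed

lemma cauchy_schwarz: 
  assumes "u \<in> V" "v \<in> V"
  shows "(norm (s u v))\<^sup>2 \<le> sq u * sq v"
proof -
  define a where "a = (norm (s u v))\<^sup>2"
  have *: "0 \<le> sq u - 2 * t * a + t\<^sup>2 * a * sq v" for t :: real
  proof -
    \<comment> \<open>this choice makes the cross term real, so that the expansion is a quadratic in \<open>t\<close>\<close>
    define c where "c = - of_real t * s u v"
    have "Re (cnj c * s u v) = - t * a"
    proof -
      have "cnj c * s u v = - of_real t * (s u v * cnj (s u v))"
        by (simp add: c_def)
      also have "\<dots> = of_real (- t * a)" by (simp add: a_def complex_norm_square[symmetric])
      finally show ?thesis by simp
    qed
    moreover have "(norm c)\<^sup>2 = t\<^sup>2 * a" by (simp add: c_def a_def norm_mult power_mult_distrib)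
    ultimately show ?thesis
      using sq_add[OF assms, of c] pos[OF lincomb[OF assms, of c]] by simp
  qed
  have a0: "0 \<le> a" by (simp add: a_def)
  show ?thesis
  proof (cases "sq v = 0")
    case True
    have "a = 0"
    proof (rule ccontr)
      assume "a \<noteq> 0"
      then have "a > 0" using a0 by simp
      then show False using *[of "(sq u + 1) / (2 * a)"] True by (simp add: field_simps)
    qed
    then show ?thesis using True by (simp add: a_def)
  next
    case False
    then have "sq v > 0" using pos[OF assms(2)] by simp
    then have "0 \<le> sq u - a / sq v"
      using *[of "1 / sq v"] by (simp add: field_simps power2_eq_square)
    then show ?thesis using \<open>sq v > 0\<close> by (simp add: a_def field_simps)
  qed
qed

text \<open>
  Applied to the form that is minimised, this is the Euler-Lagrange equation of a minimiser.
\<close>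
lemma null_vector: "u \<in> V \<Longrightarrow> v \<in> V \<Longrightarrow> sq u = 0 \<Longrightarrow> s u v = 0"
  using cauchy_schwarz[of u v] by simp

lemma sub: "u \<in> V \<Longrightarrow> v \<in> V \<Longrightarrow> (\<lambda>x. u x - v x) \<in> V"
  using lincomb[of u v "-1"] by simp

lemma s_sub: "u \<in> V \<Longrightarrow> v \<in> V \<Longrightarrow> w \<in> V \<Longrightarrow> s (\<lambda>x. u x - v x) w = s u w - s v w"
  using lin[of u v w "-1"] by simp

lemma s_sub_right: "u \<in> V \<Longrightarrow> v \<in> V \<Longrightarrow> w \<in> V \<Longrightarrow> s w (\<lambda>x. u x - v x) = s w u - s w v"
  using lin_right[of u v w "-1"] by simp

lemma parallelogram: "u \<in> V \<Longrightarrow> v \<in> V \<Longrightarrow>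
    sq (\<lambda>x. u x + v x) + sq (\<lambda>x. u x - v x) = 2 * sq u + 2 * sq v"
  using sq_add[of u v 1] sq_add[of u v "-1"] by simp

lemma s_zero: "v \<in> V \<Longrightarrow> s (\<lambda>_. 0) v = 0"
  using lin[of "\<lambda>_. 0" "\<lambda>_. 0" v 1] zero by simp

lemma sum_mem: "finite J \<Longrightarrow> (\<And>j. j \<in> J \<Longrightarrow> e j \<in> V) \<Longrightarrow> (\<lambda>x. \<Sum>j\<in>J. c j * e j x) \<in> V"
proof (induction J rule: finite_induct)
  case (insert j J)
  then show ?case using lincomb[of "\<lambda>x. \<Sum>j\<in>J. c j * e j x" "e j" "c j"] by (simp add: add.commute)
qed (simp add: zero)

lemma s_sum: "finite J \<Longrightarrow> (\<And>j. j \<in> J \<Longrightarrow> e j \<in> V) \<Longrightarrow> v \<in> V \<Longrightarrow>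
    s (\<lambda>x. \<Sum>j\<in>J. c j * e j x) v = (\<Sum>j\<in>J. c j * s (e j) v)"
proof (induction J rule: finite_induct)
  case (insert j J)
  then show ?case using lin[of "\<lambda>x. \<Sum>j\<in>J. c j * e j x" "e j" v "c j"] sum_mem[of J e c]
    by (simp add: add.commute)
qed (simp add: s_zero)

lemma s_sum_right: "finite J \<Longrightarrow> (\<And>j. j \<in> J \<Longrightarrow> e j \<in> V) \<Longrightarrow> v \<in> V \<Longrightarrow>
    s v (\<lambda>x. \<Sum>j\<in>J. c j * e j x) = (\<Sum>j\<in>J. cnj (c j) * s v (e j))"
  using s_sum[of J e v c] sum_mem[of J e c] herm[of "\<lambda>x. \<Sum>j\<in>J. c j * e j x" v]
    herm[of "e _" v] by simp

lemma sq_sum_orthogonal: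
  assumes "finite J" "\<And>j. j \<in> J \<Longrightarrow> e j \<in> V" "\<And>i j. i \<in> J \<Longrightarrow> j \<in> J \<Longrightarrow> i \<noteq> j \<Longrightarrow> s (e i) (e j) = 0"
  shows "sq (\<lambda>x. \<Sum>j\<in>J. c j * e j x) = (\<Sum>j\<in>J. (norm (c j))\<^sup>2 * sq (e j))"
proof -
  have "s (e j) (\<lambda>x. \<Sum>j\<in>J. c j * e j x) = cnj (c j) * s (e j) (e j)" if "j \<in> J" for j
  proof -
    have "s (e j) (\<lambda>x. \<Sum>j\<in>J. c j * e j x) = (\<Sum>i\<in>J. cnj (c i) * s (e j) (e i))"
      using that assms by (intro s_sum_right) auto
    also have "\<dots> = (\<Sum>i\<in>J. if i = j then cnj (c i) * s (e j) (e i) else 0)"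
      using that assms(3) by (intro sum.cong) auto
    finally show ?thesis using that assms(1) by simp
  qed
  then have "s (\<lambda>x. \<Sum>j\<in>J. c j * e j x) (\<lambda>x. \<Sum>j\<in>J. c j * e j x)
      = (\<Sum>j\<in>J. c j * (cnj (c j) * s (e j) (e j)))"
    using assms(1,2) sum_mem[OF assms(1,2)] by (subst s_sum) auto
  also have "\<dots> = (\<Sum>j\<in>J. of_real ((norm (c j))\<^sup>2 * sq (e j)))"
    using assms(2) by (intro sum.cong) (simp_all only: of_real_mult complex_norm_square diag[symmetric] mult.assoc)
  finally show ?thesis by simp
qed

lemma sq_tendsto:
  assumes "\<And>m. f m \<in> V" "u \<in> V" "(\<lambda>m. sq (\<lambda>x. f m x - u x)) \<longlonglongrightarrow> 0" and "w \<in> V"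
  shows "(\<lambda>m. s (f m) w) \<longlonglongrightarrow> s u w" "(\<lambda>m. sq (f m)) \<longlonglongrightarrow> sq u"
proof -
  have *: "(\<lambda>m. s (\<lambda>x. f m x - u x) v) \<longlonglongrightarrow> 0" if "v \<in> V" for v
  proof (rule Lim_null_comparison)
    show "\<forall>\<^sub>F m in sequentially. norm (s (\<lambda>x. f m x - u x) v) \<le> sqrt (sq (\<lambda>x. f m x - u x) * sq v)"
      using cauchy_schwarz sub assms that by (intro always_eventually allI real_le_rsqrt) auto
    have "(\<lambda>m. sqrt (sq (\<lambda>x. f m x - u x) * sq v)) \<longlonglongrightarrow> sqrt (0 * sq v)"
      by (intro tendsto_intros assms)
    then show "(\<lambda>m. sqrt (sq (\<lambda>x. f m x - u x) * sq v)) \<longlonglongrightarrow> 0" by simp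
  qed
  have 1: "(\<lambda>m. s (f m) v) \<longlonglongrightarrow> s u v" if "v \<in> V" for v
    using *[OF that] s_sub[OF assms(1,2) that] by (simp add: LIM_zero_iff)
  then show "(\<lambda>m. s (f m) w) \<longlonglongrightarrow> s u w" using assms by simp
  have eq: "sq (f m) = sq (\<lambda>x. f m x - u x) + 2 * Re (s (f m) u) - sq u" for m
    using sq_add[OF assms(1,2), of m "-1"] by simp
  have "(\<lambda>m. sq (\<lambda>x. f m x - u x) + 2 * Re (s (f m) u) - sq u) \<longlonglongrightarrow> 0 + 2 * Re (s u u) - sq u"
    by (intro tendsto_intros assms 1)
  then show "(\<lambda>m. sq (f m)) \<longlonglongrightarrow> sq u" unfolding eq by simp
qed

text \<open>
  One step of the Gram-Schmidt process for each vector. The part \<open>e1\<close> of the new vector that is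
  orthogonal to the previous ones may be null; then \<open>t = 0\<close> by the convention for division by zero,
  and a null vector is orthogonal to everything.
\<close>
lemma exists_projection:
  assumes "finite J" "\<And>j. j \<in> J \<Longrightarrow> e j \<in> V" "w \<in> V"
  shows "\<exists>c. \<forall>j\<in>J. s (\<lambda>x. w x - (\<Sum>i\<in>J. c i * e i x)) (e j) = 0"
  using assms
proof (induction J arbitrary: w rule: finite_induct)
  case (insert k J)
  obtain c where c: "\<forall>j\<in>J. s (\<lambda>x. w x - (\<Sum>i\<in>J. c i * e i x)) (e j) = 0"
    using insert.IH[of w] insert.prems by auto
  obtain d where d: "\<forall>j\<in>J. s (\<lambda>x. e k x - (\<Sum>i\<in>J. d i * e i x)) (e j) = 0"
    using insert.IH[of "e k"] insert.prems by auto
  define p where "p x = (\<Sum>i\<in>J. d i * e i x)" for x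
  define w1 where "w1 x = w x - (\<Sum>i\<in>J. c i * e i x)" for x
  define e1 where "e1 x = e k x - p x" for x
  have V: "w1 \<in> V" "e1 \<in> V" "p \<in> V" "e k \<in> V" "\<And>j. j \<in> J \<Longrightarrow> e j \<in> V"
    using insert sum_mem[of J e c] sum_mem[of J e d]
    by (auto simp: w1_def[abs_def] e1_def[abs_def] p_def[abs_def] intro!: sub)
  have orth: "s w1 (e j) = 0" "s e1 (e j) = 0" if "j \<in> J" for j
    using c d that by (auto simp: w1_def[abs_def] e1_def[abs_def] p_def[abs_def])
  have orth_p: "s w1 p = 0" "s e1 p = 0"
    using V insert.hyps orth unfolding p_def[abs_def] by (subst s_sum_right; simp)+
  have ek: "s w1 (e k) = s w1 e1" "s e1 (e k) = s e1 e1"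
    using s_sub_right[of "e k" p w1] s_sub_right[of "e k" p e1] V orth_p
    by (auto simp: e1_def[symmetric, abs_def])
  define t where "t = s w1 e1 / s e1 e1"
  define w2 where "w2 x = w1 x + (- t) * e1 x" for x
  have "s w2 (e j) = 0" if "j \<in> insert k J" for j
  proof (cases "j = k")
    case True
    have "s w2 (e k) = s w1 e1 - t * s e1 e1"
      using lin[of w1 e1 "e k" "-t"] V ek by (simp add: w2_def[abs_def])
    also have "\<dots> = 0"
    proof (cases "s e1 e1 = 0")
      case True
      then have "s e1 w1 = 0" using null_vector[of e1 w1] V by simp
      then show ?thesis using herm[of e1 w1] V True by simp
    qed (simp add: t_def)
    finally show ?thesis using True by simp
  next
    case False
    then show ?thesis using that V orth lin[of w1 e1 "e j" "-t"] by (simp add: w2_def[abs_def])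
  qed
  moreover have "w2 = (\<lambda>x. w x - (\<Sum>i\<in>insert k J. (if i = k then t else c i - t * d i) * e i x))"
  proof
    fix x
    have eq: "(\<Sum>i\<in>J. (if i = k then t else c i - t * d i) * e i x) = (\<Sum>i\<in>J. (c i - t * d i) * e i x)"
      using insert.hyps by (intro sum.cong) auto
    then show "w2 x = w x - (\<Sum>i\<in>insert k J. (if i = k then t else c i - t * d i) * e i x)"
      unfolding sum.insert[OF insert.hyps] eq
      by (simp add: w2_def w1_def e1_def p_def algebra_simps sum_subtractf sum_distrib_left sum_negf)
  qed
  ultimately show ?case by (intro exI[of _ "\<lambda>i. if i = k then t else c i - t * d i"]) auto
qed simp

end

text \<open>
  Completeness is that of the common domain in the norm built from both forms, as for a closed
  quadratic form.
\<close>
locale form_pair = ip: hermitian_form V ip + en: hermitian_form V en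
  for V :: "('a \<Rightarrow> complex) set" and ip en +
  assumes complete: "(\<And>m. f m \<in> V) \<Longrightarrow>
     (\<And>e. e > 0 \<Longrightarrow> \<exists>N. \<forall>m\<ge>N. \<forall>p\<ge>N. ip.sq (\<lambda>x. f m x - f p x) < e \<and> en.sq (\<lambda>x. f m x - f p x) < e) \<Longrightarrow>
     \<exists>u\<in>V. (\<lambda>m. ip.sq (\<lambda>x. f m x - u x)) \<longlonglongrightarrow> 0 \<and> (\<lambda>m. en.sq (\<lambda>x. f m x - u x)) \<longlonglongrightarrow> 0"
begin

text \<open>
  The direct method. Let \<open>\<nu>\<close> be the infimum of the Rayleigh quotient on the orthogonal complement \<open>W\<close>
  of the vectors \<open>e j\<close>. The form \<open>F = en - \<nu> * ip\<close> is semidefinite on \<open>W\<close>, so by the parallelogram law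
  it is small on differences of members of a normalised minimising sequence. Along a subsequence on
  which the functionals \<open>l k\<close> converge, the hypothesis on them bounds \<open>ip\<close> of such a difference by
  \<open>\<delta> * en\<close> up to small terms, hence by \<open>\<delta> * \<nu> * ip\<close>, and \<open>\<delta> * \<nu> < 1\<close> makes the sequence Cauchy. The
  limit is a null vector of \<open>F\<close>.
\<close>
theorem rayleigh_minimiser:
  assumes E: "finite J" "\<And>j. j \<in> J \<Longrightarrow> e j \<in> V"
    and v: "v \<in> V" "\<And>j. j \<in> J \<Longrightarrow> ip v (e j) = 0" "0 < ip.sq v" "en.sq v \<le> \<mu> * ip.sq v"
    and L: "finite L" "\<And>k u w. k \<in> L \<Longrightarrow> u \<in> V \<Longrightarrow> w \<in> V \<Longrightarrow> l k (\<lambda>x. u x - w x) = l k u - l k w"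
      "\<And>k u. k \<in> L \<Longrightarrow> u \<in> V \<Longrightarrow> (norm (l k u))\<^sup>2 \<le> K * ip.sq u"
      "\<And>u. u \<in> V \<Longrightarrow> ip.sq u \<le> \<delta> * en.sq u + C * (\<Sum>k\<in>L. (norm (l k u :: complex))\<^sup>2)"
      "0 \<le> \<delta>" "\<delta> * \<mu> < 1"
  shows "\<exists>\<nu> u. \<nu> \<le> \<mu> \<and> u \<in> V \<and> ip.sq u = 1 \<and> (\<forall>j\<in>J. ip u (e j) = 0) \<and>
    (\<forall>w\<in>V. (\<forall>j\<in>J. ip w (e j) = 0) \<longrightarrow> en u w = of_real \<nu> * ip u w)"
proof -
  define W where "W = {u\<in>V. \<forall>j\<in>J. ip u (e j) = 0}"
  have WV: "u \<in> V" if "u \<in> W" for u using that by (simp add: W_def)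
  have W_lincomb: "(\<lambda>x. u x + c * w x) \<in> W" if "u \<in> W" "w \<in> W" for u w c
    using that E by (auto simp: W_def ip.lincomb ip.lin)
  define R where "R = {en.sq u | u. u \<in> W \<and> ip.sq u = 1}"
  define \<nu> where "\<nu> = Inf R"
  have normalize: "\<exists>u'\<in>W. ip.sq u' = 1 \<and> en.sq u' = en.sq u / ip.sq u" if "u \<in> W" "0 < ip.sq u" for u
  proof -
    define c where "c = complex_of_real (1 / sqrt (ip.sq u))"
    have z: "(\<lambda>_. 0) \<in> W" using E ip.zero by (auto simp: W_def ip.s_zero)
    have c: "(norm c)\<^sup>2 = 1 / ip.sq u" using that(2) by (simp add: c_def norm_divide power_divide)
    have "ip.sq (\<lambda>x. 0 + c * u x) = 1"
      unfolding ip.sq_add[OF ip.zero WV[OF that(1)]] c using that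
      by (simp add: ip.s_zero ip.zero WV)
    moreover have "en.sq (\<lambda>x. 0 + c * u x) = en.sq u / ip.sq u"
      unfolding en.sq_add[OF ip.zero WV[OF that(1)]] c using that
      by (simp add: en.s_zero en.zero WV)
    ultimately show ?thesis using W_lincomb[OF z that(1), of c] by blast
  qed
  have vW: "v \<in> W" using v by (simp add: W_def)
  have bdd: "bdd_below R" by (rule bdd_belowI[of _ 0]) (auto simp: R_def en.pos WV)
  obtain v' where v': "v' \<in> W" "ip.sq v' = 1" "en.sq v' \<le> \<mu>"
    using normalize[OF vW v(3)] v by (auto simp: divide_le_eq)
  have Rne: "R \<noteq> {}" using v' by (auto simp: R_def)
  have \<nu>\<mu>: "\<nu> \<le> \<mu>"
    using cInf_lower[OF _ bdd, of "en.sq v'"] v' by (force simp: \<nu>_def R_def)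
  have \<nu>_pos: "0 \<le> \<nu>" unfolding \<nu>_def
    by (rule cInf_greatest[OF Rne]) (auto simp: R_def en.pos WV)
  have \<nu>_le: "\<nu> * ip.sq u \<le> en.sq u" if uW: "u \<in> W" for u
  proof (cases "ip.sq u = 0")
    case True
    then show ?thesis using en.pos WV uW by simp
  next
    case False
    then have p: "0 < ip.sq u" using ip.pos[of u] WV[OF uW] by simp
    obtain u' where u': "u'\<in>W" "ip.sq u' = 1" "en.sq u' = en.sq u / ip.sq u"
      using normalize[OF uW p] by blast
    have "en.sq u / ip.sq u \<in> R" unfolding R_def using u' by (intro CollectI exI[of _ u'] conjI u'(3)[symmetric])
    then have "\<nu> \<le> en.sq u / ip.sq u" unfolding \<nu>_def using bdd by (rule cInf_lower)
    then show ?thesis using p by (simp add: le_divide_eq)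
  qed
  interpret F: hermitian_form W "\<lambda>u w. en u w - of_real \<nu> * ip u w"
  proof
    show "(\<lambda>_. 0) \<in> W" using E ip.zero by (auto simp: W_def ip.s_zero)
    show "0 \<le> Re (en u u - complex_of_real \<nu> * ip u u)" if "u \<in> W" for u
      using \<nu>_le[OF that] by simp
    show "en v u - complex_of_real \<nu> * ip v u = cnj (en u v - complex_of_real \<nu> * ip u v)"
      if "u \<in> W" "v \<in> W" for u v
      using that ip.herm[of u v] en.herm[of u v] WV by simp
  qed (auto simp: W_lincomb ip.lin en.lin WV algebra_simps)
  have "\<exists>u\<in>W. ip.sq u = 1 \<and> en.sq u < \<nu> + 1 / real (Suc m)" for m
  proof -
    have "Inf R < \<nu> + 1 / real (Suc m)" by (simp add: \<nu>_def)
    from cInf_lessD[OF Rne this] show ?thesis by (auto simp: R_def)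
  qed
  then obtain f0 where f0: "\<And>m. f0 m \<in> W" "\<And>m. ip.sq (f0 m) = 1"
    "\<And>m. en.sq (f0 m) < \<nu> + 1 / real (Suc m)" by metis
  have "bounded (range (\<lambda>m. l k (f0 m)))" if "k \<in> L" for k
  proof -
    have "norm (l k (f0 m)) \<le> sqrt K" for m
      using L(3)[OF that WV[OF f0(1)], of m] f0(2) by (simp add: real_le_rsqrt)
    then show ?thesis by (auto simp: bounded_iff)
  qed
  then obtain r where r: "strict_mono r" "\<forall>k\<in>L. convergent (\<lambda>m. l k (f0 (r m)))"
    using bounded_family_convergent_subseq[OF L(1), of "\<lambda>k m. l k (f0 m)"] by blast
  define f where "f m = f0 (r m)" for m
  have f: "\<And>m. f m \<in> W" "\<And>m. ip.sq (f m) = 1" "\<And>m. en.sq (f m) < \<nu> + 1 / real (Suc m)"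
  proof -
    show "f m \<in> W" "ip.sq (f m) = 1" for m using f0 by (auto simp: f_def)
    have "1 / real (Suc (r m)) \<le> 1 / real (Suc m)" for m
      using seq_suble[OF r(1), of m] by (simp add: frac_le)
    then show "en.sq (f m) < \<nu> + 1 / real (Suc m)" for m
      unfolding f_def using f0(3)[of "r m"] by (metis add_left_mono less_le_trans)
  qed
  have fV: "f m \<in> V" for m using f WV by blast
  have conv: "convergent (\<lambda>m. l k (f m))" if "k \<in> L" for k using r that by (simp add: f_def)
  have diffV: "(\<lambda>x. f m x - f p x) \<in> V" for m p by (intro ip.sub fV)
  have Fdiff: "en.sq (\<lambda>x. f m x - f p x) \<le> \<nu> * ip.sq (\<lambda>x. f m x - f p x) + (2 / real (Suc m) + 2 / real (Suc p))" for m p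
  proof -
    have "F.sq (\<lambda>x. f m x - f p x) \<le> 2 * F.sq (f m) + 2 * F.sq (f p)"
      using F.parallelogram[OF f(1) f(1), of m p] F.pos[OF F.lincomb[OF f(1) f(1), of m 1 p]] by simp
    also have "\<dots> \<le> 2 / real (Suc m) + 2 / real (Suc p)"
      using f(2,3)[of m] f(2,3)[of p] by (simp add: algebra_simps)
    finally show ?thesis by simp
  qed
  define T where "T m p = C * (\<Sum>k\<in>L. (norm (l k (f m) - l k (f p)))\<^sup>2)" for m p
  have ipdiff: "(1 - \<delta> * \<mu>) * ip.sq (\<lambda>x. f m x - f p x) \<le> \<delta> * (2 / real (Suc m) + 2 / real (Suc p)) + T m p" for m p
  proof -
    \<comment> \<open>the energy of the difference is absorbed on the left, since \<open>\<delta> * \<nu> \<le> \<delta> * \<mu> < 1\<close>\<close>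
    have "ip.sq (\<lambda>x. f m x - f p x) \<le> \<delta> * en.sq (\<lambda>x. f m x - f p x) + T m p"
      using L(4)[OF diffV, of m p] L(2) fV by (simp add: T_def)
    also have "\<dots> \<le> \<delta> * (\<nu> * ip.sq (\<lambda>x. f m x - f p x) + (2 / real (Suc m) + 2 / real (Suc p))) + T m p"
      using Fdiff L(5) by (intro add_right_mono mult_left_mono) auto
    also have "\<dots> \<le> \<delta> * (\<mu> * ip.sq (\<lambda>x. f m x - f p x) + (2 / real (Suc m) + 2 / real (Suc p))) + T m p"
      using \<nu>\<mu> L(5) ip.pos[OF diffV] by (intro add_right_mono mult_left_mono mult_right_mono) auto
    finally show ?thesis by (simp add: algebra_simps)
  qed
  have T0: "\<exists>N. \<forall>m\<ge>N. \<forall>p\<ge>N. T m p < e0" if "e0 > 0" for e0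
  proof -
    define e1 where "e1 = e0 / (\<bar>C\<bar> * real (card L) + 1)"
    have "\<bar>C\<bar> * real (card L) + 1 > 0" by (simp add: add_nonneg_pos)
    then have e1: "e1 > 0" "\<bar>C\<bar> * real (card L) * e1 < e0"
      using that by (auto simp: e1_def divide_less_eq algebra_simps)
    have "\<forall>k\<in>L. \<exists>N. \<forall>m\<ge>N. \<forall>p\<ge>N. norm (l k (f m) - l k (f p)) < sqrt e1"
      using conv[THEN convergent_Cauchy] e1(1) by (simp add: Cauchy_def dist_norm)
    then obtain N where N: "\<And>k m p. k \<in> L \<Longrightarrow> m \<ge> N k \<Longrightarrow> p \<ge> N k \<Longrightarrow> norm (l k (f m) - l k (f p)) < sqrt e1"
      by metis
    define M where "M = (\<Sum>k\<in>L. N k)"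
    have M: "N k \<le> M" if "k \<in> L" for k unfolding M_def using L(1) that by (rule member_le_sum[rotated 2]) auto
    have "T m p < e0" if "m \<ge> M" "p \<ge> M" for m p
    proof -
      have "(norm (l k (f m) - l k (f p)))\<^sup>2 \<le> e1" if "k \<in> L" for k
      proof -
        have "norm (l k (f m) - l k (f p)) \<le> sqrt e1"
          using N[OF that, of m p] M[OF that] \<open>m \<ge> M\<close> \<open>p \<ge> M\<close> by simp
        then have "(norm (l k (f m) - l k (f p)))\<^sup>2 \<le> (sqrt e1)\<^sup>2" by (intro power_mono) auto
        then show ?thesis using e1 by simp
      qed
      then have "(\<Sum>k\<in>L. (norm (l k (f m) - l k (f p)))\<^sup>2) \<le> real (card L) * e1"
        using sum_bounded_above[of L "\<lambda>k. (norm (l k (f m) - l k (f p)))\<^sup>2" e1] by simp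
      moreover have "0 \<le> (\<Sum>k\<in>L. (norm (l k (f m) - l k (f p)))\<^sup>2)" by (rule sum_nonneg) simp
      ultimately have "T m p \<le> \<bar>C\<bar> * (real (card L) * e1)"
        unfolding T_def by (intro mult_mono) auto
      then show ?thesis using e1 by (simp add: mult.assoc)
    qed
    then show ?thesis by blast
  qed
  have small: "\<exists>N. \<forall>m\<ge>N. 1 / real (Suc m) < e0" if "e0 > 0" for e0
  proof -
    obtain N where N: "inverse (real (Suc N)) < e0" using reals_Archimedean[OF \<open>e0 > 0\<close>] by auto
    have "1 / real (Suc m) < e0" if "m \<ge> N" for m
    proof -
      have "1 / real (Suc m) \<le> inverse (real (Suc N))" using that by (simp add: field_simps)
      then show ?thesis using N by simp
    qed
    then show ?thesis by blast
  qed
  have cauchy: "\<exists>N. \<forall>m\<ge>N. \<forall>p\<ge>N. ip.sq (\<lambda>x. f m x - f p x) < e0 \<and> en.sq (\<lambda>x. f m x - f p x) < e0"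
    if "e0 > 0" for e0
  proof -
    define \<theta> where "\<theta> = 1 - \<delta> * \<mu>"
    have \<theta>: "\<theta> > 0" using L(6) by (simp add: \<theta>_def)
    define \<eta> where "\<eta> = \<theta> * (e0 / (2 * (\<nu> + 1)))"
    have \<eta>: "\<eta> > 0" using \<theta> that \<nu>_pos by (simp add: \<eta>_def)
    define \<kappa> where "\<kappa> = min (\<eta> / (8 * (\<delta> + 1))) (e0 / 16)"
    have \<kappa>: "\<kappa> > 0" using \<eta> L(5) that by (simp add: \<kappa>_def)
    obtain N1 where N1: "\<forall>m\<ge>N1. \<forall>p\<ge>N1. T m p < \<eta> / 2" using T0[of "\<eta> / 2"] \<eta> by auto
    obtain N2 where N2: "\<forall>m\<ge>N2. 1 / real (Suc m) < \<kappa>" using small[OF \<kappa>] by auto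
    have "ip.sq (\<lambda>x. f m x - f p x) < e0 \<and> en.sq (\<lambda>x. f m x - f p x) < e0"
      if "m \<ge> max N1 N2" "p \<ge> max N1 N2" for m p
    proof -
      have mp: "1 / real (Suc m) < \<kappa>" "1 / real (Suc p) < \<kappa>" using N2 that by auto
      have Tmp: "T m p < \<eta> / 2" using N1 that by auto
      have "\<kappa> \<le> \<eta> / (8 * (\<delta> + 1))" "8 * (\<delta> + 1) > 0"
        using L(5) by (simp_all add: \<kappa>_def)
      then have "\<kappa> * (8 * (\<delta> + 1)) \<le> \<eta>"
        by (simp only: pos_le_divide_eq)
      then have "\<delta> * (4 * \<kappa>) < \<eta> / 2" using \<kappa> by (simp add: algebra_simps)
      moreover have "\<delta> * (2 / real (Suc m) + 2 / real (Suc p)) \<le> \<delta> * (4 * \<kappa>)"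
        using mp L(5) by (intro mult_left_mono) auto
      ultimately have "\<delta> * (2 / real (Suc m) + 2 / real (Suc p)) < \<eta> / 2"
        by linarith
      then have "\<theta> * ip.sq (\<lambda>x. f m x - f p x) < \<eta>"
        using ipdiff[of m p] Tmp unfolding \<theta>_def by linarith
      then have ip_lt: "ip.sq (\<lambda>x. f m x - f p x) < e0 / (2 * (\<nu> + 1))"
        using mult_less_cancel_left_pos[OF \<theta>] unfolding \<eta>_def by blast
      have n: "2 * (\<nu> + 1) > 0" using \<nu>_pos by simp
      have *: "(\<nu> + 1) * ip.sq (\<lambda>x. f m x - f p x) < e0 / 2"
        using ip_lt \<nu>_pos by (simp add: field_simps)
      have "ip.sq (\<lambda>x. f m x - f p x) \<ge> 0" by (rule ip.pos[OF diffV])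
      then have a: "ip.sq (\<lambda>x. f m x - f p x) < e0" "\<nu> * ip.sq (\<lambda>x. f m x - f p x) < e0 / 2"
        using * \<nu>_pos mult_nonneg_nonneg[OF \<nu>_pos, of "ip.sq (\<lambda>x. f m x - f p x)"] \<open>e0 > 0\<close>
        unfolding distrib_right by linarith+
      have "\<kappa> \<le> e0 / 16" unfolding \<kappa>_def by (rule min.cobounded2)
      then have "2 / real (Suc m) + 2 / real (Suc p) < e0 / 2" using mp \<open>e0 > 0\<close> by simp
      then show ?thesis using a Fdiff[of m p] by linarith
    qed
    then show ?thesis by blast
  qed
  obtain u where u: "u \<in> V" "(\<lambda>m. ip.sq (\<lambda>x. f m x - u x)) \<longlonglongrightarrow> 0" "(\<lambda>m. en.sq (\<lambda>x. f m x - u x)) \<longlonglongrightarrow> 0"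
    using complete[OF fV cauchy] by blast
  note ip_lim = ip.sq_tendsto[of f u, OF fV u(1,2)]
  note en_lim = en.sq_tendsto[of f u, OF fV u(1,3)]
  have u1: "ip.sq u = 1"
    using LIMSEQ_unique[OF ip_lim(2)[OF u(1)], of 1] f(2) by simp
  have uW: "u \<in> W"
  proof -
    have "ip u (e j) = 0" if "j \<in> J" for j
    proof -
      have "ip (f m) (e j) = 0" for m using f(1)[of m] that by (simp add: W_def)
      then show ?thesis using LIMSEQ_unique[OF ip_lim(1)[OF E(2)[OF that]], of 0] by simp
    qed
    then show ?thesis using u by (simp add: W_def)
  qed
  have "en.sq u \<le> \<nu>"
  proof (rule LIMSEQ_le[OF en_lim(2)[OF u(1)]])
    have "(\<lambda>m. \<nu> + 1 / real (Suc m)) \<longlonglongrightarrow> \<nu> + 0"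
      using LIMSEQ_inverse_real_of_nat by (intro tendsto_intros) (simp add: inverse_eq_divide)
    then show "(\<lambda>m. \<nu> + 1 / real (Suc m)) \<longlonglongrightarrow> \<nu>" by simp
    show "\<exists>N. \<forall>m\<ge>N. en.sq (f m) \<le> \<nu> + 1 / real (Suc m)" using f(3) less_imp_le by blast
  qed
  then have "F.sq u = 0" using \<nu>_le[OF uW] u1 by simp
  then have "en u w = of_real \<nu> * ip u w" if "w \<in> W" for w
    using F.null_vector[OF uW that] by simp
  then show ?thesis using \<nu>\<mu> u(1) u1 uW
    by (intro exI[of _ \<nu>] exI[of _ u] conjI ballI impI) (simp_all add: W_def)
qed

text \<open>
  The minimiser \<open>u\<close> satisfies the eigenvalue equation against the complement of the \<open>e j\<close>. It also does
  so against the \<open>e j\<close> themselves, since they are eigenvectors and both sides vanish there.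
\<close>
theorem exists_new_eigenvector:
  assumes E: "finite J" "\<And>j. j \<in> J \<Longrightarrow> e j \<in> V"
    and eig: "\<And>j w. j \<in> J \<Longrightarrow> w \<in> V \<Longrightarrow> en (e j) w = of_real (ev j) * ip (e j) w"
    and v: "v \<in> V" "\<And>j. j \<in> J \<Longrightarrow> ip v (e j) = 0" "0 < ip.sq v" "en.sq v \<le> \<mu> * ip.sq v"
    and L: "finite L" "\<And>k u w. k \<in> L \<Longrightarrow> u \<in> V \<Longrightarrow> w \<in> V \<Longrightarrow> l k (\<lambda>x. u x - w x) = l k u - l k w"
      "\<And>k u. k \<in> L \<Longrightarrow> u \<in> V \<Longrightarrow> (norm (l k u))\<^sup>2 \<le> K * ip.sq u"
      "\<And>u. u \<in> V \<Longrightarrow> ip.sq u \<le> \<delta> * en.sq u + C * (\<Sum>k\<in>L. (norm (l k u :: complex))\<^sup>2)"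
      "0 \<le> \<delta>" "\<delta> * \<mu> < 1"
  shows "\<exists>\<nu> u. \<nu> \<le> \<mu> \<and> u \<in> V \<and> ip.sq u = 1 \<and> (\<forall>j\<in>J. ip u (e j) = 0) \<and>
    (\<forall>w\<in>V. en u w = of_real \<nu> * ip u w)"
proof -
  have "\<exists>\<nu> u. \<nu> \<le> \<mu> \<and> u \<in> V \<and> ip.sq u = 1 \<and> (\<forall>j\<in>J. ip u (e j) = 0) \<and>
    (\<forall>w\<in>V. (\<forall>j\<in>J. ip w (e j) = 0) \<longrightarrow> en u w = of_real \<nu> * ip u w)"
    by (rule rayleigh_minimiser[where J = J and e = e and l = l and L = L and v = v and K = K and \<delta> = \<delta> and C = C, OF E v L])
  then obtain \<nu> u where u: "\<nu> \<le> \<mu>" "u \<in> V" "ip.sq u = 1" "\<forall>j\<in>J. ip u (e j) = 0"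
    "\<forall>w\<in>V. (\<forall>j\<in>J. ip w (e j) = 0) \<longrightarrow> en u w = of_real \<nu> * ip u w"
    by (elim exE conjE)
  have ue: "en u (e j) = 0" if "j \<in> J" for j
    using eig[OF that u(2)] bspec[OF u(4) that] en.herm[of "e j" u] ip.herm[of u "e j"] E(2)[OF that] u(2) by simp
  have "en u w = of_real \<nu> * ip u w" if w: "w \<in> V" for w
  proof -
    obtain c where c: "\<forall>j\<in>J. ip (\<lambda>x. w x - (\<Sum>i\<in>J. c i * e i x)) (e j) = 0"
      using ip.exists_projection[of J e w, OF E w] by blast
    define p where "p x = (\<Sum>i\<in>J. c i * e i x)" for x
    have p: "p \<in> V" unfolding p_def[abs_def] by (rule ip.sum_mem[of J e, OF E])
    have "en u p = 0" "ip u p = 0"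
      unfolding p_def[abs_def] using u(4) ue
      by (simp_all add: ip.s_sum_right[of J e u, OF E u(2)] en.s_sum_right[of J e u, OF E u(2)])
    moreover have "en u (\<lambda>x. w x - p x) = of_real \<nu> * ip u (\<lambda>x. w x - p x)"
      using u(5) c ip.sub[OF w p] by (simp add: p_def)
    ultimately show ?thesis using w p u(2) by (simp add: en.s_sub_right ip.s_sub_right)
  qed
  then show ?thesis using u(1-3) u(4)[rule_format]
    by (intro exI[of _ \<nu>] exI[of _ u] conjI ballI)
qed

end

section \<open>Test functions and the fundamental lemma of the calculus of variations\<close>

text \<open>
  The functions \<open>exp (-1/t) / t ^ k\<close>, extended by 0, form a family whose derivatives are again linear
  combinations of the family; so all of them are smooth.
\<close>
definition exp_flat :: "nat \<Rightarrow> real \<Rightarrow> real" where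
  "exp_flat k t = (if t > 0 then exp (- 1 / t) / t ^ k else 0)"

lemma exp_flat_tendsto_0: "(exp_flat k \<longlongrightarrow> 0) (at_right 0)"
proof -
  have "((\<lambda>t. inverse t ^ k / exp (inverse t)) \<longlongrightarrow> (0::real)) (at_right 0)"
    by (rule filterlim_compose[OF tendsto_power_div_exp_0 filterlim_inverse_at_top_right])
  moreover have "\<forall>\<^sub>F t in at_right (0::real). inverse t ^ k / exp (inverse t) = exp_flat k t"
    using eventually_at_right_less[of 0]
    by eventually_elim (simp add: exp_flat_def exp_minus field_simps)
  ultimately show ?thesis by (rule Lim_transform_eventually)
qed

lemma DERIV_flat: "(exp_flat k has_real_derivative (exp_flat (k + 2) t - real k * exp_flat (k + 1) t)) (at t)"
proof -
  consider "t > 0" | "t < 0" | "t = 0" by linarith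
  then show ?thesis
  proof cases
    case 1
    have "((\<lambda>t. exp (- 1 / t) / t ^ k) has_real_derivative (exp_flat (k + 2) t - real k * exp_flat (k + 1) t)) (at t)"
    proof (cases "k = 0")
      case True
      then show ?thesis
        using 1 by (auto intro!: derivative_eq_intros simp: exp_flat_def field_simps power2_eq_square)
    next
      case False
      then have "t ^ (k - Suc 0) = t ^ k / t" using 1 by (cases k) auto
      then show ?thesis
        using 1 by (auto intro!: derivative_eq_intros simp: exp_flat_def field_simps power2_eq_square)
    qed
    then show ?thesis
      by (rule has_field_derivative_transform_within[of _ _ _ _ t]) (use 1 in \<open>auto simp: exp_flat_def dist_real_def\<close>)
  next
    case 2
    have "((\<lambda>t. 0) has_real_derivative (exp_flat (k + 2) t - real k * exp_flat (k + 1) t)) (at t)"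
      using 2 by (auto simp: exp_flat_def)
    then show ?thesis
      by (rule has_field_derivative_transform_within[of _ _ _ _ "- t"]) (use 2 in \<open>auto simp: exp_flat_def dist_real_def\<close>)
  next
    case 3
    have "((\<lambda>y. exp_flat k y / y) \<longlongrightarrow> 0) (at 0)"
    proof (rule filterlim_split_at)
      show "((\<lambda>y. exp_flat k y / y) \<longlongrightarrow> 0) (at_right 0)"
        by (rule Lim_transform_eventually[OF exp_flat_tendsto_0[of "Suc k"]])
          (use eventually_at_right_less[of "0::real"] in \<open>eventually_elim, auto simp: exp_flat_def field_simps\<close>)
      have "\<forall>\<^sub>F y in at_left 0. exp_flat k y / y = 0"
        unfolding eventually_at_left_field by (auto simp: exp_flat_def intro!: exI[of _ "-1"])
      then show "((\<lambda>y. exp_flat k y / y) \<longlongrightarrow> 0) (at_left 0)"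
        by (rule tendsto_eventually)
    qed
    then show ?thesis using 3 by (simp add: has_field_derivative_iff exp_flat_def)
  qed
qed

text \<open>
  A class of functions that is closed under directional derivatives. Closedness gives all orders of
  differentiability at once, without formulas for higher derivatives.
\<close>
inductive elementary_smooth :: "('a::euclidean_space \<Rightarrow> real) \<Rightarrow> bool" where
  const: "elementary_smooth (\<lambda>x. c)"
| exp_flat: "elementary_smooth (\<lambda>x. exp_flat k (x \<bullet> v + a))"
| add: "elementary_smooth f \<Longrightarrow> elementary_smooth g \<Longrightarrow> elementary_smooth (\<lambda>x. f x + g x)"
| mult: "elementary_smooth f \<Longrightarrow> elementary_smooth g \<Longrightarrow> elementary_smooth (\<lambda>x. f x * g x)"
| exp: "elementary_smooth f \<Longrightarrow> elementary_smooth (\<lambda>x. exp (f x))"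

lemma elementary_smooth_derivative:
  assumes "elementary_smooth f"
  shows "\<exists>D. (\<forall>x. (f has_derivative D x) (at x)) \<and> (\<forall>i. elementary_smooth (\<lambda>x. D x i))"
  using assms
proof (induction rule: elementary_smooth.induct)
  case (const c)
  show ?case by (intro exI[of _ "\<lambda>x i. 0"]) (auto intro: elementary_smooth.const)
next
  case (exp_flat k v a)
  show ?case
  proof (intro exI[of _ "\<lambda>x i. (exp_flat (k + 2) (x \<bullet> v + a) + (- real k) * exp_flat (k + 1) (x \<bullet> v + a)) * (i \<bullet> v)"] conjI allI)
    fix x
    have "((\<lambda>x. exp_flat k (x \<bullet> v + a)) has_derivative
        (\<lambda>i. (i \<bullet> v) * (exp_flat (k + 2) (x \<bullet> v + a) - real k * exp_flat (k + 1) (x \<bullet> v + a)))) (at x)"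
      by (rule DERIV_flat[THEN DERIV_compose_FDERIV]) (auto intro!: derivative_eq_intros)
    then show "((\<lambda>x. exp_flat k (x \<bullet> v + a)) has_derivative
        (\<lambda>i. (exp_flat (k + 2) (x \<bullet> v + a) + (- real k) * exp_flat (k + 1) (x \<bullet> v + a)) * (i \<bullet> v))) (at x)"
      by (simp add: mult.commute)
  qed (intro elementary_smooth.intros)
next
  case (add f g)
  then obtain D E where D: "\<forall>x. (f has_derivative D x) (at x)" "\<forall>i. elementary_smooth (\<lambda>x. D x i)"
    and E: "\<forall>x. (g has_derivative E x) (at x)" "\<forall>i. elementary_smooth (\<lambda>x. E x i)"
    by (elim exE conjE)
  show ?case
  proof (intro exI[of _ "\<lambda>x i. D x i + E x i"] conjI allI)
    show "((\<lambda>x. f x + g x) has_derivative (\<lambda>i. D x i + E x i)) (at x)" for x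
      by (rule has_derivative_add[OF D(1)[rule_format] E(1)[rule_format]])
    show "elementary_smooth (\<lambda>x. D x i + E x i)" for i
      by (rule elementary_smooth.add[OF D(2)[rule_format, of i] E(2)[rule_format, of i]])
  qed
next
  case (mult f g)
  then obtain D E where D: "\<forall>x. (f has_derivative D x) (at x)" "\<forall>i. elementary_smooth (\<lambda>x. D x i)"
    and E: "\<forall>x. (g has_derivative E x) (at x)" "\<forall>i. elementary_smooth (\<lambda>x. E x i)"
    by (elim exE conjE)
  show ?case
  proof (intro exI[of _ "\<lambda>x i. f x * E x i + D x i * g x"] conjI allI)
    show "((\<lambda>x. f x * g x) has_derivative (\<lambda>i. f x * E x i + D x i * g x)) (at x)" for x
      by (rule has_derivative_mult[OF D(1)[rule_format] E(1)[rule_format]])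
    show "elementary_smooth (\<lambda>x. f x * E x i + D x i * g x)" for i
      by (rule elementary_smooth.add[OF elementary_smooth.mult[OF mult.hyps(1) E(2)[rule_format, of i]]
            elementary_smooth.mult[OF D(2)[rule_format, of i] mult.hyps(2)]])
  qed
next
  case (exp f)
  then obtain D where D: "\<forall>x. (f has_derivative D x) (at x)" "\<forall>i. elementary_smooth (\<lambda>x. D x i)" by (elim exE conjE)
  show ?case
  proof (intro exI[of _ "\<lambda>x i. exp (f x) * D x i"] conjI allI)
    show "((\<lambda>x. exp (f x)) has_derivative (\<lambda>i. exp (f x) * D x i)) (at x)" for x
      using has_derivative_exp[OF D(1)[rule_format, of x]] by (simp add: mult.commute)
    show "elementary_smooth (\<lambda>x. exp (f x) * D x i)" for i
      by (rule elementary_smooth.mult[OF elementary_smooth.exp[OF exp.hyps] D(2)[rule_format, of i]])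
  qed
qed

lemma elementary_smooth_C_diff: "elementary_smooth f \<Longrightarrow> C_diff k f"
proof (induction k arbitrary: f)
  case 0
  then obtain D where "\<forall>x. (f has_derivative D x) (at x)"
    using elementary_smooth_derivative[of f] by auto
  then show ?case
    by (auto intro!: continuous_at_imp_continuous_on has_derivative_continuous)
next
  case (Suc k)
  obtain D where D: "\<forall>x. (f has_derivative D x) (at x)" "\<forall>i. elementary_smooth (\<lambda>x. D x i)"
    using elementary_smooth_derivative[OF Suc.prems] by (elim exE conjE)
  have "frechet_derivative f (at x) = D x" for x
    using frechet_derivative_at[OF D(1)[rule_format, of x]] by simp
  moreover have "f differentiable at x" for x
    using D(1) by (auto simp: differentiable_def)
  ultimately show ?case using Suc.IH[OF D(2)[rule_format]] by simp
qed

lemma elementary_smooth_prod: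
  "finite I \<Longrightarrow> (\<And>i. i \<in> I \<Longrightarrow> elementary_smooth (f i)) \<Longrightarrow> elementary_smooth (\<lambda>x. \<Prod>i\<in>I. f i x)"
proof (induction I rule: finite_induct)
  case empty
  show ?case unfolding prod.empty by (rule elementary_smooth.const)
next
  case (insert i I)
  show ?case unfolding prod.insert[OF insert.hyps]
    by (intro elementary_smooth.mult insert.prems insert.IH insertI1 insertI2)
qed

definition box_bump :: "'a::euclidean_space \<Rightarrow> 'a \<Rightarrow> 'a \<Rightarrow> real" where
  "box_bump a c x = (\<Prod>b\<in>Basis. exp_flat 0 (x \<bullet> b + - (a \<bullet> b)) * exp_flat 0 (x \<bullet> (- b) + c \<bullet> b))"

lemma box_bump_nonneg: "0 \<le> box_bump a c x"
  by (auto simp: box_bump_def exp_flat_def intro!: prod_nonneg)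

lemma box_bump_pos_iff: "0 < box_bump a c x \<longleftrightarrow> x \<in> box a c"
proof
  assume "x \<in> box a c"
  then show "0 < box_bump a c x"
    by (auto simp: box_bump_def exp_flat_def mem_box intro!: prod_pos)
next
  assume *: "0 < box_bump a c x"
  show "x \<in> box a c"
  proof (rule ccontr)
    assume "x \<notin> box a c"
    then obtain b where "b \<in> Basis" "\<not> (a \<bullet> b < x \<bullet> b \<and> x \<bullet> b < c \<bullet> b)" by (auto simp: mem_box)
    then have "\<exists>b\<in>Basis. exp_flat 0 (x \<bullet> b + - (a \<bullet> b)) * exp_flat 0 (x \<bullet> (- b) + c \<bullet> b) = 0"
      by (intro bexI[of _ b]) (auto simp: exp_flat_def)
    then have "box_bump a c x = 0" unfolding box_bump_def by (intro prod_zero) auto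
    then show False using * by simp
  qed
qed

lemma test_function_mono: "test_function S \<phi> \<Longrightarrow> S \<subseteq> T \<Longrightarrow> test_function T \<phi>"
  by (auto simp: test_function_def)

text \<open>
  If \<open>\<beta>\<close> is a smooth function that is positive exactly on the box, then \<open>1 - exp (- m * \<beta>)\<close> has its
  support in the closed box and increases to the indicator of the box as \<open>m\<close> grows.
\<close>
lemma box_indicator_approximation:
  fixes a c :: "'a::euclidean_space"
  assumes "cbox a c \<subseteq> A"
  obtains \<theta> :: "nat \<Rightarrow> 'a \<Rightarrow> real"
  where "\<And>m. test_function A (\<theta> m)" "\<And>m x. 0 \<le> \<theta> m x \<and> \<theta> m x \<le> 1"
    "\<And>x. (\<lambda>m. \<theta> m x) \<longlonglongrightarrow> indicator (box a c) x"
proof -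
  define \<theta> where "\<theta> m x = 1 + (- 1) * exp ((- real m) * box_bump a c x)" for m x
  have out: "\<theta> m x = 0" if "x \<notin> box a c" for m x
    using that box_bump_pos_iff[of a c x] box_bump_nonneg[of a c x] by (simp add: \<theta>_def)
  show ?thesis
  proof (rule that[of \<theta>])
    fix m
    have "elementary_smooth (\<theta> m)"
      unfolding \<theta>_def[abs_def] box_bump_def
      by (intro elementary_smooth.intros elementary_smooth_prod) auto
    moreover have "closure {x. \<theta> m x \<noteq> 0} \<subseteq> cbox a c"
      using out box_subset_cbox[of a c] by (intro closure_minimal) auto
    ultimately show "test_function A (\<theta> m)"
      using assms bounded_subset[OF bounded_cbox] elementary_smooth_C_diff
      unfolding test_function_def compact_eq_bounded_closed by blast
  next
    show "0 \<le> \<theta> m x \<and> \<theta> m x \<le> 1" for m x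
      using box_bump_nonneg[of a c x] by (simp add: \<theta>_def)
  next
    fix x
    show "(\<lambda>m. \<theta> m x) \<longlonglongrightarrow> indicator (box a c) x"
    proof (cases "x \<in> box a c")
      case True
      then have p: "0 < box_bump a c x" by (simp add: box_bump_pos_iff)
      have "exp (- box_bump a c x) < 1" using p by (subst exp_less_one_iff) linarith
      then have "(\<lambda>m. exp (- box_bump a c x) ^ m) \<longlonglongrightarrow> 0"
        by (intro LIMSEQ_realpow_zero) auto
      then have "(\<lambda>m. 1 + (-1) * exp (- box_bump a c x) ^ m) \<longlonglongrightarrow> 1 + (-1) * 0"
        by (intro tendsto_add[OF tendsto_const tendsto_mult[OF tendsto_const]])
      then show ?thesis using True by (simp add: \<theta>_def exp_of_nat_mult[symmetric])
    qed (simp add: out)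
  qed
qed

text \<open>
  On a box whose closure lies in \<open>A\<close>, the densities \<open>max 0 f\<close> and \<open>max 0 (- f)\<close> define finite measures
  that agree on all boxes, hence on all Borel sets, hence almost everywhere as densities. Countably
  many such boxes cover \<open>A\<close>.
\<close>
lemma AE_zero_of_box_integrals_zero:
  fixes f :: "'a::euclidean_space \<Rightarrow> real"
  assumes f: "integrable lborel f" and A: "open A"
    and zero: "\<And>a c. cbox a c \<subseteq> A \<Longrightarrow> (LINT x|lborel. indicator (box a c) x * f x) = 0"
  shows "AE x in lborel. x \<in> A \<longrightarrow> f x = 0"
proof -
  have [measurable]: "f \<in> borel_measurable borel" using f by auto
  have box: "AE x in lborel. x \<in> box a c \<longrightarrow> f x = 0" if K: "cbox a c \<subseteq> A" for a c
  proof -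
    define p where "p x = ennreal (indicator (box a c) x * max 0 (f x))" for x
    define n where "n x = ennreal (indicator (box a c) x * max 0 (- f x))" for x
    have [measurable]: "p \<in> borel_measurable borel" "n \<in> borel_measurable borel"
      unfolding p_def[abs_def] n_def[abs_def] by measurable
    have fp: "integrable lborel (\<lambda>x. indicator X x * max 0 (f x))"
      and fn: "integrable lborel (\<lambda>x. indicator X x * max 0 (- f x))" if "X \<in> sets borel" for X
      using f that by (auto intro!: integrable_real_mult_indicator[where A = X, simplified mult.commute[of _ "indicator _ _"]] integrable_max)
    have nn: "(\<integral>\<^sup>+x. p x * indicator X x \<partial>lborel) = ennreal (LINT x|lborel. indicator (box a c \<inter> X) x * max 0 (f x))"
       "(\<integral>\<^sup>+x. n x * indicator X x \<partial>lborel) = ennreal (LINT x|lborel. indicator (box a c \<inter> X) x * max 0 (- f x))"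
      if "X \<in> sets borel" for X
      using that
      by (auto simp: p_def n_def nn_integral_eq_integral[symmetric] fp fn intro!: nn_integral_cong split: split_indicator)
    have eq: "(\<integral>\<^sup>+x. p x * indicator X x \<partial>lborel) = (\<integral>\<^sup>+x. n x * indicator X x \<partial>lborel)" if X_def: "X = box l u" for X l u
    proof -
      have "\<exists>l' u'. box a c \<inter> X = box l' u'" unfolding X_def box_Int_box by (rule exI, rule exI, rule refl)
      then obtain l' u' where lu: "box a c \<inter> X = box l' u'" by (elim exE)
      have X: "X \<in> sets borel" "box a c \<inter> X \<in> sets borel" unfolding X_def by auto
      have "(LINT x|lborel. indicator (box l' u') x * f x) = 0"
      proof (cases "box l' u' = {}")
        case False
        have "cbox l' u' = closure (box l' u')" using False by simp
        also have "\<dots> \<subseteq> closure (box a c)" using lu by (intro closure_mono) auto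
        also have "\<dots> \<subseteq> cbox a c" by (intro closure_minimal box_subset_cbox closed_cbox)
        finally show ?thesis using zero K by blast
      qed simp
      also have "(LINT x|lborel. indicator (box l' u') x * f x) =
         (LINT x|lborel. indicator (box a c \<inter> X) x * max 0 (f x) - indicator (box a c \<inter> X) x * max 0 (- f x))"
        unfolding lu by (intro Bochner_Integration.integral_cong) (auto split: split_indicator)
      also have "\<dots> = (LINT x|lborel. indicator (box a c \<inter> X) x * max 0 (f x)) - (LINT x|lborel. indicator (box a c \<inter> X) x * max 0 (- f x))"
        using X by (intro Bochner_Integration.integral_diff fp fn)
      finally show ?thesis unfolding nn[OF X(1)] by simp
    qed
    have "density lborel p = density lborel n"
    proof (rule measure_eqI_generator_eq)
      let ?E = "range (\<lambda>(a, b). box a b::'a set)"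
      show "Int_stable ?E" by (auto simp: Int_stable_def box_Int_box)
      show "?E \<subseteq> Pow UNIV" "sets (density lborel p) = sigma_sets UNIV ?E" "sets (density lborel n) = sigma_sets UNIV ?E"
        by (simp_all add: borel_eq_box)
      let ?A = "\<lambda>n::nat. box (- (real n *\<^sub>R One)) (real n *\<^sub>R One) :: 'a set"
      show "range ?A \<subseteq> ?E" "(\<Union>i. ?A i) = UNIV" unfolding UN_box_eq_UNIV by auto
      show "emeasure (density lborel p) (?A i) \<noteq> \<infinity>" for i
        by (subst emeasure_density) (auto simp: nn)
      show "emeasure (density lborel p) X = emeasure (density lborel n) X" if "X \<in> ?E" for X
        using that by (auto simp: emeasure_density eq)
    qed
    then have "AE x in lborel. p x = n x"
      by (subst (asm) sigma_finite_measure.density_unique_iff[OF sigma_finite_lborel]) auto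
    then show ?thesis
      by eventually_elim (auto simp: p_def n_def max_def split: if_splits)
  qed
  have cbox: "AE x in lborel. x \<in> cbox a c \<longrightarrow> f x = 0" if "cbox a c \<subseteq> A" for a c
  proof -
    have "cbox a c - box a c \<in> null_sets lebesgue"
      using negligible_frontier_interval negligible_iff_null_sets by blast
    then have "AE x in lebesgue. x \<notin> cbox a c - box a c" by (rule AE_not_in)
    then have "AE x in lborel. x \<notin> cbox a c - box a c" by (simp add: AE_completion_iff)
    then show ?thesis using box[OF that] by eventually_elim auto
  qed
  obtain \<D> where D: "countable \<D>" "\<D> \<subseteq> Pow A" "\<And>X. X \<in> \<D> \<Longrightarrow> \<exists>a b. X = cbox a b" "\<Union>\<D> = A"
    by (rule open_countable_Union_open_cbox[OF A]) (rule that)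
  have "AE x in lborel. \<forall>X\<in>\<D>. x \<in> X \<longrightarrow> f x = 0"
    unfolding AE_ball_countable[OF D(1)]
  proof
    fix X assume X: "X \<in> \<D>"
    then obtain a b where "X = cbox a b" using D(3) by blast
    then show "AE x in lborel. x \<in> X \<longrightarrow> f x = 0" using cbox[of a b] D(2) X by auto
  qed
  then show ?thesis by eventually_elim (use D in auto)
qed

text \<open>
  Approximating indicators by test functions reduces the claim to integrals over boxes.
\<close>
lemma fundamental_lemma:
  fixes w :: "'a::euclidean_space \<Rightarrow> complex"
  assumes w: "integrable lborel w" and A: "open A"
    and zero: "\<And>\<phi>. test_function A \<phi> \<Longrightarrow> (LINT x|lborel. of_real (\<phi> x) * w x) = 0"
  shows "AE x in lborel. x \<in> A \<longrightarrow> w x = 0"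
proof -
  have [measurable]: "w \<in> borel_measurable borel" using w by auto
  have box: "(LINT x|lborel. of_real (indicator (box a c) x) * w x) = 0" if K: "cbox a c \<subseteq> A" for a c
  proof -
    obtain \<theta> where \<theta>: "\<And>m. test_function A (\<theta> m)" "\<And>m x. 0 \<le> \<theta> m x \<and> \<theta> m x \<le> 1"
      "\<And>x. (\<lambda>m. \<theta> m x) \<longlonglongrightarrow> indicator (box a c) x"
      by (rule box_indicator_approximation[OF K]) (rule that)
    have "continuous_on UNIV (\<theta> m)" for m
      using \<theta>(1)[of m] by (auto simp: test_function_def dest: spec[of _ 0])
    then have [measurable]: "\<theta> m \<in> borel_measurable borel" for m
      by (rule borel_measurable_continuous_onI)
    have "(\<lambda>m. LINT x|lborel. of_real (\<theta> m x) * w x) \<longlonglongrightarrow> (LINT x|lborel. of_real (indicator (box a c) x) * w x)"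
    proof (rule integral_dominated_convergence[where w = "\<lambda>x. norm (w x)"])
      show "AE x in lborel. norm (of_real (\<theta> m x) * w x) \<le> norm (w x)" for m
        using \<theta>(2)[of m] by (auto simp: norm_mult mult_left_le_one_le)
    qed (use w \<theta>(3) in \<open>auto intro!: tendsto_intros\<close>)
    then show ?thesis unfolding zero[OF \<theta>(1)] by (simp add: LIMSEQ_const_iff)
  qed
  have int: "integrable lborel (\<lambda>x. of_real (indicator (box a c) x) * w x)" for a c
    by (rule Bochner_Integration.integrable_bound[OF w]) (auto simp: norm_mult split: split_indicator)
  have "AE x in lborel. x \<in> A \<longrightarrow> Re (w x) = 0"
  proof (rule AE_zero_of_box_integrals_zero[OF _ A])
    show "(LINT x|lborel. indicator (box a c) x * Re (w x)) = 0" if "cbox a c \<subseteq> A" for a c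
      using integral_Re[OF int[of a c]] box[OF that] by simp
  qed (use w in auto)
  moreover have "AE x in lborel. x \<in> A \<longrightarrow> Im (w x) = 0"
  proof (rule AE_zero_of_box_integrals_zero[OF _ A])
    show "(LINT x|lborel. indicator (box a c) x * Im (w x)) = 0" if "cbox a c \<subseteq> A" for a c
      using integral_Im[OF int[of a c]] box[OF that] by simp
  qed (use w in auto)
  ultimately show ?thesis by eventually_elim (auto simp: complex_eq_iff)
qed

lemma test_function_has_derivative:
  assumes "test_function S \<phi>"
  shows "(\<phi> has_derivative frechet_derivative \<phi> (at x)) (at x)"
proof -
  have "C_diff (Suc 0) \<phi>" using assms by (simp add: test_function_def)
  then show ?thesis by (simp add: frechet_derivative_works)
qed

lemma test_function_linear: "test_function S \<phi> \<Longrightarrow> linear (frechet_derivative \<phi> (at x))"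
  using test_function_has_derivative has_derivative_linear by blast

lemma test_function_sum_Basis: "test_function S \<phi> \<Longrightarrow>
   frechet_derivative \<phi> (at x) v = (\<Sum>b\<in>Basis. (v \<bullet> b) * frechet_derivative \<phi> (at x) b)"
  using linear_sum[OF test_function_linear, of S \<phi> x "\<lambda>b. (v \<bullet> b) *\<^sub>R b" Basis]
    linear_scale[OF test_function_linear, of S \<phi> x]
  by (simp add: euclidean_representation)

lemma test_function_continuous: "test_function S \<phi> \<Longrightarrow> continuous_on UNIV \<phi>"
  by (auto simp: test_function_def dest: spec[of _ 0])

lemma test_function_deriv_continuous:
  assumes "test_function S \<phi>"
  shows "continuous_on UNIV (\<lambda>x. frechet_derivative \<phi> (at x) v)"
proof -
  have "C_diff (Suc 0) \<phi>" using assms by (simp add: test_function_def)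
  then show ?thesis
    by (subst test_function_sum_Basis[OF assms]) (auto intro!: continuous_intros)
qed

lemma test_function_zero:
  assumes "test_function S \<phi>" "x \<notin> closure {x. \<phi> x \<noteq> 0}"
  shows "\<phi> x = 0" "frechet_derivative \<phi> (at x) v = 0"
proof -
  show "\<phi> x = 0" using assms closure_subset[of "{x. \<phi> x \<noteq> 0}"] by auto
  have "(\<phi> has_derivative (\<lambda>_. 0)) (at x)"
  proof (rule has_derivative_transform_within_open[where f = "\<lambda>_. 0" and s = "- closure {x. \<phi> x \<noteq> 0}"])
    show "0 = \<phi> y" if "y \<in> - closure {x. \<phi> x \<noteq> 0}" for y
      using that closure_subset[of "{x. \<phi> x \<noteq> 0}"] by auto
  qed (use assms in auto)
  then show "frechet_derivative \<phi> (at x) v = 0"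
    using fun_cong[OF frechet_derivative_at, of \<phi> "\<lambda>_. 0" x v] by simp
qed

lemma test_function_zero_outside:
  assumes "test_function S \<phi>" "x \<notin> S"
  shows "\<phi> x = 0" "frechet_derivative \<phi> (at x) v = 0"
proof -
  have x: "x \<notin> closure {x. \<phi> x \<noteq> 0}" using assms by (auto simp: test_function_def)
  show "\<phi> x = 0" "frechet_derivative \<phi> (at x) v = 0"
    by (rule test_function_zero[OF assms(1) x])+
qed

lemma compact_support_bounded:
  fixes f :: "'a::euclidean_space \<Rightarrow> real"
  assumes "continuous_on UNIV f" "compact K" "\<And>x. x \<notin> K \<Longrightarrow> f x = 0"
  obtains B where "\<And>x. \<bar>f x\<bar> \<le> B" "B \<ge> 0"
proof -
  have "compact (f ` K)" using assms by (intro compact_continuous_image) (auto intro: continuous_on_subset)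
  then obtain B where B: "\<And>x. x \<in> K \<Longrightarrow> \<bar>f x\<bar> \<le> B"
    using compact_imp_bounded[of "f ` K"] by (auto simp: bounded_iff)
  have "\<bar>f x\<bar> \<le> max B 0" for x using B[of x] assms(3)[of x] by (cases "x \<in> K") auto
  then show ?thesis using that[of "max B 0"] by auto
qed

lemma test_function_bounded:
  assumes "test_function S \<phi>"
  obtains B where "\<And>x. \<bar>\<phi> x\<bar> \<le> B" "\<And>x. \<bar>frechet_derivative \<phi> (at x) v\<bar> \<le> B" "B \<ge> 0"
proof -
  have K: "compact (closure {x. \<phi> x \<noteq> 0})" using assms by (simp add: test_function_def)
  obtain B1 where 1: "\<And>x. \<bar>\<phi> x\<bar> \<le> B1" "B1 \<ge> 0"
    by (rule compact_support_bounded[OF test_function_continuous[OF assms] K test_function_zero(1)[OF assms]]) (assumption, rule that)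
  obtain B2 where 2: "\<And>x. \<bar>frechet_derivative \<phi> (at x) v\<bar> \<le> B2" "B2 \<ge> 0"
    by (rule compact_support_bounded[OF test_function_deriv_continuous[OF assms] K test_function_zero(2)[OF assms]]) (assumption, rule that)
  show ?thesis
    by (rule that[of "max B1 B2"]) (use 1 2 in \<open>auto intro: max.coboundedI1 max.coboundedI2\<close>)
qed

lemma test_function_measurable [measurable_dest]:
  assumes "test_function S \<phi>"
  shows "\<phi> \<in> borel_measurable borel" "(\<lambda>x. frechet_derivative \<phi> (at x) v) \<in> borel_measurable borel"
  using assms test_function_continuous test_function_deriv_continuous
  by (auto intro!: borel_measurable_continuous_onI)

lemma frechet_derivative_shift:
  assumes "(\<phi> has_derivative frechet_derivative \<phi> (at (x + a))) (at (x + a))"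
  shows "frechet_derivative (\<lambda>x. \<phi> (x + a)) (at x) = frechet_derivative \<phi> (at (x + a))"
    "((\<lambda>x. \<phi> (x + a)) has_derivative frechet_derivative \<phi> (at (x + a))) (at x)"
proof -
  have "((\<lambda>x. x + a) has_derivative (\<lambda>x. x)) (at x)" by (auto intro!: derivative_eq_intros)
  from has_derivative_compose[OF this, of \<phi> "frechet_derivative \<phi> (at (x + a))"] assms
  show *: "((\<lambda>x. \<phi> (x + a)) has_derivative frechet_derivative \<phi> (at (x + a))) (at x)" by simp
  show "frechet_derivative (\<lambda>x. \<phi> (x + a)) (at x) = frechet_derivative \<phi> (at (x + a))"
    using frechet_derivative_at[OF *] by simp
qed

lemma C_diff_shift: "C_diff k \<phi> \<Longrightarrow> C_diff k (\<lambda>x. \<phi> (x + a))"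
proof (induction k arbitrary: \<phi>)
  case 0
  then show ?case by (auto intro!: continuous_on_compose2[of UNIV \<phi>] continuous_intros)
next
  case (Suc k)
  have d: "(\<phi> has_derivative frechet_derivative \<phi> (at x)) (at x)" for x
    using Suc.prems by (simp add: frechet_derivative_works)
  have "C_diff k (\<lambda>x. frechet_derivative \<phi> (at (x + a)) i)" if "i \<in> Basis" for i
    using Suc.prems that by (intro Suc.IH[of "\<lambda>x. frechet_derivative \<phi> (at x) i"]) simp
  moreover have "(\<lambda>x. \<phi> (x + a)) differentiable at x" for x
    using frechet_derivative_shift(2)[OF d] by (auto simp: differentiable_def)
  ultimately show ?case by (simp add: frechet_derivative_shift(1)[OF d])
qed

lemma test_function_shift:
  assumes "test_function S \<phi>" "\<And>x. x \<in> S \<Longrightarrow> x - a \<in> T"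
  shows "test_function T (\<lambda>x. \<phi> (x + a))"
proof -
  let ?K = "closure {x. \<phi> x \<noteq> 0}"
  have K: "compact ?K" "?K \<subseteq> S" using assms by (auto simp: test_function_def)
  have "{x. \<phi> (x + a) \<noteq> 0} = (\<lambda>x. - a + x) ` {x. \<phi> x \<noteq> 0}"
    by (force simp: image_iff algebra_simps intro: exI[of _ "_ + a"])
  then have "closure {x. \<phi> (x + a) \<noteq> 0} = (\<lambda>x. - a + x) ` ?K"
    by (simp only: closure_translation)
  moreover have "compact ((\<lambda>x. - a + x) ` ?K)" by (intro compact_translation K)
  moreover have "(\<lambda>x. - a + x) ` ?K \<subseteq> T" using K assms(2) by auto
  moreover have "\<forall>k. C_diff k (\<lambda>x. \<phi> (x + a))"
    by (intro allI C_diff_shift) (use assms in \<open>simp add: test_function_def\<close>)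
  ultimately show ?thesis unfolding test_function_def by simp
qed

section \<open>Translations of functions with weak derivatives\<close>

lemma measurable_shift [measurable]: "(\<lambda>x. x + a :: 'a::euclidean_space) \<in> borel_measurable borel"
  by (intro borel_measurable_continuous_onI continuous_intros)

lemma nn_integral_lborel_shift:
  fixes f :: "'a::euclidean_space \<Rightarrow> ennreal"
  assumes [measurable]: "f \<in> borel_measurable borel"
  shows "(\<integral>\<^sup>+x. f (x + a) \<partial>lborel) = (\<integral>\<^sup>+x. f x \<partial>lborel)"
proof -
  have "(\<integral>\<^sup>+x. f x \<partial>lborel) = (\<integral>\<^sup>+x. f x \<partial>(distr lborel borel ((+) a)))"
    by (simp add: lborel_distr_plus)
  also have "\<dots> = (\<integral>\<^sup>+x. f (a + x) \<partial>lborel)" by (subst nn_integral_distr) auto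
  finally show ?thesis by (simp add: add.commute)
qed

lemma integral_lborel_shift:
  fixes f :: "'a::euclidean_space \<Rightarrow> 'b::{banach, second_countable_topology}"
  assumes [measurable]: "f \<in> borel_measurable borel"
  shows "(LINT x|lborel. f (x + a)) = (LINT x|lborel. f x)"
proof -
  have "(LINT x|lborel. f x) = (LINT x|(distr lborel borel ((+) a)). f x)"
    by (simp add: lborel_distr_plus)
  also have "\<dots> = (LINT x|lborel. f (a + x))" by (subst integral_distr) auto
  finally show ?thesis by (simp add: add.commute)
qed

lemma integrable_lborel_shift:
  fixes f :: "'a::euclidean_space \<Rightarrow> 'b::{banach, second_countable_topology}"
  assumes "integrable lborel f"
  shows "integrable lborel (\<lambda>x. f (x + a))"
proof -
  have [measurable]: "f \<in> borel_measurable borel" using assms by auto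
  have "integrable (distr lborel borel ((+) a)) f" using assms by (simp add: lborel_distr_plus)
  then have "integrable lborel (\<lambda>x. f (a + x))" by (subst (asm) integrable_distr_eq) auto
  then show ?thesis by (simp add: add.commute)
qed

lemma shift_pair_measurable [measurable]:
  fixes v :: "'a::euclidean_space"
  shows "(\<lambda>p. snd p + fst p *\<^sub>R v) \<in> borel_measurable (lborel \<Otimes>\<^sub>M lborel)"
    "(\<lambda>p. snd p + (- fst p) *\<^sub>R v) \<in> borel_measurable (lborel \<Otimes>\<^sub>M lborel)"
    "(\<lambda>t. x + t *\<^sub>R v) \<in> borel_measurable borel"
  unfolding lborel_prod
  by (auto intro!: borel_measurable_continuous_onI continuous_intros)

lemma integrable_segment_shift:
  fixes w :: "'a::euclidean_space \<Rightarrow> complex"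
  assumes w: "integrable lborel w"
  shows "integrable (lborel \<Otimes>\<^sub>M lborel) (\<lambda>(t, x). of_real (indicator {0..1::real} t) * w (x + t *\<^sub>R v))"
proof (rule lborel_pair.Fubini_integrable)
  have [measurable]: "w \<in> borel_measurable borel" using w by auto
  show "(\<lambda>(t, x). complex_of_real (indicator {0..1} t) * w (x + t *\<^sub>R v)) \<in> borel_measurable (lborel \<Otimes>\<^sub>M lborel)"
    unfolding split_beta by measurable
  show "AE t in lborel. integrable lborel (\<lambda>y. case (t, y) of (t, x) \<Rightarrow> complex_of_real (indicator {0..1} t) * w (x + t *\<^sub>R v))"
    using integrable_lborel_shift[OF w] by simp
  have "(LINT y|lborel. norm (complex_of_real (indicator {0..1} t) * w (y + t *\<^sub>R v)))
      = indicator {0..1} t * (LINT y|lborel. norm (w y))" for t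
    using integral_lborel_shift[of "\<lambda>y. norm (w y)"] by (simp add: norm_mult)
  then show "integrable lborel (\<lambda>x. LINT y|lborel. norm (case (x, y) of (t, x) \<Rightarrow> complex_of_real (indicator {0..1} t) * w (x + t *\<^sub>R v)))"
    by simp
qed

text \<open>
  Fubini's theorem for averages along segments. The bounded factor \<open>c\<close> is a test function or a shifted
  derivative of one in the applications.
\<close>
lemma LINT_segment_swap:
  fixes w :: "'a::euclidean_space \<Rightarrow> complex" and c :: "real \<Rightarrow> 'a \<Rightarrow> real"
  assumes w: "integrable lborel w" and c: "(\<lambda>p. c (fst p) (snd p)) \<in> borel_measurable (lborel \<Otimes>\<^sub>M lborel)"
    and B: "\<And>t x. \<bar>c t x\<bar> \<le> B"
  shows "(LINT x|lborel. LINT t|lborel. of_real (indicator {0..1} t * c t x) * w (x + t *\<^sub>R v))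
    = (LINT t|lborel. LINT x|lborel. of_real (indicator {0..1} t * c t x) * w (x + t *\<^sub>R v))"
    "integrable lborel (\<lambda>x. LINT t|lborel. of_real (indicator {0..1} t * c t x) * w (x + t *\<^sub>R v))"
proof -
  have [measurable]: "w \<in> borel_measurable borel" using w by auto
  note c[measurable]
  have int: "integrable (lborel \<Otimes>\<^sub>M lborel) (\<lambda>(t, x). of_real (indicator {0..1::real} t * c t x) * w (x + t *\<^sub>R v))"
  proof (rule Bochner_Integration.integrable_bound)
    show "integrable (lborel \<Otimes>\<^sub>M lborel) (\<lambda>p. B * norm (case p of (t, x) \<Rightarrow> of_real (indicator {0..1::real} t) * w (x + t *\<^sub>R v)))"
      by (intro integrable_mult_right integrable_norm integrable_segment_shift w)
    show "(\<lambda>(t, x). of_real (indicator {0..1::real} t * c t x) * w (x + t *\<^sub>R v)) \<in> borel_measurable (lborel \<Otimes>\<^sub>M lborel)"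
      unfolding split_beta by measurable
    show "AE p in lborel \<Otimes>\<^sub>M lborel. norm (case p of (t, x) \<Rightarrow> of_real (indicator {0..1::real} t * c t x) * w (x + t *\<^sub>R v))
       \<le> norm (B * norm (case p of (t, x) \<Rightarrow> of_real (indicator {0..1::real} t) * w (x + t *\<^sub>R v)))"
    proof (rule AE_I2)
      fix p :: "real \<times> 'a"
      obtain t x where p: "p = (t, x)" by (cases p)
      have "\<bar>c t x\<bar> \<le> \<bar>B\<bar>" using B[of t x] by linarith
      then have "(\<bar>indicator {0..1} t\<bar> * norm (w (x + t *\<^sub>R v))) * \<bar>c t x\<bar> \<le> (\<bar>indicator {0..1} t\<bar> * norm (w (x + t *\<^sub>R v))) * \<bar>B\<bar>"
        by (intro mult_left_mono) auto
      then show "norm (case p of (t, x) \<Rightarrow> of_real (indicator {0..1::real} t * c t x) * w (x + t *\<^sub>R v))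
        \<le> norm (B * norm (case p of (t, x) \<Rightarrow> of_real (indicator {0..1::real} t) * w (x + t *\<^sub>R v)))"
        by (simp add: p norm_mult abs_mult mult_ac)
    qed
  qed
  show "(LINT x|lborel. LINT t|lborel. of_real (indicator {0..1} t * c t x) * w (x + t *\<^sub>R v))
    = (LINT t|lborel. LINT x|lborel. of_real (indicator {0..1} t * c t x) * w (x + t *\<^sub>R v))"
    by (rule lborel_pair.Fubini_integral[OF int])
  show "integrable lborel (\<lambda>x. LINT t|lborel. of_real (indicator {0..1} t * c t x) * w (x + t *\<^sub>R v))"
    by (rule lborel_pair.integrable_snd[OF int])
qed

text \<open>
  A directional version of the weak derivative for functions on the whole space that vanish outside the
  domain. Restriction to an open subset then only means testing with fewer functions.
\<close>
definition weak_directional :: "'a::euclidean_space set \<Rightarrow> 'a \<Rightarrow> ('a \<Rightarrow> complex) \<Rightarrow> ('a \<Rightarrow> complex) \<Rightarrow> bool" where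
  "weak_directional A v u g \<longleftrightarrow> (\<forall>\<phi>. test_function A \<phi> \<longrightarrow>
     (LINT x|lborel. of_real (frechet_derivative \<phi> (at x) v) * u x) = - (LINT x|lborel. of_real (\<phi> x) * g x))"

lemma weak_directional_mono: "weak_directional S v u g \<Longrightarrow> A \<subseteq> S \<Longrightarrow> weak_directional A v u g"
  by (auto simp: weak_directional_def dest: test_function_mono)

lemma integrable_bounded_mult:
  fixes w :: "'a::euclidean_space \<Rightarrow> complex"
  assumes "integrable lborel w" "f \<in> borel_measurable borel" "\<And>x. \<bar>f x\<bar> \<le> B"
  shows "integrable lborel (\<lambda>x. of_real (f x) * w x)"
proof (rule Bochner_Integration.integrable_bound)
  show "integrable lborel (\<lambda>x. B * norm (w x))" using assms by auto
  show "(\<lambda>x. of_real (f x) * w x) \<in> borel_measurable lborel"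
    using assms by (auto intro!: borel_measurable_times borel_measurable_of_real)
  have "\<bar>f x\<bar> \<le> \<bar>B\<bar>" for x using assms(3)[of x] by linarith
  then show "AE x in lborel. norm (of_real (f x) * w x) \<le> norm (B * norm (w x))"
    by (auto simp: norm_mult abs_mult intro!: mult_right_mono)
qed

lemma weak_directional_combine:
  fixes u :: "'a::euclidean_space \<Rightarrow> complex"
  assumes "\<And>b. b \<in> Basis \<Longrightarrow> weak_directional S b u (g b)" "integrable lborel u" "\<And>b. b \<in> Basis \<Longrightarrow> integrable lborel (g b)"
  shows "weak_directional S v u (\<lambda>x. \<Sum>b\<in>Basis. of_real (v \<bullet> b) * g b x)"
  unfolding weak_directional_def
proof (intro allI impI)
  fix \<phi> assume \<phi>: "test_function S \<phi>"
  note m = test_function_measurable[OF \<phi>]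
  have "(LINT x|lborel. of_real (frechet_derivative \<phi> (at x) v) * u x)
     = (LINT x|lborel. (\<Sum>b\<in>Basis. of_real (v \<bullet> b) * (of_real (frechet_derivative \<phi> (at x) b) * u x)))"
    by (subst test_function_sum_Basis[OF \<phi>]) (simp add: sum_distrib_right mult.assoc)
  also have "\<dots> = (\<Sum>b\<in>Basis. of_real (v \<bullet> b) * (LINT x|lborel. of_real (frechet_derivative \<phi> (at x) b) * u x))"
  proof (subst Bochner_Integration.integral_sum)
    fix b :: 'a
    obtain B where "\<And>x. \<bar>frechet_derivative \<phi> (at x) b\<bar> \<le> B"
      by (rule test_function_bounded[OF \<phi>, of b]) (rule that)
    then show "integrable lborel (\<lambda>x. of_real (v \<bullet> b) * (of_real (frechet_derivative \<phi> (at x) b) * u x))"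
      by (intro integrable_mult_right integrable_bounded_mult[OF assms(2) m(2)])
  qed simp
  also have "\<dots> = (\<Sum>b\<in>Basis. of_real (v \<bullet> b) * - (LINT x|lborel. of_real (\<phi> x) * g b x))"
    using assms(1) \<phi> by (intro sum.cong) (auto simp: weak_directional_def)
  also have "\<dots> = - (\<Sum>b\<in>Basis. (LINT x|lborel. of_real (v \<bullet> b) * (of_real (\<phi> x) * g b x)))"
    by (simp add: sum_negf)
  also have "\<dots> = - (LINT x|lborel. (\<Sum>b\<in>Basis. of_real (v \<bullet> b) * (of_real (\<phi> x) * g b x)))"
  proof (subst Bochner_Integration.integral_sum)
    fix b :: 'a assume b: "b \<in> Basis"
    obtain B where "\<And>x. \<bar>\<phi> x\<bar> \<le> B"
      by (rule test_function_bounded[OF \<phi>, of b]) (rule that)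
    then show "integrable lborel (\<lambda>x. of_real (v \<bullet> b) * (of_real (\<phi> x) * g b x))"
      by (intro integrable_mult_right integrable_bounded_mult[OF assms(3)[OF b] m(1)])
  qed simp
  finally show "(LINT x|lborel. of_real (frechet_derivative \<phi> (at x) v) * u x)
     = - (LINT x|lborel. of_real (\<phi> x) * (\<Sum>b\<in>Basis. of_real (v \<bullet> b) * g b x))"
    by (simp add: sum_distrib_left mult_ac)
qed

lemma open_segment_translates:
  fixes S :: "'a::euclidean_space set"
  assumes "open S"
  shows "open {x. \<forall>t\<in>{0..1}. x + t *\<^sub>R v \<in> S}"
proof -
  have "compact ((\<lambda>t. t *\<^sub>R v) ` {0..1::real})"
    by (intro compact_continuous_image continuous_intros) auto
  then have "closed (\<Union>x\<in>- S. \<Union>y\<in>(\<lambda>t. t *\<^sub>R v) ` {0..1::real}. {x - y})"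
    using assms by (intro closed_compact_differences) auto
  moreover have "(\<Union>x\<in>- S. \<Union>y\<in>(\<lambda>t. t *\<^sub>R v) ` {0..1::real}. {x - y}) = - {x. \<forall>t\<in>{0..1}. x + t *\<^sub>R v \<in> S}"
    by (auto simp: algebra_simps) (metis ComplI atLeastAtMost_iff)
  ultimately show ?thesis by (simp add: open_closed)
qed

lemma test_function_translate_FTC:
  assumes \<phi>: "test_function S \<phi>"
  shows "(LINT t|lborel. indicator {0..1} t * frechet_derivative \<phi> (at (y + (- t) *\<^sub>R v)) v) = \<phi> y - \<phi> (y - v)"
proof -
  have "(LINT t|lborel. (- frechet_derivative \<phi> (at (y + (- t) *\<^sub>R v)) v) * indicator {0..1} t)
     = \<phi> (y + (- 1) *\<^sub>R v) - \<phi> (y + (- 0) *\<^sub>R v)"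
  proof (rule integral_FTC_Icc_real)
    fix t :: real
    have 1: "((\<lambda>t. y + (- t) *\<^sub>R v) has_derivative (\<lambda>h. (- h) *\<^sub>R v)) (at t)"
      by (auto intro!: derivative_eq_intros)
    have "((\<lambda>t. \<phi> (y + (- t) *\<^sub>R v)) has_derivative (\<lambda>h. frechet_derivative \<phi> (at (y + (- t) *\<^sub>R v)) ((- h) *\<^sub>R v))) (at t)"
      by (rule has_derivative_compose[OF 1 test_function_has_derivative[OF \<phi>]])
    then show "((\<lambda>t. \<phi> (y + (- t) *\<^sub>R v)) has_real_derivative - frechet_derivative \<phi> (at (y + (- t) *\<^sub>R v)) v) (at t)"
      unfolding has_field_derivative_def linear_scale[OF test_function_linear[OF \<phi>]]
      by (rule has_derivative_eq_rhs) auto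
    have "continuous_on UNIV (\<lambda>t. frechet_derivative \<phi> (at (y + (- t) *\<^sub>R v)) v)"
      by (rule continuous_on_compose2[OF test_function_deriv_continuous[OF \<phi>]]) (auto intro!: continuous_intros)
    then show "isCont (\<lambda>t. - frechet_derivative \<phi> (at (y + (- t) *\<^sub>R v)) v) t"
      by (intro continuous_intros) (simp add: continuous_on_eq_continuous_at)
  qed simp
  then show ?thesis by (simp add: mult.commute)
qed

text \<open>
  Let \<open>A\<close> be the open set of starting points whose segment stays in \<open>S\<close>. For a test function \<open>\<phi>\<close> on \<open>A\<close>,
  move the translation from \<open>u\<close> to \<open>\<phi>\<close>, write \<open>\<phi> y - \<phi> (y - v)\<close> as an integral of derivatives of the
  shifted functions \<open>\<phi> (y - t v)\<close>, which are test functions on \<open>S\<close>, and move the derivative back to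
  \<open>u\<close>. The fundamental lemma on \<open>A\<close> turns equality of the pairings into equality almost everywhere.
\<close>
theorem weak_derivative_translation:
  fixes u g :: "'a::euclidean_space \<Rightarrow> complex"
  assumes S: "open S" and u: "integrable lborel u" and g: "integrable lborel g" and w: "weak_directional S v u g"
  shows "AE x in lborel. (\<forall>t\<in>{0..1}. x + t *\<^sub>R v \<in> S) \<longrightarrow>
    u (x + v) - u x = (LINT t|lborel. of_real (indicator {0..1} t) * g (x + t *\<^sub>R v))"
proof -
  define A where "A = {x. \<forall>t\<in>{0..1}. x + t *\<^sub>R v \<in> S}"
  define G where "G x = (LINT t|lborel. of_real (indicator {0..1} t) * g (x + t *\<^sub>R v))" for x
  have [measurable]: "u \<in> borel_measurable borel" "g \<in> borel_measurable borel" using u g by auto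
  have G: "integrable lborel G"
    using LINT_segment_swap(2)[OF g, of "\<lambda>_ _. 1" 1 v] by (simp add: G_def[abs_def])
  have "AE x in lborel. x \<in> A \<longrightarrow> u (x + v) - u x - G x = 0"
  proof (rule fundamental_lemma)
    show "open A" unfolding A_def by (rule open_segment_translates[OF S])
    show "integrable lborel (\<lambda>x. u (x + v) - u x - G x)"
      by (intro Bochner_Integration.integrable_diff integrable_lborel_shift u G)
    fix \<phi> assume \<phi>: "test_function A \<phi>"
    note m[measurable] = test_function_measurable[OF \<phi>]
    obtain B where B: "\<And>x. \<bar>\<phi> x\<bar> \<le> B" "\<And>x. \<bar>frechet_derivative \<phi> (at x) v\<bar> \<le> B"
      by (rule test_function_bounded[OF \<phi>, of v]) (rule that)
    note ib = integrable_bounded_mult[OF _ m(1) B(1)]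
    have "(LINT x|lborel. of_real (\<phi> x) * (u (x + v) - u x))
        = (LINT x|lborel. of_real (\<phi> x) * u (x + v)) - (LINT x|lborel. of_real (\<phi> x) * u x)"
      unfolding right_diff_distrib
      by (intro Bochner_Integration.integral_diff ib u integrable_lborel_shift)
    also have "(LINT x|lborel. of_real (\<phi> x) * u (x + v)) = (LINT y|lborel. of_real (\<phi> (y - v)) * u y)"
      using integral_lborel_shift[of "\<lambda>y. of_real (\<phi> (y - v)) * u y" v] by simp
    also have "\<dots> - (LINT y|lborel. of_real (\<phi> y) * u y) = - (LINT y|lborel. of_real (\<phi> y - \<phi> (y - v)) * u y)"
    proof -
      have 1: "integrable lborel (\<lambda>y. of_real (\<phi> (y - v)) * u y)"
        by (rule integrable_bounded_mult[OF u _ B(1)]) measurable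
      show ?thesis
        unfolding of_real_diff left_diff_distrib Bochner_Integration.integral_diff[OF ib[OF u] 1] by simp
    qed
    also have "(LINT y|lborel. of_real (\<phi> y - \<phi> (y - v)) * u y)
      = (LINT y|lborel. LINT t|lborel. of_real (indicator {0..1} t * frechet_derivative \<phi> (at (y + (- t) *\<^sub>R v)) v) * u (y + t *\<^sub>R 0))"
      unfolding test_function_translate_FTC[OF \<phi>, symmetric]
      by (simp del: of_real_mult)
    also have "\<dots> = (LINT t|lborel. LINT y|lborel. of_real (indicator {0..1} t * frechet_derivative \<phi> (at (y + (- t) *\<^sub>R v)) v) * u (y + t *\<^sub>R 0))"
      by (rule LINT_segment_swap(1)[OF u _ B(2)])
        (rule measurable_compose[OF shift_pair_measurable(2) m(2)])
    also have "\<dots> = (LINT t|lborel. - (LINT x|lborel. of_real (indicator {0..1} t * \<phi> x) * g (x + t *\<^sub>R v)))"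
    proof (rule Bochner_Integration.integral_cong)
      fix t :: real
      show "(LINT y|lborel. of_real (indicator {0..1} t * frechet_derivative \<phi> (at (y + (- t) *\<^sub>R v)) v) * u (y + t *\<^sub>R 0))
        = - (LINT x|lborel. of_real (indicator {0..1} t * \<phi> x) * g (x + t *\<^sub>R v))"
      proof (cases "t \<in> {0..1}")
        case True
        have "test_function S (\<lambda>x. \<phi> (x + (- t) *\<^sub>R v))"
          by (rule test_function_shift[OF \<phi>]) (use True in \<open>auto simp: A_def\<close>)
        then have "(LINT x|lborel. of_real (frechet_derivative (\<lambda>x. \<phi> (x + (- t) *\<^sub>R v)) (at x) v) * u x)
          = - (LINT x|lborel. of_real (\<phi> (x + (- t) *\<^sub>R v)) * g x)"
          using w by (simp only: weak_directional_def)
        also have "(LINT x|lborel. of_real (\<phi> (x + (- t) *\<^sub>R v)) * g x) = (LINT x|lborel. of_real (\<phi> x) * g (x + t *\<^sub>R v))"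
          using integral_lborel_shift[of "\<lambda>x. of_real (\<phi> (x + (- t) *\<^sub>R v)) * g x" "t *\<^sub>R v"] by simp
        also have "(\<lambda>x. frechet_derivative (\<lambda>x. \<phi> (x + (- t) *\<^sub>R v)) (at x) v) = (\<lambda>x. frechet_derivative \<phi> (at (x + (- t) *\<^sub>R v)) v)"
          by (rule ext) (simp only: frechet_derivative_shift(1)[OF test_function_has_derivative[OF \<phi>]])
        finally show ?thesis using True by simp
      qed simp
    qed simp
    also have "\<dots> = - (LINT x|lborel. LINT t|lborel. of_real (indicator {0..1} t * \<phi> x) * g (x + t *\<^sub>R v))"
      by (subst LINT_segment_swap(1)[OF g _ B(1)]) (auto intro: measurable_compose[OF measurable_snd])
    also have "(\<lambda>x. LINT t|lborel. of_real (indicator {0..1} t * \<phi> x) * g (x + t *\<^sub>R v)) = (\<lambda>x. of_real (\<phi> x) * G x)"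
    proof
      fix x
      have "(LINT t|lborel. of_real (indicator {0..1} t * \<phi> x) * g (x + t *\<^sub>R v))
         = (LINT t|lborel. of_real (\<phi> x) * (of_real (indicator {0..1} t) * g (x + t *\<^sub>R v)))"
        by (simp add: mult_ac)
      then show "(LINT t|lborel. of_real (indicator {0..1} t * \<phi> x) * g (x + t *\<^sub>R v)) = of_real (\<phi> x) * G x"
        by (simp add: G_def)
    qed
    finally have eq: "(LINT x|lborel. of_real (\<phi> x) * (u (x + v) - u x)) = (LINT x|lborel. of_real (\<phi> x) * G x)"
      by simp
    have "(LINT x|lborel. of_real (\<phi> x) * (u (x + v) - u x - G x))
       = (LINT x|lborel. of_real (\<phi> x) * (u (x + v) - u x)) - (LINT x|lborel. of_real (\<phi> x) * G x)"
      unfolding right_diff_distrib[of _ "u _ - u _"]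
      by (intro Bochner_Integration.integral_diff ib G Bochner_Integration.integrable_diff integrable_lborel_shift u)
    then show "(LINT x|lborel. of_real (\<phi> x) * (u (x + v) - u x - G x)) = 0" using eq by simp
  qed
  then show ?thesis by eventually_elim (auto simp: A_def G_def)
qed

section \<open>Poincare inequality\<close>

lemma norm_diff_square_le:
  fixes a b :: "'a::real_normed_vector"
  shows "(norm (a - b))\<^sup>2 \<le> 2 * (norm a)\<^sup>2 + 2 * (norm b)\<^sup>2"
proof -
  have "(norm (a - b))\<^sup>2 \<le> (norm a + norm b)\<^sup>2" by (intro power_mono norm_triangle_ineq4) auto
  also have "\<dots> \<le> 2 * (norm a)\<^sup>2 + 2 * (norm b)\<^sup>2"
    using sum_squares_bound[of "norm a" "norm b"] by (simp add: power2_sum)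
  finally show ?thesis .
qed

definition weak_gradient :: "'a::euclidean_space set \<Rightarrow> ('a \<Rightarrow> complex) \<Rightarrow> ('a \<Rightarrow> 'a \<Rightarrow> complex) \<Rightarrow> bool" where
  "weak_gradient S u g \<longleftrightarrow> integrable lborel u \<and> integrable lborel (\<lambda>x. (norm (u x))\<^sup>2) \<and>
     (\<forall>b\<in>Basis. integrable lborel (g b) \<and> integrable lborel (\<lambda>x. (norm (g b x))\<^sup>2) \<and> weak_directional S b u (g b))"

definition energy :: "('a::euclidean_space \<Rightarrow> 'a \<Rightarrow> complex) \<Rightarrow> 'a \<Rightarrow> real" where
  "energy g x = (\<Sum>b\<in>Basis. (norm (g b x))\<^sup>2)"

lemma energy_nonneg [simp]: "0 \<le> energy g x"
  by (simp add: energy_def sum_nonneg)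

lemma weak_gradient_mono: "weak_gradient S u g \<Longrightarrow> A \<subseteq> S \<Longrightarrow> weak_gradient A u g"
  using weak_directional_mono[of S _ u _ A] unfolding weak_gradient_def by blast

lemma weak_gradient_measurable:
  assumes "weak_gradient S u g"
  shows "u \<in> borel_measurable borel" "b \<in> Basis \<Longrightarrow> g b \<in> borel_measurable borel"
    "energy g \<in> borel_measurable borel"
proof -
  show "u \<in> borel_measurable borel" using assms by (auto simp: weak_gradient_def)
  show g: "g b \<in> borel_measurable borel" if "b \<in> Basis" for b
    using assms that by (auto simp: weak_gradient_def)
  show "energy g \<in> borel_measurable borel"
    unfolding energy_def[abs_def]
    by (intro borel_measurable_sum borel_measurable_power measurable_compose[OF g borel_measurable_norm])
qed

lemma weak_gradient_integrable:
  assumes "weak_gradient S u g"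
  shows "integrable lborel (energy g)" "integrable lborel (\<lambda>x. (norm (u x))\<^sup>2)" "integrable lborel u"
  using assms unfolding energy_def[abs_def] weak_gradient_def by auto

lemma integrable_indicator_mult:
  fixes f :: "'a::euclidean_space \<Rightarrow> real"
  assumes "integrable lborel f" "A \<in> sets borel"
  shows "integrable lborel (\<lambda>x. indicator A x * f x)"
  using integrable_mult_indicator[of A lborel f] assms by simp

lemma directional_le_energy:
  fixes v :: "'a::euclidean_space"
  shows "(norm (\<Sum>b\<in>Basis. of_real (v \<bullet> b) * g b x))\<^sup>2 \<le> (norm v)\<^sup>2 * energy g x"
proof -
  have "norm (\<Sum>b\<in>Basis. of_real (v \<bullet> b) * g b x) \<le> (\<Sum>b\<in>Basis. \<bar>v \<bullet> b\<bar> * norm (g b x))"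
    by (rule order.trans[OF norm_sum]) (simp add: norm_mult)
  then have "(norm (\<Sum>b\<in>Basis. of_real (v \<bullet> b) * g b x))\<^sup>2 \<le> (\<Sum>b\<in>Basis. \<bar>v \<bullet> b\<bar> * norm (g b x))\<^sup>2"
    by (intro power_mono) auto
  also have "\<dots> \<le> (\<Sum>b\<in>Basis. \<bar>v \<bullet> b\<bar>\<^sup>2) * (\<Sum>b\<in>Basis. (norm (g b x))\<^sup>2)"
    by (rule Cauchy_Schwarz_ineq_sum)
  also have "(\<Sum>b\<in>Basis. \<bar>v \<bullet> b\<bar>\<^sup>2) = (norm v)\<^sup>2"
    using euclidean_inner[of v v] by (simp add: power2_norm_eq_inner power2_abs flip: power2_eq_square)
  finally show ?thesis by (simp add: energy_def)
qed

lemma segment_integral_square_bound: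
  fixes f :: "real \<Rightarrow> complex"
  assumes [measurable]: "f \<in> borel_measurable borel"
  shows "ennreal ((norm (LINT t|lborel. of_real (indicator {0..1} t) * f t))\<^sup>2)
    \<le> (\<integral>\<^sup>+t. indicator {0..1} t * ennreal ((norm (f t))\<^sup>2) \<partial>lborel)"
proof -
  define L where "L = (LINT t|lborel. of_real (indicator {0..1} t) * f t)"
  define N where "N = (\<integral>\<^sup>+t. (indicator {0..1} t :: ennreal) * (indicator {0..1} t * ennreal (norm (f t))) \<partial>lborel)"
  have "ennreal (norm L) \<le> N"
  proof (cases "integrable lborel (\<lambda>t. complex_of_real (indicator {0..1} t) * f t)")
    case True
    have "ennreal (norm L) \<le> (\<integral>\<^sup>+t. ennreal (norm (complex_of_real (indicator {0..1} t) * f t)) \<partial>lborel)"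
      unfolding L_def by (rule integral_norm_bound_ennreal[OF True])
    also have "\<dots> = N" unfolding N_def
      by (intro nn_integral_cong) (auto split: split_indicator)
    finally show ?thesis .
  next
    case False
    then show ?thesis by (simp add: L_def not_integrable_integral_eq)
  qed
  then have "(ennreal (norm L))\<^sup>2 \<le> N\<^sup>2" by (intro power_mono) auto
  also have "N\<^sup>2 \<le> (\<integral>\<^sup>+t. (indicator {0..1::real} t)\<^sup>2 \<partial>lborel) * (\<integral>\<^sup>+t. (indicator {0..1} t * ennreal (norm (f t)))\<^sup>2 \<partial>lborel)"
    unfolding N_def by (rule Cauchy_Schwarz_nn_integral) measurable
  also have "(\<integral>\<^sup>+t. (indicator {0..1::real} t)\<^sup>2 \<partial>lborel) = (\<integral>\<^sup>+t. indicator {0..1::real} t \<partial>lborel)"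
    by (intro nn_integral_cong) (auto split: split_indicator)
  also have "\<dots> = 1" by simp
  also have "(\<integral>\<^sup>+t. (indicator {0..1} t * ennreal (norm (f t)))\<^sup>2 \<partial>lborel) = (\<integral>\<^sup>+t. indicator {0..1} t * ennreal ((norm (f t))\<^sup>2) \<partial>lborel)"
    by (intro nn_integral_cong) (auto split: split_indicator simp: ennreal_power)
  finally show ?thesis by (simp add: L_def ennreal_power)
qed

text \<open>
  The translation identity, the Cauchy-Schwarz inequality on the segment, and Fubini's theorem
  together with translation invariance of the measure.
\<close>
lemma translation_estimate:
  fixes u :: "'a::euclidean_space \<Rightarrow> complex"
  assumes wg: "weak_gradient S u g" and S: "open S" and P: "P \<in> sets borel" and Q: "Q \<in> sets borel"
    and seg: "\<And>x t. x \<in> P \<Longrightarrow> 0 \<le> t \<Longrightarrow> t \<le> 1 \<Longrightarrow> x + t *\<^sub>R v \<in> S \<inter> Q"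
  shows "(\<integral>\<^sup>+x. indicator P x * ennreal ((norm (u (x + v) - u x))\<^sup>2) \<partial>lborel)
     \<le> ennreal ((norm v)\<^sup>2) * (\<integral>\<^sup>+x. indicator Q x * ennreal (energy g x) \<partial>lborel)"
proof -
  note wm[measurable] = weak_gradient_measurable[OF wg]
  note P[measurable] Q[measurable]
  define h where "h x = (\<Sum>b\<in>Basis. of_real (v \<bullet> b) * g b x)" for x
  have hm[measurable]: "h \<in> borel_measurable borel"
    unfolding h_def[abs_def] by (intro borel_measurable_sum borel_measurable_times borel_measurable_const wm)
  have hi: "integrable lborel h"
    using wg unfolding h_def[abs_def] weak_gradient_def by auto
  have "weak_directional S v u h"
    unfolding h_def[abs_def] by (rule weak_directional_combine) (use wg in \<open>auto simp: weak_gradient_def\<close>)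
  then have ae: "AE x in lborel. (\<forall>t\<in>{0..1}. x + t *\<^sub>R v \<in> S) \<longrightarrow>
    u (x + v) - u x = (LINT t|lborel. of_real (indicator {0..1} t) * h (x + t *\<^sub>R v))"
    using wg by (intro weak_derivative_translation S hi) (auto simp: weak_gradient_def)
  define E where "E x = indicator Q x * ennreal (energy g x)" for x
  have [measurable]: "E \<in> borel_measurable borel" unfolding E_def[abs_def] by measurable
  have "(\<integral>\<^sup>+x. indicator P x * ennreal ((norm (u (x + v) - u x))\<^sup>2) \<partial>lborel)
     \<le> (\<integral>\<^sup>+x. \<integral>\<^sup>+t. indicator {0..1} t * (ennreal ((norm v)\<^sup>2) * E (x + t *\<^sub>R v)) \<partial>lborel \<partial>lborel)"
  proof (rule nn_integral_mono_AE)
    show "AE x in lborel. indicator P x * ennreal ((norm (u (x + v) - u x))\<^sup>2)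
       \<le> (\<integral>\<^sup>+t. indicator {0..1} t * (ennreal ((norm v)\<^sup>2) * E (x + t *\<^sub>R v)) \<partial>lborel)"
      using ae
    proof eventually_elim
      case (elim x)
      show ?case
      proof (cases "x \<in> P")
        case True
        then have "u (x + v) - u x = (LINT t|lborel. of_real (indicator {0..1} t) * h (x + t *\<^sub>R v))"
          using elim seg by auto
        then have "ennreal ((norm (u (x + v) - u x))\<^sup>2) \<le> (\<integral>\<^sup>+t. indicator {0..1} t * ennreal ((norm (h (x + t *\<^sub>R v)))\<^sup>2) \<partial>lborel)"
          using segment_integral_square_bound[of "\<lambda>t. h (x + t *\<^sub>R v)"] by simp
        also have "\<dots> \<le> (\<integral>\<^sup>+t. indicator {0..1} t * (ennreal ((norm v)\<^sup>2) * E (x + t *\<^sub>R v)) \<partial>lborel)"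
        proof (rule nn_integral_mono)
          fix t :: real
          show "indicator {0..1} t * ennreal ((norm (h (x + t *\<^sub>R v)))\<^sup>2) \<le> indicator {0..1} t * (ennreal ((norm v)\<^sup>2) * E (x + t *\<^sub>R v))"
          proof (cases "t \<in> {0..1}")
            case t: True
            then have "x + t *\<^sub>R v \<in> Q" using seg[OF True, of t] by auto
            then have "ennreal ((norm v)\<^sup>2) * E (x + t *\<^sub>R v) = ennreal ((norm v)\<^sup>2 * energy g (x + t *\<^sub>R v))"
              by (simp add: E_def ennreal_mult energy_nonneg)
            then show ?thesis
              using directional_le_energy[of v g "x + t *\<^sub>R v"] t by (simp add: h_def ennreal_leI)
          qed simp
        qed
        finally show ?thesis using True by simp
      qed simp
    qed
  qed
  also have "\<dots> = (\<integral>\<^sup>+t. \<integral>\<^sup>+x. indicator {0..1} t * (ennreal ((norm v)\<^sup>2) * E (x + t *\<^sub>R v)) \<partial>lborel \<partial>lborel)"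
  proof (rule lborel_pair.Fubini')
    have "(\<lambda>p. E (snd p + fst p *\<^sub>R v)) \<in> borel_measurable (lborel \<Otimes>\<^sub>M lborel)"
      by (rule measurable_compose[OF shift_pair_measurable(1)]) measurable
    then show "(\<lambda>(t, x). indicator {0..1} t * (ennreal ((norm v)\<^sup>2) * E (x + t *\<^sub>R v))) \<in> borel_measurable (lborel \<Otimes>\<^sub>M lborel)"
      unfolding split_beta by measurable
  qed
  also have "\<dots> = (\<integral>\<^sup>+t. indicator {0..1::real} t * (ennreal ((norm v)\<^sup>2) * (\<integral>\<^sup>+x. E x \<partial>lborel)) \<partial>lborel)"
    by (simp add: nn_integral_cmult nn_integral_lborel_shift)
  also have "\<dots> = ennreal ((norm v)\<^sup>2) * (\<integral>\<^sup>+x. E x \<partial>lborel)"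
    by (simp add: nn_integral_multc)
  finally show ?thesis by (simp add: E_def)
qed

text \<open>
  The integral of \<open>|u x - u y|\<^sup>2\<close> over \<open>Q \<times> Q\<close> equals \<open>2 * |Q| * \<integral>|u|\<^sup>2 - 2 * |\<integral>u|\<^sup>2\<close>. With \<open>y = x + v\<close> it
  is an integral over \<open>v \<in> W\<close> of squared increments by \<open>v\<close>, each at most \<open>\<rho>\<^sup>2\<close> times the energy on \<open>Q\<close>.
  Convexity of \<open>Q\<close> is expressed by the hypothesis on segments, which suits half-open cubes.
\<close>
lemma poincare_on_set:
  fixes u :: "'a::euclidean_space \<Rightarrow> complex"
  assumes wg: "weak_gradient S u g" and S: "open S"
    and Q: "Q \<in> sets borel" "Q \<subseteq> S" "emeasure lborel Q < \<infinity>"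
    and W: "W \<in> sets borel" "emeasure lborel W < \<infinity>"
    and diff: "\<And>x v. x \<in> Q \<Longrightarrow> x + v \<in> Q \<Longrightarrow> v \<in> W \<and> norm v \<le> \<rho>"
    and seg: "\<And>x v t. x \<in> Q \<Longrightarrow> x + v \<in> Q \<Longrightarrow> 0 \<le> t \<Longrightarrow> t \<le> 1 \<Longrightarrow> x + t *\<^sub>R v \<in> Q"
  shows "measure lborel Q * (LINT x|lborel. indicator Q x * (norm (u x))\<^sup>2)
    \<le> measure lborel W * \<rho>\<^sup>2 / 2 * (LINT x|lborel. indicator Q x * energy g x)
      + (norm (LINT x|lborel. of_real (indicator Q x) * u x))\<^sup>2"
proof -
  note wm[measurable] = weak_gradient_measurable[OF wg]
  note wi = weak_gradient_integrable[OF wg]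
  note Q(1)[measurable] W(1)[measurable]
  define q where "q = measure lborel Q"
  define I2 where "I2 = (LINT x|lborel. indicator Q x * (norm (u x))\<^sup>2)"
  define m where "m = (LINT x|lborel. of_real (indicator Q x) * u x)"
  define E where "E = (LINT x|lborel. indicator Q x * energy g x)"
  have iQ: "integrable lborel (indicator Q :: 'a \<Rightarrow> real)" using Q by simp
  have iu: "integrable lborel (\<lambda>x. of_real (indicator Q x) * u x)"
    by (rule integrable_bounded_mult[OF wi(3), of _ 1]) (auto split: split_indicator)
  have i2: "integrable lborel (\<lambda>x. indicator Q x * (norm (u x))\<^sup>2)"
    by (rule integrable_indicator_mult[OF wi(2) Q(1)])
  define rr where "rr c y = Re (c * cnj (of_real (indicator Q y) * u y))" for c y
  have iR: "integrable lborel (rr c)"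
    and R: "(LINT y|lborel. rr c y) = Re (c * cnj m)" for c
  proof -
    have "integrable lborel (\<lambda>y. c * cnj (of_real (indicator Q y) * u y))"
      using iu by (intro integrable_mult_right integrable_cnj)
    note i = this
    show "integrable lborel (rr c)"
      unfolding rr_def[abs_def] by (rule integrable_Re[OF i])
    have "(LINT y|lborel. c * cnj (of_real (indicator Q y) * u y)) = c * (LINT y|lborel. cnj (of_real (indicator Q y) * u y))"
      by (rule integral_mult_right_zero)
    also have "(LINT y|lborel. cnj (of_real (indicator Q y) * u y)) = cnj m"
      unfolding m_def by (rule Bochner_Integration.integral_cnj)
    finally show "(LINT y|lborel. rr c y) = Re (c * cnj m)"
      unfolding rr_def integral_Re[OF i] by (rule arg_cong)
  qed
  have square_diff: "(norm (c - z))\<^sup>2 = (norm c)\<^sup>2 + (norm z)\<^sup>2 - 2 * Re (c * cnj z)" for c z :: complex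
    unfolding cmod_power2 by (simp add: power2_eq_square algebra_simps)
  have expand: "indicator Q y * (norm (c - u y))\<^sup>2 = (norm c)\<^sup>2 * indicator Q y + indicator Q y * (norm (u y))\<^sup>2
      - 2 * rr c y" for c :: complex and y
    by (auto simp: square_diff rr_def split: split_indicator)
  have inner_int: "integrable lborel (\<lambda>y. indicator Q y * (norm (c - u y))\<^sup>2)"
    and inner: "(LINT y|lborel. indicator Q y * (norm (c - u y))\<^sup>2) = (norm c)\<^sup>2 * q + I2 - 2 * Re (c * cnj m)" for c
    unfolding expand using iQ i2 iR[of c] R[of c]
    by (auto simp: q_def I2_def)
  have expand2: "indicator Q x * ((norm (u x))\<^sup>2 * q + I2 - 2 * Re (u x * cnj m))
     = q * (indicator Q x * (norm (u x))\<^sup>2) + I2 * indicator Q x - 2 * rr m x" for x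
    by (auto simp: rr_def algebra_simps split: split_indicator)
  have outer_int: "integrable lborel (\<lambda>x. indicator Q x * ((norm (u x))\<^sup>2 * q + I2 - 2 * Re (u x * cnj m)))"
    unfolding expand2 using iQ i2 iR[of m] by auto
  have "(LINT x|lborel. indicator Q x * ((norm (u x))\<^sup>2 * q + I2 - 2 * Re (u x * cnj m))) = q * I2 + I2 * q - 2 * Re (m * cnj m)"
    unfolding expand2 using iQ i2 iR[of m] R[of m]
    by (auto simp: q_def I2_def)
  also have "Re (m * cnj m) = (norm m)\<^sup>2"
    by (simp add: complex_norm_square[symmetric] flip: of_real_power)
  finally have outer: "(LINT x|lborel. indicator Q x * ((norm (u x))\<^sup>2 * q + I2 - 2 * Re (u x * cnj m))) = 2 * (q * I2) - 2 * (norm m)\<^sup>2"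
    by simp
  have pos: "0 \<le> (norm (u x))\<^sup>2 * q + I2 - 2 * Re (u x * cnj m)" for x
    unfolding inner[symmetric] by (intro Bochner_Integration.integral_nonneg) auto
  have "ennreal (2 * (q * I2) - 2 * (norm m)\<^sup>2)
      = (\<integral>\<^sup>+x. ennreal (indicator Q x * ((norm (u x))\<^sup>2 * q + I2 - 2 * Re (u x * cnj m))) \<partial>lborel)"
    unfolding outer[symmetric] using pos by (intro nn_integral_eq_integral[symmetric] outer_int) auto
  also have "\<dots> = (\<integral>\<^sup>+x. \<integral>\<^sup>+y. indicator Q x * ennreal (indicator Q y * (norm (u x - u y))\<^sup>2) \<partial>lborel \<partial>lborel)"
  proof (rule nn_integral_cong)
    fix x
    have "(\<integral>\<^sup>+y. ennreal (indicator Q y * (norm (u x - u y))\<^sup>2) \<partial>lborel) = ennreal ((norm (u x))\<^sup>2 * q + I2 - 2 * Re (u x * cnj m))"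
      unfolding inner[symmetric] by (intro nn_integral_eq_integral inner_int) auto
    then show "ennreal (indicator Q x * ((norm (u x))\<^sup>2 * q + I2 - 2 * Re (u x * cnj m)))
       = (\<integral>\<^sup>+y. indicator Q x * ennreal (indicator Q y * (norm (u x - u y))\<^sup>2) \<partial>lborel)"
      by (auto simp: nn_integral_cmult split: split_indicator)
  qed
  also have "\<dots> = (\<integral>\<^sup>+x. \<integral>\<^sup>+v. indicator Q x * ennreal (indicator Q (v + x) * (norm (u x - u (v + x)))\<^sup>2) \<partial>lborel \<partial>lborel)"
  proof (rule nn_integral_cong)
    fix x
    show "(\<integral>\<^sup>+y. indicator Q x * ennreal (indicator Q y * (norm (u x - u y))\<^sup>2) \<partial>lborel)
       = (\<integral>\<^sup>+v. indicator Q x * ennreal (indicator Q (v + x) * (norm (u x - u (v + x)))\<^sup>2) \<partial>lborel)"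
      by (subst nn_integral_lborel_shift[where a = x, symmetric]) auto
  qed
  also have "\<dots> = (\<integral>\<^sup>+v. \<integral>\<^sup>+x. indicator Q x * ennreal (indicator Q (v + x) * (norm (u x - u (v + x)))\<^sup>2) \<partial>lborel \<partial>lborel)"
  proof (rule lborel_pair.Fubini')
    have [measurable]: "(\<lambda>p :: 'a \<times> 'a. fst p + snd p) \<in> borel_measurable (lborel \<Otimes>\<^sub>M lborel)"
      unfolding lborel_prod by (auto intro!: borel_measurable_continuous_onI continuous_intros)
    show "(\<lambda>(v, x). indicator Q x * ennreal (indicator Q (v + x) * (norm (u x - u (v + x)))\<^sup>2)) \<in> borel_measurable (lborel \<Otimes>\<^sub>M lborel)"
      unfolding split_beta by measurable
  qed
  also have "\<dots> \<le> (\<integral>\<^sup>+v. indicator W v * (ennreal (\<rho>\<^sup>2) * ennreal E) \<partial>lborel)"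
  proof (rule nn_integral_mono)
    fix v :: 'a
    define P where "P = {x. x \<in> Q \<and> x + v \<in> Q}"
    have P: "P \<in> sets borel" unfolding P_def by measurable
    have eq: "indicator Q x * ennreal (indicator Q (v + x) * (norm (u x - u (v + x)))\<^sup>2)
       = indicator P x * ennreal ((norm (u (x + v) - u x))\<^sup>2)" for x
      by (auto simp: P_def add.commute norm_minus_commute split: split_indicator)
    show "(\<integral>\<^sup>+x. indicator Q x * ennreal (indicator Q (v + x) * (norm (u x - u (v + x)))\<^sup>2) \<partial>lborel) \<le> indicator W v * (ennreal (\<rho>\<^sup>2) * ennreal E)"
    proof (cases "P = {}")
      case True
      then show ?thesis unfolding eq by simp
    next
      case False
      then obtain x where "x \<in> Q" "x + v \<in> Q" by (auto simp: P_def)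
      then have v: "v \<in> W" "norm v \<le> \<rho>" using diff by auto
      have "(\<integral>\<^sup>+x. indicator P x * ennreal ((norm (u (x + v) - u x))\<^sup>2) \<partial>lborel)
        \<le> ennreal ((norm v)\<^sup>2) * (\<integral>\<^sup>+x. indicator Q x * ennreal (energy g x) \<partial>lborel)"
        by (rule translation_estimate[OF wg S P Q(1)]) (use seg Q(2) in \<open>auto simp: P_def\<close>)
      also have "(\<integral>\<^sup>+x. indicator Q x * ennreal (energy g x) \<partial>lborel) = (\<integral>\<^sup>+x. ennreal (indicator Q x * energy g x) \<partial>lborel)"
        by (intro nn_integral_cong) (auto split: split_indicator)
      also have "\<dots> = ennreal E"
        unfolding E_def 
        by (intro nn_integral_eq_integral integrable_indicator_mult wi(1) Q(1)) auto
      also have "ennreal ((norm v)\<^sup>2) * ennreal E \<le> ennreal (\<rho>\<^sup>2) * ennreal E"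
        using v by (intro mult_right_mono ennreal_leI power_mono) auto
      finally show ?thesis unfolding eq using v by simp
    qed
  qed
  also have "\<dots> = ennreal (measure lborel W) * (ennreal (\<rho>\<^sup>2) * ennreal E)"
    using W by (simp add: nn_integral_multc emeasure_eq_ennreal_measure)
  also have "\<dots> = ennreal (measure lborel W * \<rho>\<^sup>2 * E)"
  proof -
    have "0 \<le> E" unfolding E_def  by (intro Bochner_Integration.integral_nonneg) auto
    then show ?thesis by (simp add: ennreal_mult[symmetric] mult.assoc)
  qed
  finally have "ennreal (2 * (q * I2) - 2 * (norm m)\<^sup>2) \<le> ennreal (measure lborel W * \<rho>\<^sup>2 * E)" .
  moreover have "0 \<le> measure lborel W * \<rho>\<^sup>2 * E"
    unfolding E_def  by (intro mult_nonneg_nonneg Bochner_Integration.integral_nonneg) auto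
  ultimately have "2 * (q * I2) - 2 * (norm m)\<^sup>2 \<le> measure lborel W * \<rho>\<^sup>2 * E"
    by (simp add: ennreal_le_iff)
  then show ?thesis unfolding q_def I2_def m_def E_def by simp
qed

section \<open>Control of the square norm by the gradient and finitely many averages\<close>

lemma translation_estimate_real:
  fixes u :: "'a::euclidean_space \<Rightarrow> complex"
  assumes wg: "weak_gradient S u g" and S: "open S" and P: "P \<in> sets borel"
    and seg: "\<And>x t. x \<in> P \<Longrightarrow> 0 \<le> t \<Longrightarrow> t \<le> 1 \<Longrightarrow> x + t *\<^sub>R v \<in> S"
  shows "integrable lborel (\<lambda>x. indicator P x * (norm (u (x + v) - u x))\<^sup>2)"
    "(LINT x|lborel. indicator P x * (norm (u (x + v) - u x))\<^sup>2)
     \<le> (norm v)\<^sup>2 * (LINT x|lborel. indicator S x * energy g x)"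
proof -
  note wm[measurable] = weak_gradient_measurable[OF wg]
  note wi = weak_gradient_integrable[OF wg]
  note P[measurable]
  have Sb: "S \<in> sets borel" using S by auto
  note sq = norm_diff_square_le
  show int: "integrable lborel (\<lambda>x. indicator P x * (norm (u (x + v) - u x))\<^sup>2)"
  proof (rule Bochner_Integration.integrable_bound)
    show "integrable lborel (\<lambda>x. 2 * (norm (u (x + v)))\<^sup>2 + 2 * (norm (u x))\<^sup>2)"
      using wi(2) integrable_lborel_shift[OF wi(2), of v] by auto
    have "indicator P x * (norm (u (x + v) - u x))\<^sup>2 \<le> 2 * (norm (u (x + v)))\<^sup>2 + 2 * (norm (u x))\<^sup>2" for x
      using sq[of "u (x + v)" "u x"] by (auto split: split_indicator)
    then show "AE x in lborel. norm (indicator P x * (norm (u (x + v) - u x))\<^sup>2) \<le> norm (2 * (norm (u (x + v)))\<^sup>2 + 2 * (norm (u x))\<^sup>2)"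
      by simp
  qed measurable
  have E: "integrable lborel (\<lambda>x. indicator S x * energy g x)"
    by (rule integrable_indicator_mult[OF wi(1) Sb])
  have E0: "0 \<le> (LINT x|lborel. indicator S x * energy g x)"
    by (intro Bochner_Integration.integral_nonneg) auto
  have "ennreal (LINT x|lborel. indicator P x * (norm (u (x + v) - u x))\<^sup>2)
     = (\<integral>\<^sup>+x. ennreal (indicator P x * (norm (u (x + v) - u x))\<^sup>2) \<partial>lborel)"
    by (intro nn_integral_eq_integral[symmetric] int) auto
  also have "\<dots> = (\<integral>\<^sup>+x. indicator P x * ennreal ((norm (u (x + v) - u x))\<^sup>2) \<partial>lborel)"
    by (intro nn_integral_cong) (auto split: split_indicator)
  also have "\<dots> \<le> ennreal ((norm v)\<^sup>2) * (\<integral>\<^sup>+x. indicator S x * ennreal (energy g x) \<partial>lborel)"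
    by (rule translation_estimate[OF wg S P Sb]) (use seg in auto)
  also have "(\<integral>\<^sup>+x. indicator S x * ennreal (energy g x) \<partial>lborel) = (\<integral>\<^sup>+x. ennreal (indicator S x * energy g x) \<partial>lborel)"
    by (intro nn_integral_cong) (auto split: split_indicator)
  also have "\<dots> = ennreal (LINT x|lborel. indicator S x * energy g x)"
    by (intro nn_integral_eq_integral E AE_I2) simp
  finally show "(LINT x|lborel. indicator P x * (norm (u (x + v) - u x))\<^sup>2)
     \<le> (norm v)\<^sup>2 * (LINT x|lborel. indicator S x * energy g x)"
    using E0 by (simp add: ennreal_mult[symmetric] ennreal_le_iff)
qed

text \<open>
  The quantitative substitute for compactness of the embedding of \<open>H\<^sup>1(S)\<close> into \<open>L\<^sub>2(K)\<close>. The set \<open>K\<close> may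
  differ from the open set \<open>S\<close> on which the weak gradient lives.
\<close>
definition coercive_on :: "'a::euclidean_space set \<Rightarrow> 'a set \<Rightarrow> bool" where
  "coercive_on K S \<longleftrightarrow> (\<forall>\<delta>>0. \<exists>F C. finite F \<and> F \<subseteq> sets borel \<and> 0 \<le> C \<and>
     (\<forall>u g. weak_gradient S u g \<longrightarrow>
        (LINT x|lborel. indicator K x * (norm (u x))\<^sup>2) \<le> \<delta> * (LINT x|lborel. indicator S x * energy g x)
          + C * (\<Sum>Q\<in>F. (norm (LINT x|lborel. of_real (indicator Q x) * u x))\<^sup>2)))"

lemma coercive_onE:
  assumes "coercive_on K S" "\<delta> > 0"
  obtains F C where "finite F" "F \<subseteq> sets borel" "0 \<le> C"
    "\<And>u g. weak_gradient S u g \<Longrightarrow>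
        (LINT x|lborel. indicator K x * (norm (u x))\<^sup>2) \<le> \<delta> * (LINT x|lborel. indicator S x * energy g x)
          + C * (\<Sum>Q\<in>F. (norm (LINT x|lborel. of_real (indicator Q x) * u x))\<^sup>2)"
proof -
  from assms have "\<exists>F C. finite F \<and> F \<subseteq> sets borel \<and> 0 \<le> C \<and>
     (\<forall>u g. weak_gradient S u g \<longrightarrow>
        (LINT x|lborel. indicator K x * (norm (u x))\<^sup>2) \<le> \<delta> * (LINT x|lborel. indicator S x * energy g x)
          + C * (\<Sum>Q\<in>F. (norm (LINT x|lborel. of_real (indicator Q x) * u x))\<^sup>2))"
    unfolding coercive_on_def by (elim allE[of _ \<delta>]) (rule mp)
  then show ?thesis
  proof (elim exE conjE)
    fix F C
    assume *: "finite F" "F \<subseteq> sets borel" "0 \<le> C" "\<forall>u g. weak_gradient S u g \<longrightarrow>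
        (LINT x|lborel. indicator K x * (norm (u x))\<^sup>2) \<le> \<delta> * (LINT x|lborel. indicator S x * energy g x)
          + C * (\<Sum>Q\<in>F. (norm (LINT x|lborel. of_real (indicator Q x) * u x))\<^sup>2)"
    show thesis by (rule that[OF *(1-3)]) (rule *(4)[rule_format])
  qed
qed

text \<open>
  A grid of half-open cubes of side \<open>s\<close>, of which finitely many meet \<open>K\<close>; for small \<open>s\<close> all of these lie
  in \<open>S\<close>. The ratio of the volume of the differences to that of a cube does not depend on \<open>s\<close>, so the
  constant in the Poincare inequality is of order \<open>s\<^sup>2\<close>. The cubes are disjoint, so their energies add
  up to at most that of \<open>S\<close>.
\<close>
lemma coercive_on_compact:
  fixes K S :: "'a::euclidean_space set"
  assumes K: "compact K" and S: "open S" and KS: "K \<subseteq> S"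
  shows "coercive_on K S"
  unfolding coercive_on_def
proof (intro allI impI)
  fix \<delta> :: real assume \<delta>: "\<delta> > 0"
  define d where "d = real DIM('a)"
  have d: "d \<ge> 1" using DIM_positive[where 'a = 'a] by (simp add: d_def Suc_leI)
  define c where "c = 2 ^ DIM('a) * d\<^sup>2"
  have c: "c > 0" using d by (simp add: c_def)
  obtain e where e: "e > 0" "(\<Union>x\<in>K. ball x e) \<subseteq> S"
    by (rule compact_subset_open_imp_ball_epsilon_subset[OF K S KS]) (rule that)
  \<comment> \<open>the side is small enough for cells that meet \<open>K\<close> to lie in \<open>S\<close>, and for \<open>c * s\<^sup>2 \<le> \<delta>\<close>, where \<open>c / 2\<close> is the constant in the Poincare inequality on a unit cube\<close>
  define s where "s = min (e / (2 * d)) (min 1 (\<delta> / c))"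
  have s: "s > 0" "s \<le> 1" "s \<le> \<delta> / c" "s \<le> e / (2 * d)"
    using e(1) d \<delta> c by (simp_all add: s_def)
  have ds: "d * s < e"
  proof -
    have "d * s \<le> d * (e / (2 * d))" using s(4) d by (intro mult_left_mono) auto
    then show ?thesis using d e(1) by simp
  qed
  have cs: "c * s\<^sup>2 \<le> \<delta>"
  proof -
    have "s\<^sup>2 \<le> s" using s by (simp add: power2_eq_square mult_left_le)
    then have "c * s\<^sup>2 \<le> c * (\<delta> / c)" using s(3) c by (intro mult_left_mono) auto
    then show ?thesis using c by simp
  qed
  define \<kappa> where "\<kappa> x b = (if b \<in> Basis then \<lfloor>(x \<bullet> b) / s\<rfloor> else 0)" for x b :: 'a
  define cell where "cell k = {x::'a. \<forall>b\<in>Basis. of_int (k b) * s \<le> x \<bullet> b \<and> x \<bullet> b < (of_int (k b) + 1) * s}" for k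
  have cell_iff: "x \<in> cell k \<longleftrightarrow> (\<forall>b\<in>Basis. k b = \<kappa> x b)" for x k
  proof -
    have "of_int (k b) * s \<le> x \<bullet> b \<and> x \<bullet> b < (of_int (k b) + 1) * s \<longleftrightarrow> \<lfloor>(x \<bullet> b) / s\<rfloor> = k b" for b
      using s(1) by (simp add: floor_eq_iff pos_le_divide_eq pos_divide_less_eq)
    then show ?thesis by (auto simp: cell_def \<kappa>_def)
  qed
  have own: "x \<in> cell (\<kappa> x)" for x by (simp add: cell_iff)
  define F where "F = cell ` \<kappa> ` K"
  obtain M where M: "\<And>x. x \<in> K \<Longrightarrow> norm x \<le> M"
    using compact_imp_bounded[OF K] by (auto simp: bounded_iff)
  have "finite (\<kappa> ` K)"
  proof (rule finite_subset)
    show "\<kappa> ` K \<subseteq> {f. \<forall>x. (x \<in> Basis \<longrightarrow> f x \<in> {\<lfloor>- M / s\<rfloor>..\<lfloor>M / s\<rfloor>}) \<and> (x \<notin> Basis \<longrightarrow> f x = 0)}"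
    proof clarify
      fix x b :: 'a assume x: "x \<in> K"
      have "\<lfloor>- M / s\<rfloor> \<le> \<lfloor>(x \<bullet> b) / s\<rfloor> \<and> \<lfloor>(x \<bullet> b) / s\<rfloor> \<le> \<lfloor>M / s\<rfloor>" if "b \<in> Basis"
      proof -
        have "\<bar>x \<bullet> b\<bar> \<le> M" using Basis_le_norm[OF that, of x] M[OF x] by linarith
        then show ?thesis using s(1) by (intro conjI floor_mono divide_right_mono) auto
      qed
      then show "(b \<in> Basis \<longrightarrow> \<kappa> x b \<in> {\<lfloor>- M / s\<rfloor>..\<lfloor>M / s\<rfloor>}) \<and> (b \<notin> Basis \<longrightarrow> \<kappa> x b = 0)"
        by (simp add: \<kappa>_def)
    qed
    show "finite {f :: 'a \<Rightarrow> int. \<forall>x. (x \<in> Basis \<longrightarrow> f x \<in> {\<lfloor>- M / s\<rfloor>..\<lfloor>M / s\<rfloor>}) \<and> (x \<notin> Basis \<longrightarrow> f x = 0)}"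
      by (rule finite_set_of_finite_funs) auto
  qed
  then have finF: "finite F" by (simp add: F_def)
  have disj: "Q = Q'" if QQ': "Q \<in> F" "Q' \<in> F" "x \<in> Q" "x \<in> Q'" for Q Q' x
  proof -
    obtain k k' where k: "Q = cell k" "Q' = cell k'" using QQ'(1,2) unfolding F_def by blast
    then have "\<forall>b\<in>Basis. k b = k' b" using QQ'(3,4) by (simp add: cell_iff)
    then show ?thesis using k by (simp add: cell_def)
  qed
  have coord_norm: "norm v \<le> d * s" if "\<And>b. b \<in> Basis \<Longrightarrow> \<bar>v \<bullet> b\<bar> \<le> s" for v :: 'a
  proof -
    have "norm v \<le> (\<Sum>b\<in>Basis. \<bar>v \<bullet> b\<bar>)" by (rule norm_le_l1)
    also have "\<dots> \<le> d * s" using sum_bounded_above[of Basis "\<lambda>b. \<bar>v \<bullet> b\<bar>" s] that by (simp add: d_def)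
    finally show ?thesis .
  qed
  have cell_diff: "\<bar>(y - x) \<bullet> b\<bar> < s" if "x \<in> cell k" "y \<in> cell k" "b \<in> Basis" for x y b k
  proof -
    have "of_int (k b) * s \<le> x \<bullet> b" "x \<bullet> b < (of_int (k b) + 1) * s"
      "of_int (k b) * s \<le> y \<bullet> b" "y \<bullet> b < (of_int (k b) + 1) * s" using that by (auto simp: cell_def)
    then show ?thesis by (simp add: inner_diff_left distrib_right abs_less_iff)
  qed
  define W where "W = box (- s *\<^sub>R One) (s *\<^sub>R One :: 'a)"
  have Wm: "measure lborel W = (2 * s) ^ DIM('a)"
  proof -
    have "measure lborel W = (\<Prod>b\<in>Basis. (s *\<^sub>R One - (- s *\<^sub>R One :: 'a)) \<bullet> b)"
      unfolding W_def by (rule measure_lborel_box) (use s in auto)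
    also have "\<dots> = (\<Prod>b\<in>(Basis::'a set). 2 * s)" by (rule prod.cong) (auto simp: inner_diff_left inner_add_left)
    finally show ?thesis by simp
  qed
  have cell_borel: "cell k \<in> sets borel" for k
  proof -
    have "cell k = (\<Inter>b\<in>Basis. {x. of_int (k b) * s \<le> x \<bullet> b} \<inter> {x. x \<bullet> b < (of_int (k b) + 1) * s})"
      by (auto simp: cell_def)
    moreover have "{x :: 'a. of_int (k b) * s \<le> x \<bullet> b} \<in> sets borel" "{x :: 'a. x \<bullet> b < (of_int (k b) + 1) * s} \<in> sets borel" for b
      by measurable
    ultimately show ?thesis by (auto intro!: sets.finite_INT)
  qed
  have cell_measure: "emeasure lborel (cell k) < \<infinity>" "s ^ DIM('a) \<le> measure lborel (cell k)" for k
  proof -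
    define a where "a = (\<Sum>b\<in>Basis. (of_int (k b) * s) *\<^sub>R b :: 'a)"
    have ab: "a \<bullet> b = of_int (k b) * s" if "b \<in> Basis" for b using that by (simp add: a_def)
    have sub: "box a (a + s *\<^sub>R One) \<subseteq> cell k" "cell k \<subseteq> cbox a (a + s *\<^sub>R One)"
      by (fastforce simp: cell_def mem_box ab inner_add_left algebra_simps)+
    show fin: "emeasure lborel (cell k) < \<infinity>"
      using emeasure_mono[OF sub(2), of lborel] emeasure_lborel_cbox_finite[of a "a + s *\<^sub>R One"]
      by (simp add: le_less_trans)
    have "measure lborel (box a (a + s *\<^sub>R One)) = (\<Prod>b\<in>Basis. (a + s *\<^sub>R One - a) \<bullet> b)"
      by (rule measure_lborel_box) (use s in \<open>auto simp: inner_add_left\<close>)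
    also have "\<dots> = s ^ DIM('a)" by simp
    finally have "s ^ DIM('a) = measure lborel (box a (a + s *\<^sub>R One))" by simp
    also have "\<dots> \<le> measure lborel (cell k)"
      by (rule measure_mono_fmeasurable[OF sub(1)]) (use fin cell_borel in \<open>auto simp: fmeasurable_def\<close>)
    finally show "s ^ DIM('a) \<le> measure lborel (cell k)" .
  qed
  have cell_seg: "x + t *\<^sub>R v \<in> cell k" if xv: "x \<in> cell k" "x + v \<in> cell k" and t: "0 \<le> t" "t \<le> 1" for x v t k
    unfolding cell_def
  proof (intro CollectI ballI)
    fix b :: 'a assume b: "b \<in> Basis"
    have eq: "(x + t *\<^sub>R v) \<bullet> b = (1 - t) * (x \<bullet> b) + t * ((x + v) \<bullet> b)"
      by (simp add: inner_add_left algebra_simps)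
    have "of_int (k b) * s \<le> x \<bullet> b" "x \<bullet> b < (of_int (k b) + 1) * s"
      "of_int (k b) * s \<le> (x + v) \<bullet> b" "(x + v) \<bullet> b < (of_int (k b) + 1) * s"
      using xv b by (auto simp: cell_def)
    note kb = this
    have "(1 - t) * (x \<bullet> b) + t * ((x + v) \<bullet> b) < (of_int (k b) + 1) * s"
      using kb t by (intro convex_bound_lt) auto
    moreover have "(1 - t) * (of_int (k b) * s) + t * (of_int (k b) * s) \<le> (1 - t) * (x \<bullet> b) + t * ((x + v) \<bullet> b)"
      using kb t by (intro add_mono mult_left_mono) auto
    moreover have "(1 - t) * (of_int (k b) * s) + t * (of_int (k b) * s) = of_int (k b) * s"
      by (simp add: algebra_simps)
    ultimately show "of_int (k b) * s \<le> (x + t *\<^sub>R v) \<bullet> b \<and> (x + t *\<^sub>R v) \<bullet> b < (of_int (k b) + 1) * s"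
      unfolding eq by linarith
  qed
  have QS: "Q \<subseteq> S" if Q: "Q \<in> F" for Q
  proof
    fix y assume y: "y \<in> Q"
    obtain x where x: "x \<in> K" "Q = cell (\<kappa> x)" using Q by (auto simp: F_def)
    have "norm (y - x) \<le> d * s"
      using cell_diff[OF own, of y x] y x by (intro coord_norm) (auto intro: less_imp_le)
    then have "y \<in> ball x e" using ds by (simp add: dist_norm norm_minus_commute)
    then show "y \<in> S" using e(2) x by blast
  qed
  show "\<exists>F C. finite F \<and> F \<subseteq> sets borel \<and> 0 \<le> C \<and>
     (\<forall>u g. weak_gradient S u g \<longrightarrow>
        (LINT x|lborel. indicator K x * (norm (u x))\<^sup>2) \<le> \<delta> * (LINT x|lborel. indicator S x * energy g x)
          + C * (\<Sum>Q\<in>F. (norm (LINT x|lborel. of_real (indicator Q x) * u x))\<^sup>2))"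
  proof (intro exI[of _ F] exI[of _ "1 / s ^ DIM('a)"] conjI allI impI)
    show "finite F" by (rule finF)
    show Fb: "F \<subseteq> sets borel" using cell_borel by (auto simp: F_def)
    show "0 \<le> 1 / s ^ DIM('a)" using s by simp
    fix u :: "'a \<Rightarrow> complex" and g assume wg: "weak_gradient S u g"
    note wi = weak_gradient_integrable[OF wg]
    define I where "I Q = (LINT x|lborel. indicator Q x * (norm (u x))\<^sup>2)" for Q
    define E where "E Q = (LINT x|lborel. indicator Q x * energy g x)" for Q
    define m where "m Q = (norm (LINT x|lborel. of_real (indicator Q x) * u x))\<^sup>2" for Q
    have iI: "integrable lborel (\<lambda>x. indicator Q x * (norm (u x))\<^sup>2)"
      and iE: "integrable lborel (\<lambda>x. indicator Q x * energy g x)" if "Q \<in> sets borel" for Q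
      using wi that by (auto intro: integrable_indicator_mult)
    have each: "I Q \<le> \<delta> * E Q + 1 / s ^ DIM('a) * m Q" if Q: "Q \<in> F" for Q
    proof -
      obtain k where k: "Q = cell k" using Q by (auto simp: F_def)
      have I0: "0 \<le> I Q" unfolding I_def by (intro Bochner_Integration.integral_nonneg) auto
      have E0: "0 \<le> E Q" unfolding E_def by (intro Bochner_Integration.integral_nonneg) auto
      have "s ^ DIM('a) * I Q \<le> measure lborel Q * I Q"
        using cell_measure(2) I0 k by (intro mult_right_mono) auto
      also have "\<dots> \<le> measure lborel W * (d * s)\<^sup>2 / 2 * E Q + m Q"
        unfolding I_def E_def m_def
      proof (rule poincare_on_set[OF wg S])
        show "Q \<in> sets borel" "emeasure lborel Q < \<infinity>" using cell_borel cell_measure(1) k by auto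
        show "W \<in> sets borel" by (simp add: W_def)
        show "emeasure lborel W < \<infinity>" unfolding W_def by (rule emeasure_lborel_box_finite)
        show "v \<in> W \<and> norm v \<le> d * s" if "x \<in> Q" "x + v \<in> Q" for x v
        proof -
          have *: "\<bar>v \<bullet> b\<bar> < s" if "b \<in> Basis" for b
            using cell_diff[of x k "x + v" b] \<open>x \<in> Q\<close> \<open>x + v \<in> Q\<close> k that by simp
          then show ?thesis using coord_norm[of v]
            by (auto simp: W_def mem_box abs_less_iff less_imp_le minus_less_iff)
        qed
        show "x + t *\<^sub>R v \<in> Q" if "x \<in> Q" "x + v \<in> Q" "0 \<le> t" "t \<le> 1" for x v t
          using cell_seg that k by simp
      qed (rule QS[OF Q])
      also have "measure lborel W * (d * s)\<^sup>2 / 2 = s ^ DIM('a) * (c * s\<^sup>2 / 2)"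
        by (simp add: Wm c_def power_mult_distrib)
      finally have "s ^ DIM('a) * I Q \<le> s ^ DIM('a) * (c * s\<^sup>2 / 2 * E Q + 1 / s ^ DIM('a) * m Q)"
        using s by (simp add: algebra_simps)
      then have "I Q \<le> c * s\<^sup>2 / 2 * E Q + 1 / s ^ DIM('a) * m Q"
        using s(1) by (simp only: mult_le_cancel_left_pos zero_less_power)
      moreover have "c * s\<^sup>2 / 2 * E Q \<le> \<delta> * E Q"
        using cs E0 \<delta> by (intro mult_right_mono) auto
      ultimately show ?thesis by linarith
    qed
    have "(LINT x|lborel. indicator K x * (norm (u x))\<^sup>2) \<le> (LINT x|lborel. (\<Sum>Q\<in>F. indicator Q x * (norm (u x))\<^sup>2))"
    proof (rule Bochner_Integration.integral_mono)
      show "integrable lborel (\<lambda>x. indicator K x * (norm (u x))\<^sup>2)"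
        using compact_imp_closed[OF K] by (intro iI) auto
      show "integrable lborel (\<lambda>x. (\<Sum>Q\<in>F. indicator Q x * (norm (u x))\<^sup>2))"
        by (intro Bochner_Integration.integrable_sum iI) (use Fb in auto)
      show "indicator K x * (norm (u x))\<^sup>2 \<le> (\<Sum>Q\<in>F. indicator Q x * (norm (u x))\<^sup>2)" for x
      proof (cases "x \<in> K")
        case True
        then have "cell (\<kappa> x) \<in> F" by (auto simp: F_def)
        then have "indicator (cell (\<kappa> x)) x * (norm (u x))\<^sup>2 \<le> (\<Sum>Q\<in>F. indicator Q x * (norm (u x))\<^sup>2)"
          using finF by (intro member_le_sum) auto
        then show ?thesis using True own by simp
      qed (auto intro: sum_nonneg)
    qed
    also have "\<dots> = (\<Sum>Q\<in>F. I Q)"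
      unfolding I_def using iI Fb by (intro Bochner_Integration.integral_sum) auto
    also have "\<dots> \<le> (\<Sum>Q\<in>F. \<delta> * E Q + 1 / s ^ DIM('a) * m Q)"
      by (rule sum_mono) (rule each)
    also have "\<dots> = \<delta> * (\<Sum>Q\<in>F. E Q) + 1 / s ^ DIM('a) * (\<Sum>Q\<in>F. m Q)"
      by (simp add: sum.distrib sum_distrib_left)
    also have "(\<Sum>Q\<in>F. E Q) \<le> E S"
    proof -
      have "(\<Sum>Q\<in>F. E Q) = (LINT x|lborel. (\<Sum>Q\<in>F. indicator Q x * energy g x))"
        unfolding E_def using iE Fb by (intro Bochner_Integration.integral_sum[symmetric]) auto
      also have "\<dots> \<le> E S" unfolding E_def
      proof (rule Bochner_Integration.integral_mono)
        show "integrable lborel (\<lambda>x. (\<Sum>Q\<in>F. indicator Q x * energy g x))" by (intro Bochner_Integration.integrable_sum iE) (use Fb in auto)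
        show "integrable lborel (\<lambda>x. indicator S x * energy g x)" using S by (intro iE) auto
        show "(\<Sum>Q\<in>F. indicator Q x * energy g x) \<le> indicator S x * energy g x" for x
        proof (cases "\<exists>Q\<in>F. x \<in> Q")
          case True
          then obtain Q0 where Q0: "Q0 \<in> F" "x \<in> Q0" by blast
          have "(\<Sum>Q\<in>F. indicator Q x * energy g x) = (\<Sum>Q\<in>F. if Q = Q0 then energy g x else 0)"
          proof (rule sum.cong[OF refl])
            fix Q assume Q: "Q \<in> F"
            show "indicator Q x * energy g x = (if Q = Q0 then energy g x else 0)"
            proof (cases "x \<in> Q")
              case True
              then show ?thesis using disj[OF Q Q0(1) True Q0(2)] by simp
            next
              case False
              then have "Q \<noteq> Q0" using Q0(2) by blast
              then show ?thesis using False by simp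
            qed
          qed
          also have "\<dots> = energy g x" using Q0(1) finF by simp
          also have "\<dots> = indicator S x * energy g x" using QS[OF Q0(1)] Q0(2) by (simp add: subsetD)
          finally show ?thesis by simp
        next
          case False
          then have "(\<Sum>Q\<in>F. indicator Q x * energy g x) = 0" by (intro sum.neutral) (auto split: split_indicator)
          then show ?thesis by simp
        qed
      qed
      finally show ?thesis .
    qed
    finally show "(LINT x|lborel. indicator K x * (norm (u x))\<^sup>2) \<le> \<delta> * (LINT x|lborel. indicator S x * energy g x)
          + 1 / s ^ DIM('a) * (\<Sum>Q\<in>F. (norm (LINT x|lborel. of_real (indicator Q x) * u x))\<^sup>2)"
      using \<delta> by (simp add: E_def m_def)
  qed
qed

lemma coercive_on_cover:
  fixes K S :: "'a::euclidean_space set"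
  assumes I: "finite I" and K: "K \<in> sets borel" and S: "S \<in> sets borel"
    and T: "\<And>i. i \<in> I \<Longrightarrow> T i \<in> sets borel" "\<And>i. i \<in> I \<Longrightarrow> T i \<subseteq> S" "\<And>i. i \<in> I \<Longrightarrow> coercive_on (T i) (T i)"
    and cover: "AE x in lborel. x \<in> K \<longrightarrow> (\<exists>i\<in>I. x \<in> T i)"
  shows "coercive_on K S"
  unfolding coercive_on_def
proof (intro allI impI)
  fix \<delta> :: real assume \<delta>: "\<delta> > 0"
  define \<delta>' where "\<delta>' = \<delta> / (real (card I) + 1)"
  have \<delta>': "\<delta>' > 0" "real (card I) * \<delta>' \<le> \<delta>" using \<delta> by (auto simp: \<delta>'_def divide_le_eq mult.commute)
  have "\<forall>i\<in>I. \<exists>FC. finite (fst FC) \<and> fst FC \<subseteq> sets borel \<and> 0 \<le> snd FC \<and> (\<forall>u g. weak_gradient (T i) u g \<longrightarrow>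
        (LINT x|lborel. indicator (T i) x * (norm (u x))\<^sup>2) \<le> \<delta>' * (LINT x|lborel. indicator (T i) x * energy g x)
          + snd FC * (\<Sum>Q\<in>fst FC. (norm (LINT x|lborel. of_real (indicator Q x) * u x))\<^sup>2))"
  proof
    fix i assume "i \<in> I"
    from coercive_onE[OF T(3)[OF this] \<delta>'(1)] obtain F C where *: "finite F" "F \<subseteq> sets borel" "0 \<le> C"
     "\<And>u g. weak_gradient (T i) u g \<Longrightarrow>
        (LINT x|lborel. indicator (T i) x * (norm (u x))\<^sup>2) \<le> \<delta>' * (LINT x|lborel. indicator (T i) x * energy g x)
          + C * (\<Sum>Q\<in>F. (norm (LINT x|lborel. of_real (indicator Q x) * u x))\<^sup>2)"
      by this (rule that)
    show "\<exists>FC. finite (fst FC) \<and> fst FC \<subseteq> sets borel \<and> 0 \<le> snd FC \<and> (\<forall>u g. weak_gradient (T i) u g \<longrightarrow>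
        (LINT x|lborel. indicator (T i) x * (norm (u x))\<^sup>2) \<le> \<delta>' * (LINT x|lborel. indicator (T i) x * energy g x)
          + snd FC * (\<Sum>Q\<in>fst FC. (norm (LINT x|lborel. of_real (indicator Q x) * u x))\<^sup>2))"
      by (intro exI[of _ "(F, C)"] conjI allI impI; simp) (use * in simp_all)
  qed
  from bchoice[OF this] obtain FC where FC: "\<forall>i\<in>I. finite (fst (FC i)) \<and> fst (FC i) \<subseteq> sets borel \<and> 0 \<le> snd (FC i) \<and> (\<forall>u g. weak_gradient (T i) u g \<longrightarrow>
        (LINT x|lborel. indicator (T i) x * (norm (u x))\<^sup>2) \<le> \<delta>' * (LINT x|lborel. indicator (T i) x * energy g x)
          + snd (FC i) * (\<Sum>Q\<in>fst (FC i). (norm (LINT x|lborel. of_real (indicator Q x) * u x))\<^sup>2))"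
    by (elim exE)
  define F where "F = (\<Union>i\<in>I. fst (FC i))"
  define C where "C = (\<Sum>i\<in>I. snd (FC i))"
  have F: "finite F" "F \<subseteq> sets borel" "0 \<le> C" using FC I by (auto simp: F_def C_def intro: sum_nonneg)
  show "\<exists>F C. finite F \<and> F \<subseteq> sets borel \<and> 0 \<le> C \<and>
     (\<forall>u g. weak_gradient S u g \<longrightarrow>
        (LINT x|lborel. indicator K x * (norm (u x))\<^sup>2) \<le> \<delta> * (LINT x|lborel. indicator S x * energy g x)
          + C * (\<Sum>Q\<in>F. (norm (LINT x|lborel. of_real (indicator Q x) * u x))\<^sup>2))"
  proof (intro exI[of _ F] exI[of _ C] conjI allI impI F)
    fix u :: "'a \<Rightarrow> complex" and g assume wg: "weak_gradient S u g"
    note wi = weak_gradient_integrable[OF wg]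
    define m where "m Q = (norm (LINT x|lborel. of_real (indicator Q x) * u x))\<^sup>2" for Q
    define M where "M = (\<Sum>Q\<in>F. m Q)"
    define E where "E = (LINT x|lborel. indicator S x * energy g x)"
    have E0: "0 \<le> E" unfolding E_def by (intro Bochner_Integration.integral_nonneg) auto
    have iI: "integrable lborel (\<lambda>x. indicator Q x * (norm (u x))\<^sup>2)"
      and iE: "integrable lborel (\<lambda>x. indicator Q x * energy g x)" if "Q \<in> sets borel" for Q
      using wi that by (auto intro: integrable_indicator_mult)
    have "(LINT x|lborel. indicator K x * (norm (u x))\<^sup>2) \<le> (LINT x|lborel. (\<Sum>i\<in>I. indicator (T i) x * (norm (u x))\<^sup>2))"
    proof (rule integral_mono_AE)
      show "integrable lborel (\<lambda>x. indicator K x * (norm (u x))\<^sup>2)" by (rule iI[OF K])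
      show "integrable lborel (\<lambda>x. (\<Sum>i\<in>I. indicator (T i) x * (norm (u x))\<^sup>2))" by (intro Bochner_Integration.integrable_sum iI T(1))
      show "AE x in lborel. indicator K x * (norm (u x))\<^sup>2 \<le> (\<Sum>i\<in>I. indicator (T i) x * (norm (u x))\<^sup>2)"
        using cover
      proof eventually_elim
        case (elim x)
        show ?case
        proof (cases "x \<in> K")
          case True
          then obtain i where i: "i \<in> I" "x \<in> T i" using elim by blast
          have "indicator (T i) x * (norm (u x))\<^sup>2 \<le> (\<Sum>i\<in>I. indicator (T i) x * (norm (u x))\<^sup>2)"
            using I i by (intro member_le_sum) auto
          then show ?thesis using True i by simp
        qed (auto intro: sum_nonneg)
      qed
    qed
    also have "\<dots> = (\<Sum>i\<in>I. LINT x|lborel. indicator (T i) x * (norm (u x))\<^sup>2)"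
      using iI T(1) by (intro Bochner_Integration.integral_sum) auto
    also have "\<dots> \<le> (\<Sum>i\<in>I. \<delta>' * E + snd (FC i) * M)"
    proof (rule sum_mono)
      fix i assume i: "i \<in> I"
      have "(LINT x|lborel. indicator (T i) x * (norm (u x))\<^sup>2) \<le> \<delta>' * (LINT x|lborel. indicator (T i) x * energy g x)
          + snd (FC i) * (\<Sum>Q\<in>fst (FC i). m Q)"
        using FC i weak_gradient_mono[OF wg T(2)[OF i]] unfolding m_def by blast
      also have "(LINT x|lborel. indicator (T i) x * energy g x) \<le> E"
        unfolding E_def using T(1,2)[OF i] S
        by (intro Bochner_Integration.integral_mono iE) (auto split: split_indicator)
      also have "(\<Sum>Q\<in>fst (FC i). m Q) \<le> M"
        unfolding M_def using F(1) i by (intro sum_mono2) (auto simp: F_def m_def)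
      finally show "(LINT x|lborel. indicator (T i) x * (norm (u x))\<^sup>2) \<le> \<delta>' * E + snd (FC i) * M"
        using \<delta>' FC i by (simp add: mult_left_mono)
    qed
    also have "\<dots> = real (card I) * \<delta>' * E + C * M"
      by (simp add: sum.distrib C_def sum_distrib_right)
    also have "\<dots> \<le> \<delta> * E + C * M" using \<delta>' E0 by (intro add_right_mono mult_right_mono) auto
    finally show "(LINT x|lborel. indicator K x * (norm (u x))\<^sup>2) \<le> \<delta> * (LINT x|lborel. indicator S x * energy g x)
          + C * (\<Sum>Q\<in>F. (norm (LINT x|lborel. of_real (indicator Q x) * u x))\<^sup>2)"
      by (simp add: E_def M_def m_def)
  qed
qed

text \<open>
  Near each point of the closure, all short translations in one direction lead into the set, even from
  boundary points. The vector \<open>e\<close> is not normalised and may be 0 at interior points, which makes the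
  notion stable under products.
\<close>
definition inward :: "'a::euclidean_space set \<Rightarrow> bool" where
  "inward S \<longleftrightarrow> (\<forall>p\<in>closure S. \<exists>r e \<tau>. r > 0 \<and> \<tau> > 0 \<and> (\<forall>x\<in>closure S \<inter> ball p r. \<forall>t. 0 < t \<and> t \<le> \<tau> \<longrightarrow> x + t *\<^sub>R e \<in> S))"

text \<open>
  Cover the closure by finitely many balls with inward vectors. A translation by \<open>t e\<close> moves the part of
  \<open>S\<close> in each ball into a compact subset of \<open>S\<close>, at the cost of \<open>2 * |t e|\<^sup>2\<close> times the energy. Choose \<open>t\<close>
  first, so that the total cost is at most \<open>\<delta> / 2\<close>, and then apply the estimate on the resulting
  compact set.
\<close>
theorem coercive_on_inward:
  fixes S :: "'a::euclidean_space set"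
  assumes S: "open S" "bounded S" and inw: "inward S"
  shows "coercive_on S S"
  unfolding coercive_on_def
proof (intro allI impI)
  fix \<delta> :: real assume \<delta>: "\<delta> > 0"
  have "\<forall>p\<in>closure S. \<exists>z. fst z > 0 \<and> snd (snd z) > (0::real) \<and>
    (\<forall>x\<in>closure S \<inter> ball p (fst z). \<forall>t. 0 < t \<and> t \<le> snd (snd z) \<longrightarrow> x + t *\<^sub>R fst (snd z) \<in> S)"
  proof
    fix p assume "p \<in> closure S"
    then obtain r e \<tau> where "r > 0" "\<tau> > 0" "\<forall>x\<in>closure S \<inter> ball p r. \<forall>t. 0 < t \<and> t \<le> \<tau> \<longrightarrow> x + t *\<^sub>R e \<in> S"
      using inw unfolding inward_def by blast
    then show "\<exists>z. fst z > 0 \<and> snd (snd z) > (0::real) \<and>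
    (\<forall>x\<in>closure S \<inter> ball p (fst z). \<forall>t. 0 < t \<and> t \<le> snd (snd z) \<longrightarrow> x + t *\<^sub>R fst (snd z) \<in> S)"
      by (intro exI[of _ "(r, e, \<tau>)"]) simp
  qed
  from bchoice[OF this] obtain z where z: "\<forall>p\<in>closure S. fst (z p) > 0 \<and> snd (snd (z p)) > (0::real) \<and>
    (\<forall>x\<in>closure S \<inter> ball p (fst (z p)). \<forall>t. 0 < t \<and> t \<le> snd (snd (z p)) \<longrightarrow> x + t *\<^sub>R fst (snd (z p)) \<in> S)"
    by (elim exE)
  define r where "r p = fst (z p)" for p
  define e where "e p = fst (snd (z p))" for p
  define \<tau> where "\<tau> p = snd (snd (z p))" for p
  have rp: "r p > 0" "\<tau> p > 0" if "p \<in> closure S" for p using z that by (auto simp: r_def \<tau>_def)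
  have inS: "x + t *\<^sub>R e p \<in> S" if "p \<in> closure S" "x \<in> closure S" "x \<in> ball p (r p)" "0 < t" "t \<le> \<tau> p" for p x t
    using z that by (auto simp: r_def e_def \<tau>_def)
  have cS: "compact (closure S)" using S(2) by simp
  obtain C where C: "C \<subseteq> closure S" "finite C" "closure S \<subseteq> (\<Union>p\<in>C. ball p (r p / 2))"
  proof (rule compactE_image[OF cS])
    show "open (ball p (r p / 2))" if "p \<in> closure S" for p by simp
    show "closure S \<subseteq> (\<Union>p\<in>closure S. ball p (r p / 2))"
      using rp by fastforce
  qed (rule that)
  define N where "N = real (card C) + 1"
  have N: "N > 0" "real (card C) \<le> N" by (auto simp: N_def)
  define \<eta> where "\<eta> = \<delta> / (2 * N)"
  have \<eta>: "\<eta> > 0" using \<delta> N by (simp add: \<eta>_def)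
  have "\<forall>\<^sub>F t in at_right (0::real). \<forall>p\<in>C. t \<le> \<tau> p \<and> 2 * (norm (t *\<^sub>R e p))\<^sup>2 < \<eta>"
  proof (rule eventually_ball_finite[OF C(2)], intro ballI eventually_conj)
    fix p assume p: "p \<in> C"
    show "\<forall>\<^sub>F t in at_right (0::real). t \<le> \<tau> p"
    proof -
      have "0 < \<tau> p" using rp(2) C(1) p by blast
      from eventually_at_right_real[OF this] show ?thesis by (rule eventually_mono) simp
    qed
    have "((\<lambda>t. 2 * (norm (t *\<^sub>R e p))\<^sup>2) \<longlongrightarrow> 2 * (norm (0 *\<^sub>R e p))\<^sup>2) (at_right 0)"
      by (intro tendsto_intros)
    then show "\<forall>\<^sub>F t in at_right (0::real). 2 * (norm (t *\<^sub>R e p))\<^sup>2 < \<eta>"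
      using \<eta> by (intro order_tendstoD(2)[where y = "2 * (norm (0 *\<^sub>R e p))\<^sup>2"]) auto
  qed
  then have "\<forall>\<^sub>F t in at_right (0::real). 0 < t \<and> (\<forall>p\<in>C. t \<le> \<tau> p \<and> 2 * (norm (t *\<^sub>R e p))\<^sup>2 < \<eta>)"
    using eventually_at_right_less[of "0::real"] by eventually_elim auto
  then have "\<exists>t. 0 < t \<and> (\<forall>p\<in>C. t \<le> \<tau> p \<and> 2 * (norm (t *\<^sub>R e p))\<^sup>2 < \<eta>)"
    by (rule eventually_happens'[OF trivial_limit_at_right_real])
  then obtain t where t: "0 < t" "\<And>p. p \<in> C \<Longrightarrow> t \<le> \<tau> p" "\<And>p. p \<in> C \<Longrightarrow> 2 * (norm (t *\<^sub>R e p))\<^sup>2 < \<eta>"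
    by blast
  define v where "v p = t *\<^sub>R e p" for p
  define K where "K = (\<Union>p\<in>C. (\<lambda>x. v p + x) ` (closure S \<inter> cball p (r p / 2)))"
  have half: "x \<in> ball p (r p)" if "x \<in> cball p (r p / 2)" "p \<in> C" for x p
    using that rp[of p] C(1) by auto
  have K: "compact K" unfolding K_def
    by (intro compact_UN C(2) compact_translation compact_Int_closed cS) auto
  have KS: "K \<subseteq> S"
  proof
    fix y assume "y \<in> K"
    then obtain p x where px: "p \<in> C" "x \<in> closure S" "x \<in> cball p (r p / 2)" "y = v p + x"
      by (auto simp: K_def)
    then have "x + t *\<^sub>R e p \<in> S" using inS[of p x t] half t C(1) by blast
    then show "y \<in> S" using px by (simp add: v_def add.commute)
  qed
  have "\<delta> / (4 * N) > 0" using \<delta> N by simp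
  from coercive_onE[OF coercive_on_compact[OF K S(1) KS] this] obtain F C0 where F: "finite F" "F \<subseteq> sets borel" "0 \<le> C0"
     "\<And>u g. weak_gradient S u g \<Longrightarrow>
        (LINT x|lborel. indicator K x * (norm (u x))\<^sup>2) \<le> \<delta> / (4 * N) * (LINT x|lborel. indicator S x * energy g x)
          + C0 * (\<Sum>Q\<in>F. (norm (LINT x|lborel. of_real (indicator Q x) * u x))\<^sup>2)"
    by this (rule that)
  show "\<exists>F C. finite F \<and> F \<subseteq> sets borel \<and> 0 \<le> C \<and>
     (\<forall>u g. weak_gradient S u g \<longrightarrow>
        (LINT x|lborel. indicator S x * (norm (u x))\<^sup>2) \<le> \<delta> * (LINT x|lborel. indicator S x * energy g x)
          + C * (\<Sum>Q\<in>F. (norm (LINT x|lborel. of_real (indicator Q x) * u x))\<^sup>2))"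
  proof (intro exI[of _ F] exI[of _ "2 * N * C0"] conjI allI impI F(1,2))
    show "0 \<le> 2 * N * C0" using N F by simp
    fix u :: "'a \<Rightarrow> complex" and g assume wg: "weak_gradient S u g"
    note wm[measurable] = weak_gradient_measurable[OF wg]
    note wi = weak_gradient_integrable[OF wg]
    define M where "M = (\<Sum>Q\<in>F. (norm (LINT x|lborel. of_real (indicator Q x) * u x))\<^sup>2)"
    define E where "E = (LINT x|lborel. indicator S x * energy g x)"
    define IK where "IK = (LINT x|lborel. indicator K x * (norm (u x))\<^sup>2)"
    have E0: "0 \<le> E" unfolding E_def by (intro Bochner_Integration.integral_nonneg) auto
    have Kb[measurable]: "K \<in> sets borel" using compact_imp_closed[OF K] by auto
    have IK: "IK \<le> \<delta> / (4 * N) * E + C0 * M" using F(4)[OF wg] by (simp add: IK_def E_def M_def)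
    have IK0: "0 \<le> IK" unfolding IK_def by (intro Bochner_Integration.integral_nonneg) auto
    have iI: "integrable lborel (\<lambda>x. indicator Q x * (norm (u x))\<^sup>2)" if "Q \<in> sets borel" for Q
      using wi that by (auto intro: integrable_indicator_mult)
    define A where "A p = S \<inter> ball p (r p / 2)" for p
    have A[measurable]: "A p \<in> sets borel" for p using S by (auto simp: A_def)
    have layer: "(LINT x|lborel. indicator (A p) x * (norm (u x))\<^sup>2) \<le> 2 * IK + \<eta> * E" if p: "p \<in> C" for p
    proof -
      have seg: "x + s *\<^sub>R v p \<in> S" if x: "x \<in> A p" and s: "0 \<le> s" "s \<le> 1" for x s
      proof (cases "s = 0")
        case True
        then show ?thesis using x by (simp add: A_def)
      next
        case False
        have xp: "x \<in> closure S" "x \<in> ball p (r p)"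
          using x half[of x p] p closure_subset[of S] by (auto simp: A_def)
        have "s * t \<le> t" using t(1) s by (simp add: mult_left_le_one_le)
        then have "s * t \<le> \<tau> p" using t(2)[OF p] by linarith
        moreover have "0 < s * t" using t(1) s False by simp
        ultimately have "x + (s * t) *\<^sub>R e p \<in> S" using inS[OF _ xp] p C(1) by blast
        then show ?thesis by (simp add: v_def)
      qed
      note te = translation_estimate_real[OF wg S(1) A, of p "v p", OF seg]
      have iK: "integrable lborel (\<lambda>x. indicator K (x + v p) * (norm (u (x + v p)))\<^sup>2)"
        using integrable_lborel_shift[OF iI[OF Kb], of "v p"] .
      have "(LINT x|lborel. indicator (A p) x * (norm (u x))\<^sup>2)
        \<le> (LINT x|lborel. 2 * (indicator K (x + v p) * (norm (u (x + v p)))\<^sup>2) + 2 * (indicator (A p) x * (norm (u (x + v p) - u x))\<^sup>2))"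
      proof (rule Bochner_Integration.integral_mono)
        fix x
        show "indicator (A p) x * (norm (u x))\<^sup>2 \<le> 2 * (indicator K (x + v p) * (norm (u (x + v p)))\<^sup>2) + 2 * (indicator (A p) x * (norm (u (x + v p) - u x))\<^sup>2)"
        proof (cases "x \<in> A p")
          case True
          then have "x \<in> closure S \<inter> cball p (r p / 2)" using closure_subset[of S] by (auto simp: A_def)
          then have "v p + x \<in> K" unfolding K_def using p by blast
          then have "x + v p \<in> K" by (simp add: add.commute)
          have "norm (u x) \<le> norm (u (x + v p)) + norm (u (x + v p) - u x)"
            using norm_triangle_ineq4[of "u (x + v p)" "u (x + v p) - u x"] by simp
          then have "(norm (u x))\<^sup>2 \<le> (norm (u (x + v p)) + norm (u (x + v p) - u x))\<^sup>2"
            by (intro power_mono) auto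
          also have "\<dots> \<le> 2 * (norm (u (x + v p)))\<^sup>2 + 2 * (norm (u (x + v p) - u x))\<^sup>2"
            using sum_squares_bound[of "norm (u (x + v p))" "norm (u (x + v p) - u x)"] by (simp add: power2_sum)
          finally show ?thesis using True \<open>x + v p \<in> K\<close> by simp
        qed simp
      qed (use iI[OF A] iK te(1) in auto)
      also have "\<dots> = 2 * (LINT x|lborel. indicator K (x + v p) * (norm (u (x + v p)))\<^sup>2)
          + 2 * (LINT x|lborel. indicator (A p) x * (norm (u (x + v p) - u x))\<^sup>2)"
        using iK te(1) by simp
      also have "(LINT x|lborel. indicator K (x + v p) * (norm (u (x + v p)))\<^sup>2) = IK"
        unfolding IK_def by (intro integral_lborel_shift[of "\<lambda>x. indicator K x * (norm (u x))\<^sup>2"]) measurable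
      also have "2 * IK + 2 * (LINT x|lborel. indicator (A p) x * (norm (u (x + v p) - u x))\<^sup>2) \<le> 2 * IK + 2 * ((norm (v p))\<^sup>2 * E)"
        using te(2) unfolding E_def by linarith
      also have "2 * ((norm (v p))\<^sup>2 * E) \<le> \<eta> * E"
        using mult_right_mono[OF less_imp_le[OF t(3)[OF p]] E0] by (simp add: v_def)
      finally show ?thesis by simp
    qed
    have "(LINT x|lborel. indicator S x * (norm (u x))\<^sup>2) \<le> (LINT x|lborel. (\<Sum>p\<in>C. indicator (A p) x * (norm (u x))\<^sup>2))"
    proof (rule Bochner_Integration.integral_mono)
      show "integrable lborel (\<lambda>x. indicator S x * (norm (u x))\<^sup>2)" using S by (intro iI) auto
      show "integrable lborel (\<lambda>x. (\<Sum>p\<in>C. indicator (A p) x * (norm (u x))\<^sup>2))" by (intro Bochner_Integration.integrable_sum iI A)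
      show "indicator S x * (norm (u x))\<^sup>2 \<le> (\<Sum>p\<in>C. indicator (A p) x * (norm (u x))\<^sup>2)" for x
      proof (cases "x \<in> S")
        case True
        then obtain p where p: "p \<in> C" "x \<in> A p" using C(3) closure_subset[of S] by (auto simp: A_def)
        have "indicator (A p) x * (norm (u x))\<^sup>2 \<le> (\<Sum>p\<in>C. indicator (A p) x * (norm (u x))\<^sup>2)"
          using C(2) p by (intro member_le_sum) auto
        then show ?thesis using True p by simp
      qed (auto intro: sum_nonneg)
    qed
    also have "\<dots> = (\<Sum>p\<in>C. LINT x|lborel. indicator (A p) x * (norm (u x))\<^sup>2)"
      using iI[OF A] by (intro Bochner_Integration.integral_sum) auto
    also have "\<dots> \<le> (\<Sum>p\<in>C. 2 * IK + \<eta> * E)" by (rule sum_mono) (rule layer)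
    also have "\<dots> = real (card C) * (2 * IK + \<eta> * E)" by simp
    also have "\<dots> \<le> N * (2 * IK + \<eta> * E)"
      using N IK0 E0 \<eta> by (intro mult_right_mono) auto
    also have "\<dots> \<le> N * (2 * (\<delta> / (4 * N) * E + C0 * M) + \<eta> * E)"
      using less_imp_le[OF N(1)] by (intro mult_left_mono add_right_mono IK) simp_all
    also have "\<dots> = \<delta> * E + 2 * N * C0 * M"
      using N by (simp add: \<eta>_def field_simps)
    finally show "(LINT x|lborel. indicator S x * (norm (u x))\<^sup>2) \<le> \<delta> * (LINT x|lborel. indicator S x * energy g x)
          + 2 * N * C0 * (\<Sum>Q\<in>F. (norm (LINT x|lborel. of_real (indicator Q x) * u x))\<^sup>2)"
      by (simp add: E_def M_def)
  qed
qed

section \<open>Inward translations and completeness of square integrable functions\<close>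

text \<open>
  At a boundary point the direction in which the set is an epigraph is inward. Points of the closure lie
  on or above the graph, and moving up makes this strict.
\<close>
lemma lipschitz_boundary_inward:
  assumes S: "open S" and lip: "lipschitz_boundary S"
  shows "inward S"
  unfolding inward_def
proof
  fix p assume p: "p \<in> closure S"
  show "\<exists>r e \<tau>. r > 0 \<and> \<tau> > 0 \<and> (\<forall>x\<in>closure S \<inter> ball p r. \<forall>t. 0 < t \<and> t \<le> \<tau> \<longrightarrow> x + t *\<^sub>R e \<in> S)"
  proof (cases "p \<in> S")
    case True
    then obtain r where "r > 0" "ball p r \<subseteq> S" using S open_contains_ball by blast
    then show ?thesis by (intro exI[of _ r] exI[of _ 0]) auto
  next
    case False
    then have "p \<in> frontier S" using p S by (simp add: frontier_def interior_open)
    then obtain r e L \<phi> where r: "r > 0" and e: "norm e = 1" and L: "L-lipschitz_on {y. y \<bullet> e = 0} \<phi>"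
      and eq: "S \<inter> ball p r = {x \<in> ball p r. \<phi> (x - (x \<bullet> e) *\<^sub>R e) < x \<bullet> e}"
      using lip unfolding lipschitz_boundary_def by blast
    have ee: "e \<bullet> e = 1" using e by (simp add: dot_square_norm)
    have cont: "continuous_on UNIV (\<lambda>x. \<phi> (x - (x \<bullet> e) *\<^sub>R e))"
      by (rule continuous_on_compose2[OF lipschitz_on_continuous_on[OF L]])
        (auto intro!: continuous_intros simp: inner_diff_left ee)
    define T where "T = {x. \<phi> (x - (x \<bullet> e) *\<^sub>R e) \<le> x \<bullet> e}"
    have "closed T" unfolding T_def by (intro closed_Collect_le cont continuous_intros)
    have "closure (S \<inter> ball p r) \<subseteq> T"
      by (rule closure_minimal[OF _ \<open>closed T\<close>]) (auto simp: eq T_def)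
    then have T: "x \<in> T" if "x \<in> closure S" "x \<in> ball p r" for x
      using that open_Int_closure_subset[of "ball p r" S] by (auto simp: Int_commute)
    show ?thesis
    proof (rule exI[of _ "r / 2"], rule exI[of _ e], rule exI[of _ "r / 2"], intro conjI ballI allI impI)
      fix x t assume x: "x \<in> closure S \<inter> ball p (r / 2)" and t: "0 < t \<and> t \<le> r / 2"
      have "x \<in> ball p r" using x r by auto
      then have xT: "\<phi> (x - (x \<bullet> e) *\<^sub>R e) \<le> x \<bullet> e" using T x by (auto simp: T_def)
      have "dist p (x + t *\<^sub>R e) \<le> dist p x + dist x (x + t *\<^sub>R e)" by (rule dist_triangle)
      also have "\<dots> < r / 2 + r / 2" using x t e by (intro add_less_le_mono) (auto simp: dist_norm)
      finally have b: "x + t *\<^sub>R e \<in> ball p r" by simp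
      have ie: "(x + t *\<^sub>R e) \<bullet> e = x \<bullet> e + t" by (simp add: inner_add_left ee)
      have proj: "x + t *\<^sub>R e - ((x + t *\<^sub>R e) \<bullet> e) *\<^sub>R e = x - (x \<bullet> e) *\<^sub>R e"
        unfolding ie by (simp add: scaleR_add_left)
      have "x + t *\<^sub>R e \<in> {x \<in> ball p r. \<phi> (x - (x \<bullet> e) *\<^sub>R e) < x \<bullet> e}"
        unfolding mem_Collect_eq proj unfolding ie using b xT t by linarith
      then show "x + t *\<^sub>R e \<in> S" using eq by blast
    qed (use r in auto)
  qed
qed

lemma inward_Times:
  fixes S :: "'a::euclidean_space set" and T :: "'b::euclidean_space set"
  assumes "inward S" "inward T"
  shows "inward (S \<times> T)"
  unfolding inward_def
proof
  fix p assume "p \<in> closure (S \<times> T)"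
  then have p: "fst p \<in> closure S" "snd p \<in> closure T" by (auto simp: closure_Times)
  obtain r1 e1 \<tau>1 where 1: "r1 > 0" "\<tau>1 > 0" "\<forall>x\<in>closure S \<inter> ball (fst p) r1. \<forall>t. 0 < t \<and> t \<le> \<tau>1 \<longrightarrow> x + t *\<^sub>R e1 \<in> S"
    using assms(1) p(1) unfolding inward_def by blast
  obtain r2 e2 \<tau>2 where 2: "r2 > 0" "\<tau>2 > 0" "\<forall>x\<in>closure T \<inter> ball (snd p) r2. \<forall>t. 0 < t \<and> t \<le> \<tau>2 \<longrightarrow> x + t *\<^sub>R e2 \<in> T"
    using assms(2) p(2) unfolding inward_def by blast
  show "\<exists>r e \<tau>. r > 0 \<and> \<tau> > 0 \<and> (\<forall>x\<in>closure (S \<times> T) \<inter> ball p r. \<forall>t. 0 < t \<and> t \<le> \<tau> \<longrightarrow> x + t *\<^sub>R e \<in> S \<times> T)"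
  proof (rule exI[of _ "min r1 r2"], rule exI[of _ "(e1, e2)"], rule exI[of _ "min \<tau>1 \<tau>2"], intro conjI ballI allI impI)
    fix x t assume x: "x \<in> closure (S \<times> T) \<inter> ball p (min r1 r2)" and t: "0 < t \<and> t \<le> min \<tau>1 \<tau>2"
    have "fst x \<in> closure S \<inter> ball (fst p) r1" "snd x \<in> closure T \<inter> ball (snd p) r2"
      using x dist_fst_le[of p x] dist_snd_le[of p x] by (auto simp: closure_Times mem_Times_iff)
    then show "x + t *\<^sub>R (e1, e2) \<in> S \<times> T" using 1 2 t by (auto simp: mem_Times_iff)
  qed (use 1 2 in auto)
qed

lemma inward_interval: "inward {0<..<h::real}"
  unfolding inward_def
proof
  fix p assume p: "p \<in> closure {0<..<h}"
  have h: "h > 0"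
  proof (rule ccontr)
    assume "\<not> h > 0"
    then have "{0<..<h} = {}" by auto
    then show False using p by simp
  qed
  have cl: "closure {0<..<h} = {0..h}" using h by (rule closure_greaterThanLessThan)
  show "\<exists>r e \<tau>. r > 0 \<and> \<tau> > 0 \<and> (\<forall>x\<in>closure {0<..<h} \<inter> ball p r. \<forall>t. 0 < t \<and> t \<le> \<tau> \<longrightarrow> x + t *\<^sub>R e \<in> {0<..<h})"
  proof (rule exI[of _ "h / 4"], rule exI[of _ "if p \<le> h / 2 then 1 else - 1"], rule exI[of _ "h / 8"], intro conjI ballI allI impI)
    fix x t assume x: "x \<in> closure {0<..<h} \<inter> ball p (h / 4)" and t: "0 < t \<and> t \<le> h / 8"
    have "0 \<le> x" "x \<le> h" "\<bar>p - x\<bar> < h / 4" using x unfolding cl by (auto simp: dist_real_def)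
    then have "0 \<le> x" "x \<le> h" "p - x < h / 4" "x - p < h / 4" by linarith+
    then show "x + t *\<^sub>R (if p \<le> h / 2 then 1 else - 1) \<in> {0<..<h}" using t by auto
  qed (use h in auto)
qed

lemma inward_translation:
  fixes S :: "'a::euclidean_space set"
  assumes "inward S"
  shows "inward ((\<lambda>x. a + x) ` S)"
  unfolding inward_def
proof
  fix p assume "p \<in> closure ((\<lambda>x. a + x) ` S)"
  then have p: "p - a \<in> closure S" by (auto simp: closure_translation)
  obtain r e \<tau> where 1: "r > 0" "\<tau> > 0" "\<forall>x\<in>closure S \<inter> ball (p - a) r. \<forall>t. 0 < t \<and> t \<le> \<tau> \<longrightarrow> x + t *\<^sub>R e \<in> S"
    using assms p unfolding inward_def by blast
  show "\<exists>r e \<tau>. r > 0 \<and> \<tau> > 0 \<and> (\<forall>x\<in>closure ((\<lambda>x. a + x) ` S) \<inter> ball p r. \<forall>t. 0 < t \<and> t \<le> \<tau> \<longrightarrow> x + t *\<^sub>R e \<in> (\<lambda>x. a + x) ` S)"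
  proof (rule exI[of _ r], rule exI[of _ e], rule exI[of _ \<tau>], intro conjI ballI allI impI 1(1,2))
    fix x t assume x: "x \<in> closure ((\<lambda>x. a + x) ` S) \<inter> ball p r" and t: "0 < t \<and> t \<le> \<tau>"
    then obtain y where y: "y \<in> closure S" "x = a + y" unfolding closure_translation by blast
    have "y \<in> ball (p - a) r" using x y by (auto simp: dist_norm algebra_simps)
    then have "y + t *\<^sub>R e \<in> S" using 1(3) y(1) t by blast
    then show "x + t *\<^sub>R e \<in> (\<lambda>x. a + x) ` S" using y by (auto simp: image_iff add.assoc intro!: bexI[of _ "y + t *\<^sub>R e"])
  qed
qed

lemma inward_scaling:
  fixes S :: "'a::euclidean_space set"
  assumes "inward S" and c: "c > 0"
  shows "inward ((\<lambda>x. c *\<^sub>R x) ` S)"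
  unfolding inward_def
proof
  have cl: "closure ((\<lambda>x. c *\<^sub>R x) ` S) = (\<lambda>x. c *\<^sub>R x) ` closure S" by (simp add: closure_scaleR)
  fix p assume "p \<in> closure ((\<lambda>x. c *\<^sub>R x) ` S)"
  then obtain q where q: "q \<in> closure S" "p = c *\<^sub>R q" using cl by auto
  obtain r e \<tau> where 1: "r > 0" "\<tau> > 0" "\<forall>x\<in>closure S \<inter> ball q r. \<forall>t. 0 < t \<and> t \<le> \<tau> \<longrightarrow> x + t *\<^sub>R e \<in> S"
    using assms q unfolding inward_def by blast
  show "\<exists>r e \<tau>. r > 0 \<and> \<tau> > 0 \<and> (\<forall>x\<in>closure ((\<lambda>x. c *\<^sub>R x) ` S) \<inter> ball p r. \<forall>t. 0 < t \<and> t \<le> \<tau> \<longrightarrow> x + t *\<^sub>R e \<in> (\<lambda>x. c *\<^sub>R x) ` S)"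
  proof (rule exI[of _ "c * r"], rule exI[of _ "c *\<^sub>R e"], rule exI[of _ \<tau>], intro conjI ballI allI impI 1(2))
    show "c * r > 0" using 1 c by simp
    fix x t assume x: "x \<in> closure ((\<lambda>x. c *\<^sub>R x) ` S) \<inter> ball p (c * r)" and t: "0 < t \<and> t \<le> \<tau>"
    then obtain y where y: "y \<in> closure S" "x = c *\<^sub>R y" unfolding cl by blast
    have "dist p x = c * dist q y" using c q y by (simp add: dist_norm flip: scaleR_diff_right)
    then have "y \<in> ball q r" using x c by simp
    then have "y + t *\<^sub>R e \<in> S" using 1(3) y(1) t by blast
    then show "x + t *\<^sub>R c *\<^sub>R e \<in> (\<lambda>x. c *\<^sub>R x) ` S"
      using y by (auto simp: image_iff scaleR_add_right mult.commute intro!: bexI[of _ "y + t *\<^sub>R e"])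
  qed
qed

text \<open>
  On a finite measure space a Cauchy sequence in the square norm is Cauchy in the mean, hence has an
  almost everywhere convergent subsequence; Fatou's lemma gives convergence in the square norm.
\<close>
lemma L2_complete:
  fixes f :: "nat \<Rightarrow> 'a \<Rightarrow> complex"
  assumes M: "finite_measure M" and fm: "\<And>m. f m \<in> borel_measurable M"
    and f2: "\<And>m. integrable M (\<lambda>x. (norm (f m x))\<^sup>2)"
    and cauchy: "\<And>e. e > 0 \<Longrightarrow> \<exists>N. \<forall>m\<ge>N. \<forall>p\<ge>N. (LINT x|M. (norm (f m x - f p x))\<^sup>2) < e"
  shows "\<exists>u. u \<in> borel_measurable M \<and> integrable M (\<lambda>x. (norm (u x))\<^sup>2) \<and>
    (\<lambda>m. LINT x|M. (norm (f m x - u x))\<^sup>2) \<longlonglongrightarrow> 0"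
proof -
  interpret finite_measure M by fact
  note fm[measurable]
  note sq = norm_diff_square_le
  have d2: "integrable M (\<lambda>x. (norm (g x - h x))\<^sup>2)"
    if "g \<in> borel_measurable M" "h \<in> borel_measurable M" "integrable M (\<lambda>x. (norm (g x))\<^sup>2)" "integrable M (\<lambda>x. (norm (h x))\<^sup>2)"
    for g h :: "'a \<Rightarrow> complex"
  proof (rule Bochner_Integration.integrable_bound)
    show "integrable M (\<lambda>x. 2 * (norm (g x))\<^sup>2 + 2 * (norm (h x))\<^sup>2)" using that by auto
    show "(\<lambda>x. (norm (g x - h x))\<^sup>2) \<in> borel_measurable M" using that(1,2) by measurable
    show "AE x in M. norm ((norm (g x - h x))\<^sup>2) \<le> norm (2 * (norm (g x))\<^sup>2 + 2 * (norm (h x))\<^sup>2)"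
      using sq by (intro AE_I2) simp
  qed
  have l1: "integrable M g" if "g \<in> borel_measurable M" "integrable M (\<lambda>x. (norm (g x))\<^sup>2)" for g :: "'a \<Rightarrow> complex"
  proof (rule Bochner_Integration.integrable_bound)
    show "integrable M (\<lambda>x. 1 + (norm (g x))\<^sup>2)" using that by auto
    have "norm (g x) \<le> 1 + (norm (g x))\<^sup>2" for x
      using sum_squares_bound[of "norm (g x)" 1] norm_ge_zero[of "g x"] zero_le_power2[of "norm (g x)"] unfolding power_one mult_1_right by linarith
    then show "AE x in M. norm (g x) \<le> norm (1 + (norm (g x))\<^sup>2)" by (intro AE_I2) simp
  qed fact
  have L1: "\<exists>N. \<forall>m\<ge>N. \<forall>p\<ge>N. (LINT x|M. norm (f m x - f p x)) < e" if e: "e > 0" for e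
  proof -
    define \<mu> where "\<mu> = measure M (space M)"
    \<comment> \<open>\<open>|a| \<le> \<eta> / 2 + |a|\<^sup>2 / (2 * \<eta>)\<close> bounds the mean by the square norm\<close>
    define \<eta> where "\<eta> = e / (\<mu> + 1)"
    have \<mu>: "\<mu> \<ge> 0" by (simp add: \<mu>_def)
    have \<eta>: "\<eta> > 0" "\<eta> * \<mu> < e" using e \<mu> by (auto simp: \<eta>_def divide_less_eq)
    obtain N where N: "\<forall>m\<ge>N. \<forall>p\<ge>N. (LINT x|M. (norm (f m x - f p x))\<^sup>2) < e * \<eta>"
      using cauchy[of "e * \<eta>"] e \<eta> by auto
    have "(LINT x|M. norm (f m x - f p x)) < e" if mp: "m \<ge> N" "p \<ge> N" for m p
    proof -
      have "(LINT x|M. norm (f m x - f p x)) \<le> (LINT x|M. \<eta> / 2 + (norm (f m x - f p x))\<^sup>2 / (2 * \<eta>))"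
      proof (rule Bochner_Integration.integral_mono)
        show "integrable M (\<lambda>x. norm (f m x - f p x))"
          by (intro integrable_norm Bochner_Integration.integrable_diff l1 fm f2)
        show "integrable M (\<lambda>x. \<eta> / 2 + (norm (f m x - f p x))\<^sup>2 / (2 * \<eta>))"
          using d2[OF fm fm f2 f2, of m p] by auto
        show "norm (f m x - f p x) \<le> \<eta> / 2 + (norm (f m x - f p x))\<^sup>2 / (2 * \<eta>)" for x
        proof -
          have "2 * \<eta> * norm (f m x - f p x) \<le> \<eta>\<^sup>2 + (norm (f m x - f p x))\<^sup>2"
            by (rule sum_squares_bound)
          then show ?thesis using \<eta>(1) by (simp add: field_simps power2_eq_square)
        qed
      qed
      also have "\<dots> = \<eta> / 2 * \<mu> + (LINT x|M. (norm (f m x - f p x))\<^sup>2) / (2 * \<eta>)"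
        using d2[OF fm fm f2 f2, of m p] by (simp add: \<mu>_def)
      also have "(LINT x|M. (norm (f m x - f p x))\<^sup>2) / (2 * \<eta>) < e * \<eta> / (2 * \<eta>)"
        using N mp \<eta>(1) by (intro divide_strict_right_mono) auto
      finally show ?thesis using \<eta> by simp
    qed
    then show ?thesis by blast
  qed
  obtain r where r: "strict_mono r" "AE x in M. Cauchy (\<lambda>i. f (r i) x)"
    by (rule cauchy_L1_AE_cauchy_subseq[OF l1[OF fm f2] L1]) (assumption, rule that)
  define u where "u x = lim (\<lambda>i. f (r i) x)" for x
  have um[measurable]: "u \<in> borel_measurable M" unfolding u_def[abs_def] by measurable
  have conv: "AE x in M. (\<lambda>i. f (r i) x) \<longlonglongrightarrow> u x"
    using r(2) by eventually_elim (simp add: u_def Cauchy_convergent_iff convergent_LIMSEQ_iff)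
  have fatou: "(\<integral>\<^sup>+x. ennreal ((norm (f m x - u x))\<^sup>2) \<partial>M) \<le> ennreal e"
    if N: "\<forall>m\<ge>N. \<forall>p\<ge>N. (LINT x|M. (norm (f m x - f p x))\<^sup>2) < e" and m: "m \<ge> N" for N e m
  proof -
    have "(\<integral>\<^sup>+x. ennreal ((norm (f m x - u x))\<^sup>2) \<partial>M) = (\<integral>\<^sup>+x. liminf (\<lambda>i. ennreal ((norm (f m x - f (r i) x))\<^sup>2)) \<partial>M)"
    proof (rule nn_integral_cong_AE)
      show "AE x in M. ennreal ((norm (f m x - u x))\<^sup>2) = liminf (\<lambda>i. ennreal ((norm (f m x - f (r i) x))\<^sup>2))"
        using conv
      proof eventually_elim
        case (elim x)
        then have "(\<lambda>i. ennreal ((norm (f m x - f (r i) x))\<^sup>2)) \<longlonglongrightarrow> ennreal ((norm (f m x - u x))\<^sup>2)"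
          by (intro tendsto_intros) auto
        from lim_imp_Liminf[OF sequentially_bot this] show ?case by simp
      qed
    qed
    also have "\<dots> \<le> liminf (\<lambda>i. \<integral>\<^sup>+x. ennreal ((norm (f m x - f (r i) x))\<^sup>2) \<partial>M)"
      by (rule nn_integral_liminf) measurable
    also have "\<dots> \<le> ennreal e"
    proof (rule Liminf_le)
      show "\<forall>\<^sub>F i in sequentially. (\<integral>\<^sup>+x. ennreal ((norm (f m x - f (r i) x))\<^sup>2) \<partial>M) \<le> ennreal e"
        using eventually_ge_at_top[of N]
      proof eventually_elim
        case (elim i)
        then have "r i \<ge> N" using seq_suble[OF r(1), of i] by linarith
        have "(\<integral>\<^sup>+x. ennreal ((norm (f m x - f (r i) x))\<^sup>2) \<partial>M) = ennreal (LINT x|M. (norm (f m x - f (r i) x))\<^sup>2)"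
          using d2[OF fm fm f2 f2] by (intro nn_integral_eq_integral) auto
        also have "\<dots> \<le> ennreal e" using N m \<open>r i \<ge> N\<close> by (intro ennreal_leI) (simp add: less_imp_le)
        finally show ?case .
      qed
    qed simp
    finally show ?thesis .
  qed
  have diff_int: "integrable M (\<lambda>x. (norm (f m x - u x))\<^sup>2) \<and> (LINT x|M. (norm (f m x - u x))\<^sup>2) \<le> e"
    if N: "\<forall>m\<ge>N. \<forall>p\<ge>N. (LINT x|M. (norm (f m x - f p x))\<^sup>2) < e" and m: "m \<ge> N" and e: "e > 0" for N e m
  proof -
    have le: "(\<integral>\<^sup>+x. ennreal ((norm (f m x - u x))\<^sup>2) \<partial>M) \<le> ennreal e" by (rule fatou[OF N m])
    then have "(\<integral>\<^sup>+x. ennreal ((norm (f m x - u x))\<^sup>2) \<partial>M) < \<infinity>"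
      using le_less_trans[OF le, of \<infinity>] by simp
    then have i: "integrable M (\<lambda>x. (norm (f m x - u x))\<^sup>2)"
      by (intro integrableI_nonneg) auto
    have "ennreal (LINT x|M. (norm (f m x - u x))\<^sup>2) \<le> ennreal e"
      using le nn_integral_eq_integral[OF i] by simp
    then show ?thesis using i e by (simp add: ennreal_le_iff)
  qed
  obtain N where N: "\<forall>m\<ge>N. \<forall>p\<ge>N. (LINT x|M. (norm (f m x - f p x))\<^sup>2) < 1" using cauchy[of 1] by auto
  have u2: "integrable M (\<lambda>x. (norm (u x))\<^sup>2)"
  proof -
    have "integrable M (\<lambda>x. (norm (f N x - (f N x - u x)))\<^sup>2)"
      by (rule d2) (use diff_int[OF N] f2 in auto)
    then show ?thesis by simp
  qed
  have "(\<lambda>m. LINT x|M. (norm (f m x - u x))\<^sup>2) \<longlonglongrightarrow> 0"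
  proof (rule LIMSEQ_I)
    fix e :: real assume e: "e > 0"
    then obtain N where N: "\<forall>m\<ge>N. \<forall>p\<ge>N. (LINT x|M. (norm (f m x - f p x))\<^sup>2) < e / 2"
      using cauchy[of "e / 2"] by auto
    have "norm ((LINT x|M. (norm (f m x - u x))\<^sup>2) - 0) < e" if "m \<ge> N" for m
      using diff_int[OF N that] e by simp
    then show "\<exists>N. \<forall>m\<ge>N. norm ((LINT x|M. (norm (f m x - u x))\<^sup>2) - 0) < e" by blast
  qed
  then show ?thesis using um u2 by blast
qed

section \<open>The Sobolev space and its two forms\<close>

lemma borel_measurable_of_real_fun:
  "f \<in> borel_measurable M \<Longrightarrow> (\<lambda>x. complex_of_real (f x)) \<in> borel_measurable M"
  by (rule measurable_compose[OF _ borel_measurable_continuous_onI]) (auto intro!: continuous_intros)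

lemma borel_measurable_cnj_fun:
  "f \<in> borel_measurable M \<Longrightarrow> (\<lambda>x. cnj (f x)) \<in> borel_measurable M"
  by (rule measurable_compose[OF _ borel_measurable_continuous_onI]) (auto intro!: continuous_intros)

lemma integrable_L2_product:
  fixes u v :: "'a \<Rightarrow> complex"
  assumes "u \<in> borel_measurable M" "v \<in> borel_measurable M" "w \<in> borel_measurable M"
    and "integrable M (\<lambda>x. (norm (u x))\<^sup>2)" "integrable M (\<lambda>x. (norm (v x))\<^sup>2)" "\<And>x. \<bar>w x\<bar> \<le> C"
  shows "integrable M (\<lambda>x. u x * cnj (v x) * of_real (w x))"
proof (rule Bochner_Integration.integrable_bound)
  show "integrable M (\<lambda>x. C * ((norm (u x))\<^sup>2 + (norm (v x))\<^sup>2))" using assms by auto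
  show "(\<lambda>x. u x * cnj (v x) * of_real (w x)) \<in> borel_measurable M"
    by (intro borel_measurable_times borel_measurable_of_real_fun borel_measurable_cnj_fun assms(1-3))
  have "norm (u x * cnj (v x) * of_real (w x)) \<le> norm (C * ((norm (u x))\<^sup>2 + (norm (v x))\<^sup>2))" for x
  proof -
    have "norm (u x) * norm (v x) \<le> (norm (u x))\<^sup>2 + (norm (v x))\<^sup>2"
      using sum_squares_bound[of "norm (u x)" "norm (v x)"] mult_nonneg_nonneg[OF norm_ge_zero[of "u x"] norm_ge_zero[of "v x"]]
      unfolding mult.assoc by linarith
    then have "(norm (u x) * norm (v x)) * \<bar>w x\<bar> \<le> ((norm (u x))\<^sup>2 + (norm (v x))\<^sup>2) * C"
      using assms(6)[of x] by (intro mult_mono) auto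
    also have "\<dots> \<le> \<bar>C * ((norm (u x))\<^sup>2 + (norm (v x))\<^sup>2)\<bar>" by (simp add: mult.commute)
    finally show ?thesis by (simp add: norm_mult)
  qed
  then show "AE x in M. norm (u x * cnj (v x) * of_real (w x)) \<le> norm (C * ((norm (u x))\<^sup>2 + (norm (v x))\<^sup>2))"
    by (intro AE_I2)
qed

lemma L2_D: "u \<in> L2 S \<Longrightarrow> u \<in> borel_measurable (lebesgue_on S)"
  "u \<in> L2 S \<Longrightarrow> integrable (lebesgue_on S) (\<lambda>x. (norm (u x))\<^sup>2)"
  by (auto simp: L2_def)

lemma L2_lincomb:
  assumes u: "u \<in> L2 S" and v: "v \<in> L2 S"
  shows "(\<lambda>x. u x + c * v x) \<in> L2 S"
  unfolding L2_def mem_Collect_eq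
proof
  note m[measurable] = L2_D(1)[OF u] L2_D(1)[OF v]
  show "(\<lambda>x. u x + c * v x) \<in> borel_measurable (lebesgue_on S)" by measurable
  show "integrable (lebesgue_on S) (\<lambda>x. (norm (u x + c * v x))\<^sup>2)"
  proof (rule Bochner_Integration.integrable_bound)
    show "integrable (lebesgue_on S) (\<lambda>x. 2 * (norm (u x))\<^sup>2 + 2 * ((norm c)\<^sup>2 * (norm (v x))\<^sup>2))"
      using L2_D(2)[OF u] L2_D(2)[OF v] by auto
    have "(norm (u x + c * v x))\<^sup>2 \<le> 2 * (norm (u x))\<^sup>2 + 2 * ((norm c)\<^sup>2 * (norm (v x))\<^sup>2)" for x
    proof -
      have "(norm (u x + c * v x))\<^sup>2 \<le> (norm (u x) + norm (c * v x))\<^sup>2" by (intro power_mono norm_triangle_ineq) auto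
      also have "\<dots> \<le> 2 * (norm (u x))\<^sup>2 + 2 * (norm (c * v x))\<^sup>2"
        using sum_squares_bound[of "norm (u x)" "norm (c * v x)"] by (simp add: power2_sum)
      finally show ?thesis by (simp add: norm_mult power_mult_distrib)
    qed
    then show "AE x in lebesgue_on S. norm ((norm (u x + c * v x))\<^sup>2) \<le> norm (2 * (norm (u x))\<^sup>2 + 2 * ((norm c)\<^sup>2 * (norm (v x))\<^sup>2))"
      by (intro AE_I2) simp
  qed measurable
qed

lemma zero_in_L2: "(\<lambda>_. 0) \<in> L2 S"
  by (simp add: L2_def)

lemma weighted_inner_diag:
  "Re (weighted_inner S w u u) = (LINT x|lebesgue_on S. (norm (u x))\<^sup>2 * w x)"
proof -
  have eq: "u x * cnj (u x) * of_real (w x) = of_real ((norm (u x))\<^sup>2 * w x)" for x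
    unfolding of_real_mult complex_norm_square ..
  show ?thesis unfolding weighted_inner_def eq integral_complex_of_real by (rule Re_complex_of_real)
qed

lemma hermitian_form_weighted_inner:
  assumes w: "w \<in> borel_measurable (lebesgue_on S)" "\<And>x. 0 \<le> w x" "\<And>x. w x \<le> C"
  shows "hermitian_form (L2 S) (weighted_inner S w)"
proof
  have int: "integrable (lebesgue_on S) (\<lambda>x. u x * cnj (v x) * of_real (w x))" if "u \<in> L2 S" "v \<in> L2 S" for u v
    using w by (intro integrable_L2_product[where C = C] L2_D that) auto
  show "(\<lambda>_. 0) \<in> L2 S" by (rule zero_in_L2)
  show "(\<lambda>x. u x + c * v x) \<in> L2 S" if "u \<in> L2 S" "v \<in> L2 S" for u v c
    using that by (rule L2_lincomb)
  show "weighted_inner S w (\<lambda>x. u x + c * v x) y = weighted_inner S w u y + c * weighted_inner S w v y"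
    if "u \<in> L2 S" "v \<in> L2 S" "y \<in> L2 S" for u v y c
  proof -
    have "weighted_inner S w (\<lambda>x. u x + c * v x) y
      = (LINT x|lebesgue_on S. u x * cnj (y x) * of_real (w x) + c * (v x * cnj (y x) * of_real (w x)))"
      unfolding weighted_inner_def by (intro Bochner_Integration.integral_cong) (auto simp: algebra_simps)
    also have "\<dots> = weighted_inner S w u y + c * weighted_inner S w v y"
      unfolding weighted_inner_def using int[OF that(1,3)] int[OF that(2,3)] by simp
    finally show ?thesis .
  qed
  show "weighted_inner S w v u = cnj (weighted_inner S w u v)" for u v
    unfolding weighted_inner_def Bochner_Integration.integral_cnj[symmetric]
    by (intro Bochner_Integration.integral_cong) (auto simp: mult_ac)
  show "0 \<le> Re (weighted_inner S w u u)" for u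
    unfolding weighted_inner_diag using w by (intro Bochner_Integration.integral_nonneg) auto
qed

lemma hermitian_form_subspace:
  assumes "hermitian_form V s" "W \<subseteq> V" "(\<lambda>_. 0) \<in> W" "\<And>u v c. u \<in> W \<Longrightarrow> v \<in> W \<Longrightarrow> (\<lambda>x. u x + c * v x) \<in> W"
  shows "hermitian_form W s"
proof -
  interpret hermitian_form V s by fact
  show ?thesis
  proof
    show "(\<lambda>_. 0) \<in> W" by fact
    show "(\<lambda>x. u x + c * v x) \<in> W" if "u \<in> W" "v \<in> W" for u v c using assms(4) that .
    show "s (\<lambda>x. u x + c * v x) w = s u w + c * s v w" if "u \<in> W" "v \<in> W" "w \<in> W" for u v w c
      using lin[of u v w c] that assms(2) by blast
    show "s v u = cnj (s u v)" if "u \<in> W" "v \<in> W" for u v using herm[of u v] that assms(2) by blast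
    show "0 \<le> Re (s u u)" if "u \<in> W" for u using pos[of u] that assms(2) by blast
  qed
qed

text \<open>
  The open set \<open>S0\<close> carries the analysis, while the form and the eigenvalues refer to \<open>S\<close>, which
  differs from it by a null set.
\<close>
locale weighted_domain =
  fixes S S0 :: "'a::euclidean_space set" and \<rho> :: "'a \<Rightarrow> real" and \<rho>0 \<rho>1 :: real
  assumes S_borel: "S \<in> sets borel" and S_bounded: "bounded S"
    and S0: "open S0" "S0 \<subseteq> S" "AE x in lborel. x \<in> S \<longrightarrow> x \<in> S0"
    and \<rho>_borel: "\<rho> \<in> borel_measurable borel" and \<rho>0: "0 < \<rho>0" and \<rho>: "\<And>x. \<rho>0 \<le> \<rho> x" "\<And>x. \<rho> x \<le> \<rho>1"
    and coercive: "coercive_on S S0"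
begin

abbreviation M where "M \<equiv> lebesgue_on S"

lemma S_lebesgue: "S \<in> sets lebesgue"
  using S_borel by simp

lemma S_lmeasurable: "S \<in> lmeasurable"
  using S_bounded S_lebesgue by (rule bounded_set_imp_lmeasurable)

sublocale fin: finite_measure M
  using S_lmeasurable by (rule finite_measure_lebesgue_on)

lemma borel_M: "f \<in> borel_measurable borel \<Longrightarrow> f \<in> borel_measurable M"
  by (intro measurable_restrict_space1 measurable_completion) simp

text \<open>
  Borel representatives on the whole space, so that Fubini's theorem and translations apply.
\<close>
lemma representative:
  fixes u :: "'a \<Rightarrow> complex"
  assumes "u \<in> borel_measurable M"
  shows "\<exists>u0. u0 \<in> borel_measurable borel \<and> (AE x in lborel. u0 x = (if x \<in> S then u x else 0))"
proof -
  define U where "U x = (if x \<in> S then u x else 0)" for x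
  have U: "U \<in> borel_measurable lebesgue"
    unfolding U_def[abs_def] by (rule borel_measurable_if_I[OF assms S_lebesgue])
  have "(\<lambda>x. Re (U x)) \<in> borel_measurable lebesgue" "(\<lambda>x. Im (U x)) \<in> borel_measurable lebesgue"
    using U by measurable
  then obtain a b where ab: "a \<in> borel_measurable lborel" "AE x in lborel. Re (U x) = a x"
    "b \<in> borel_measurable lborel" "AE x in lborel. Im (U x) = b x"
    using completion_ex_borel_measurable_real[of _ lborel] by blast
  note ab(1,3)[measurable]
  show ?thesis
  proof (intro exI[of _ "\<lambda>x. Complex (a x) (b x)"] conjI)
    have "(\<lambda>x. of_real (a x) + \<i> * of_real (b x)) \<in> borel_measurable borel"
      using ab(1,3) by (intro borel_measurable_add borel_measurable_times borel_measurable_of_real_fun borel_measurable_const) auto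
    moreover have "(\<lambda>x. of_real (a x) + \<i> * of_real (b x)) = (\<lambda>x. Complex (a x) (b x))"
      by (simp add: fun_eq_iff complex_eq_iff)
    ultimately show "(\<lambda>x. Complex (a x) (b x)) \<in> borel_measurable borel" by simp
    show "AE x in lborel. Complex (a x) (b x) = (if x \<in> S then u x else 0)"
      using ab(2,4) by eventually_elim (auto simp: U_def complex_eq_iff)
  qed
qed

text \<open>
  The bridge between integrals over \<open>S\<close> with the completed measure and Borel integrals over the whole
  space.
\<close>
lemma transfer_integral:
  fixes F :: "'a \<Rightarrow> 'b::euclidean_space"
  assumes F: "F \<in> borel_measurable M" and F0: "F0 \<in> borel_measurable borel"
    and ae: "AE x in lborel. F0 x = (if x \<in> S then F x else 0)"
  shows "(LINT x|M. F x) = (LINT x|lborel. F0 x)" "integrable M F \<longleftrightarrow> integrable lborel F0"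
proof -
  have eq: "(\<lambda>x. indicator S x *\<^sub>R F x) = (\<lambda>x. if x \<in> S then F x else 0)" by (auto simp: fun_eq_iff)
  have m: "(\<lambda>x. if x \<in> S then F x else 0) \<in> borel_measurable lebesgue"
    by (rule borel_measurable_if_I[OF F S_lebesgue])
  have m0: "F0 \<in> borel_measurable lebesgue" using F0 by (intro measurable_completion) simp
  have ae': "AE x in lebesgue. (if x \<in> S then F x else 0) = F0 x"
    using AE_completion[OF ae] by eventually_elim simp
  have "(LINT x|M. F x) = (LINT x|lebesgue. (if x \<in> S then F x else 0))"
    using S_lebesgue by (subst integral_restrict_space) (auto simp: eq)
  also have "\<dots> = (LINT x|lebesgue. F0 x)" by (rule integral_cong_AE[OF m m0 ae'])
  also have "\<dots> = (LINT x|lborel. F0 x)" by (rule integral_completion) (use F0 in simp)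
  finally show "(LINT x|M. F x) = (LINT x|lborel. F0 x)" .
  have "integrable M F \<longleftrightarrow> integrable lebesgue (\<lambda>x. if x \<in> S then F x else 0)"
    using S_lebesgue by (subst integrable_restrict_space) (auto simp: eq)
  also have "\<dots> \<longleftrightarrow> integrable lebesgue F0" by (rule integrable_cong_AE[OF m m0 ae'])
  also have "\<dots> \<longleftrightarrow> integrable lborel F0" by (rule integrable_completion) (use F0 in simp)
  finally show "integrable M F \<longleftrightarrow> integrable lborel F0" .
qed

lemma L2_integrable: "u \<in> L2 S \<Longrightarrow> integrable M u"
proof (rule Bochner_Integration.integrable_bound)
  assume u: "u \<in> L2 S"
  show "integrable M (\<lambda>x. 1 + (norm (u x))\<^sup>2)" using L2_D(2)[OF u] by auto
  show "u \<in> borel_measurable M" using L2_D(1)[OF u] .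
  have "norm (u x) \<le> 1 + (norm (u x))\<^sup>2" for x
    using sum_squares_bound[of "norm (u x)" 1] norm_ge_zero[of "u x"] zero_le_power2[of "norm (u x)"] unfolding power_one mult_1_right by linarith
  then show "AE x in M. norm (u x) \<le> norm (1 + (norm (u x))\<^sup>2)" by (intro AE_I2) simp
qed

lemma bounded_in_L2:
  assumes "f \<in> borel_measurable borel" "\<And>x. \<bar>f x\<bar> \<le> B"
  shows "(\<lambda>x. complex_of_real (f x)) \<in> L2 S"
  unfolding L2_def mem_Collect_eq
proof
  have f: "f \<in> borel_measurable M" by (rule borel_M[OF assms(1)])
  then show "(\<lambda>x. complex_of_real (f x)) \<in> borel_measurable M" by (rule borel_measurable_of_real_fun)
  show "integrable M (\<lambda>x. (norm (complex_of_real (f x)))\<^sup>2)"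
  proof (rule fin.integrable_const_bound[of _ "B\<^sup>2"])
    have "(\<bar>f x\<bar>)\<^sup>2 \<le> B\<^sup>2" for x using assms(2)[of x] by (intro power_mono) auto
    then show "AE x in M. norm ((norm (complex_of_real (f x)))\<^sup>2) \<le> B\<^sup>2" by (intro AE_I2) simp
    show "(\<lambda>x. (norm (complex_of_real (f x)))\<^sup>2) \<in> borel_measurable M" using f by measurable
  qed
qed

sublocale one: hermitian_form "L2 S" "weighted_inner S (\<lambda>_. 1)"
  by (rule hermitian_form_weighted_inner[of _ _ 1]) auto

lemma one_diag: "one.sq u = (LINT x|M. (norm (u x))\<^sup>2)"
  by (simp add: weighted_inner_diag)

lemma bounded_mult_as_inner:
  "(LINT x|M. of_real (f x) * u x) = weighted_inner S (\<lambda>_. 1) u (\<lambda>x. of_real (f x))"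
  unfolding weighted_inner_def by (simp add: mult.commute)

lemma bounded_mult_integrable:
  assumes "f \<in> borel_measurable borel" "\<And>x. \<bar>f x\<bar> \<le> B" "u \<in> L2 S"
  shows "integrable M (\<lambda>x. of_real (f x) * u x)"
proof -
  have "integrable M (\<lambda>x. u x * cnj (of_real (f x)) * of_real ((\<lambda>_. 1) x))"
    by (rule integrable_L2_product[where C = 1]) (use L2_D[OF bounded_in_L2[OF assms(1,2)]] L2_D[OF assms(3)] in auto)
  then show ?thesis by (simp add: mult.commute)
qed

lemma rep_properties:
  assumes u: "u \<in> L2 S" and u0: "u0 \<in> borel_measurable borel" "AE x in lborel. u0 x = (if x \<in> S then u x else 0)"
  shows "integrable lborel u0" "integrable lborel (\<lambda>x. (norm (u0 x))\<^sup>2)"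
proof -
  show "integrable lborel u0"
    using transfer_integral(2)[OF L2_D(1)[OF u] u0] L2_integrable[OF u] by simp
  have m: "(\<lambda>x. (norm (u x))\<^sup>2) \<in> borel_measurable M" using L2_D(1)[OF u] by measurable
  have m0: "(\<lambda>x. (norm (u0 x))\<^sup>2) \<in> borel_measurable borel" using u0(1) by measurable
  have "AE x in lborel. (norm (u0 x))\<^sup>2 = (if x \<in> S then (norm (u x))\<^sup>2 else 0)"
    using u0(2) by eventually_elim auto
  from transfer_integral(2)[OF m m0 this] show "integrable lborel (\<lambda>x. (norm (u0 x))\<^sup>2)"
    using L2_D(2)[OF u] by simp
qed


lemma weak_rep:
  assumes u: "u \<in> L2 S" "u0 \<in> borel_measurable borel" "AE x in lborel. u0 x = (if x \<in> S then u x else 0)"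
    and g: "g \<in> L2 S" "g0 \<in> borel_measurable borel" "AE x in lborel. g0 x = (if x \<in> S then g x else 0)"
    and w: "has_weak_partial S i u g"
  shows "weak_directional S0 i u0 g0"
  unfolding weak_directional_def
proof (intro allI impI)
  fix \<phi> assume "test_function S0 \<phi>"
  then have \<phi>: "test_function S \<phi>" using S0(2) by (rule test_function_mono)
  note m = test_function_measurable[OF \<phi>]
  have tr: "(LINT x|M. of_real (f x) * y x) = (LINT x|lborel. of_real (f x) * y0 x)"
    if "f \<in> borel_measurable borel" "y \<in> L2 S" "y0 \<in> borel_measurable borel" "AE x in lborel. y0 x = (if x \<in> S then y x else 0)"
    for f and y y0 :: "'a \<Rightarrow> complex"
  proof (rule transfer_integral(1))
    show "(\<lambda>x. of_real (f x) * y x) \<in> borel_measurable M"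
      by (intro borel_measurable_times borel_measurable_of_real_fun borel_M L2_D(1) that)
    show "(\<lambda>x. of_real (f x) * y0 x) \<in> borel_measurable borel"
      by (intro borel_measurable_times borel_measurable_of_real_fun that)
    show "AE x in lborel. of_real (f x) * y0 x = (if x \<in> S then of_real (f x) * y x else 0)"
      using that(4) by eventually_elim auto
  qed
  show "(LINT x|lborel. of_real (frechet_derivative \<phi> (at x) i) * u0 x) = - (LINT x|lborel. of_real (\<phi> x) * g0 x)"
    using w[unfolded has_weak_partial_def, rule_format, OF \<phi>]
    unfolding tr[OF m(2)[of i] u] tr[OF m(1) g] .
qed

lemma test_integrable:
  assumes \<phi>: "test_function S \<phi>" and u: "u \<in> L2 S"
  shows "integrable M (\<lambda>x. of_real (\<phi> x) * u x)"
    "integrable M (\<lambda>x. of_real (frechet_derivative \<phi> (at x) i) * u x)"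
proof -
  obtain B where B: "\<And>x. \<bar>\<phi> x\<bar> \<le> B" "\<And>x. \<bar>frechet_derivative \<phi> (at x) i\<bar> \<le> B"
    by (rule test_function_bounded[OF \<phi>, of i]) (rule that)
  show "integrable M (\<lambda>x. of_real (\<phi> x) * u x)"
    by (rule bounded_mult_integrable[OF test_function_measurable(1)[OF \<phi>] B(1) u])
  show "integrable M (\<lambda>x. of_real (frechet_derivative \<phi> (at x) i) * u x)"
    by (rule bounded_mult_integrable[OF test_function_measurable(2)[OF \<phi>] B(2) u])
qed

lemma weak_partial_unique:
  assumes g: "g \<in> L2 S" "has_weak_partial S i u g" and g': "g' \<in> L2 S" "has_weak_partial S i u g'"
  shows "AE x in M. g x = g' x"
proof -
  define k where "k x = g x + (- 1) * g' x" for x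
  have k: "k \<in> L2 S" unfolding k_def[abs_def] by (rule L2_lincomb[OF g(1) g'(1)])
  obtain k0 where k0: "k0 \<in> borel_measurable borel" "AE x in lborel. k0 x = (if x \<in> S then k x else 0)"
    using representative[OF L2_D(1)[OF k]] by (elim exE conjE)
  have "AE x in lborel. x \<in> S0 \<longrightarrow> k0 x = 0"
  proof (rule fundamental_lemma[OF rep_properties(1)[OF k k0] S0(1)])
    fix \<phi> assume "test_function S0 \<phi>"
    then have \<phi>: "test_function S \<phi>" using S0(2) by (rule test_function_mono)
    note m = test_function_measurable[OF \<phi>]
    have "(LINT x|lborel. of_real (\<phi> x) * k0 x) = (LINT x|M. of_real (\<phi> x) * k x)"
    proof (rule transfer_integral(1)[symmetric])
      show "(\<lambda>x. of_real (\<phi> x) * k x) \<in> borel_measurable M"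
        by (intro borel_measurable_times borel_measurable_of_real_fun borel_M L2_D(1) k m)
      show "(\<lambda>x. of_real (\<phi> x) * k0 x) \<in> borel_measurable borel"
        by (intro borel_measurable_times borel_measurable_of_real_fun k0 m)
      show "AE x in lborel. of_real (\<phi> x) * k0 x = (if x \<in> S then of_real (\<phi> x) * k x else 0)"
        using k0(2) by eventually_elim auto
    qed
    also have "\<dots> = (LINT x|M. of_real (\<phi> x) * g x - of_real (\<phi> x) * g' x)"
      by (intro Bochner_Integration.integral_cong) (auto simp: k_def algebra_simps)
    also have "\<dots> = (LINT x|M. of_real (\<phi> x) * g x) - (LINT x|M. of_real (\<phi> x) * g' x)"
      by (intro Bochner_Integration.integral_diff test_integrable(1)[OF \<phi>] g g')
    also have "\<dots> = 0"
      using g(2)[unfolded has_weak_partial_def, rule_format, OF \<phi>] g'(2)[unfolded has_weak_partial_def, rule_format, OF \<phi>]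
      by simp
    finally show "(LINT x|lborel. of_real (\<phi> x) * k0 x) = 0" .
  qed
  then have "AE x in lborel. x \<in> S \<longrightarrow> g x = g' x"
    using k0(2) S0(3) by eventually_elim (auto simp: k_def)
  then have "AE x in lebesgue. x \<in> S \<longrightarrow> g x = g' x" by (rule AE_completion)
  then show ?thesis using S_lebesgue by (subst AE_restrict_space_iff) auto
qed

lemma H1_D: "u \<in> H1 S \<Longrightarrow> u \<in> L2 S"
  by (simp add: H1_def)

lemma weak_partial_D:
  assumes "u \<in> H1 S" "i \<in> Basis"
  shows "weak_partial S i u \<in> L2 S" "has_weak_partial S i u (weak_partial S i u)"
proof -
  have "\<exists>g. g \<in> L2 S \<and> has_weak_partial S i u g" using assms unfolding H1_def by blast
  from someI_ex[OF this] show "weak_partial S i u \<in> L2 S" "has_weak_partial S i u (weak_partial S i u)"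
    unfolding weak_partial_def by blast+
qed

lemma has_weak_partial_lincomb:
  assumes u: "u \<in> L2 S" "g \<in> L2 S" "has_weak_partial S i u g" and v: "v \<in> L2 S" "h \<in> L2 S" "has_weak_partial S i v h"
  shows "has_weak_partial S i (\<lambda>x. u x + c * v x) (\<lambda>x. g x + c * h x)"
  unfolding has_weak_partial_def
proof (intro allI impI)
  fix \<phi> assume \<phi>: "test_function S \<phi>"
  note ti = test_integrable[OF \<phi>]
  have "(LINT x|M. of_real (frechet_derivative \<phi> (at x) i) * (u x + c * v x))
     = (LINT x|M. of_real (frechet_derivative \<phi> (at x) i) * u x + c * (of_real (frechet_derivative \<phi> (at x) i) * v x))"
    by (intro Bochner_Integration.integral_cong) (auto simp: algebra_simps)
  also have "\<dots> = (LINT x|M. of_real (frechet_derivative \<phi> (at x) i) * u x) + c * (LINT x|M. of_real (frechet_derivative \<phi> (at x) i) * v x)"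
    using ti(2)[OF u(1), of i] ti(2)[OF v(1), of i] by simp
  also have "\<dots> = - ((LINT x|M. of_real (\<phi> x) * g x) + c * (LINT x|M. of_real (\<phi> x) * h x))"
    using u(3) v(3) \<phi> by (simp add: has_weak_partial_def)
  also have "(LINT x|M. of_real (\<phi> x) * g x) + c * (LINT x|M. of_real (\<phi> x) * h x)
     = (LINT x|M. of_real (\<phi> x) * g x + c * (of_real (\<phi> x) * h x))"
    using ti(1)[OF u(2)] ti(1)[OF v(2)] by simp
  also have "\<dots> = (LINT x|M. of_real (\<phi> x) * (g x + c * h x))"
    by (intro Bochner_Integration.integral_cong) (auto simp: algebra_simps)
  finally show "(LINT x|M. of_real (frechet_derivative \<phi> (at x) i) * (u x + c * v x)) = - (LINT x|M. of_real (\<phi> x) * (g x + c * h x))" .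
qed

lemma H1_lincomb:
  assumes u: "u \<in> H1 S" and v: "v \<in> H1 S"
  shows "(\<lambda>x. u x + c * v x) \<in> H1 S"
    "i \<in> Basis \<Longrightarrow> AE x in M. weak_partial S i (\<lambda>x. u x + c * v x) x = weak_partial S i u x + c * weak_partial S i v x"
proof -
  have *: "(\<lambda>x. weak_partial S i u x + c * weak_partial S i v x) \<in> L2 S"
    "has_weak_partial S i (\<lambda>x. u x + c * v x) (\<lambda>x. weak_partial S i u x + c * weak_partial S i v x)" if "i \<in> Basis" for i
    by (intro L2_lincomb weak_partial_D u v that)
      (rule has_weak_partial_lincomb[OF H1_D[OF u] weak_partial_D[OF u that] H1_D[OF v] weak_partial_D[OF v that]])
  show mem: "(\<lambda>x. u x + c * v x) \<in> H1 S"
    unfolding H1_def mem_Collect_eq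
  proof (intro conjI ballI)
    show "(\<lambda>x. u x + c * v x) \<in> L2 S" by (intro L2_lincomb H1_D u v)
    fix i :: 'a assume i: "i \<in> Basis"
    show "\<exists>g\<in>L2 S. has_weak_partial S i (\<lambda>x. u x + c * v x) g"
    proof (rule bexI)
      show "has_weak_partial S i (\<lambda>x. u x + c * v x) (\<lambda>x. weak_partial S i u x + c * weak_partial S i v x)"
        by (rule *(2)[OF i])
      show "(\<lambda>x. weak_partial S i u x + c * weak_partial S i v x) \<in> L2 S" by (rule *(1)[OF i])
    qed
  qed
  show "AE x in M. weak_partial S i (\<lambda>x. u x + c * v x) x = weak_partial S i u x + c * weak_partial S i v x" if i: "i \<in> Basis"
    by (rule weak_partial_unique[OF weak_partial_D[OF mem i] *[OF i]])
qed

lemma zero_in_H1: "(\<lambda>_. 0) \<in> H1 S"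
proof -
  have "has_weak_partial S i (\<lambda>_. 0) (\<lambda>_. 0)" for i by (simp add: has_weak_partial_def)
  then show ?thesis using zero_in_L2 unfolding H1_def by blast
qed

lemma dirichlet_integrable:
  assumes "u \<in> H1 S" "v \<in> H1 S"
  shows "integrable M (\<lambda>x. \<Sum>i\<in>Basis. weak_partial S i u x * cnj (weak_partial S i v x))"
proof (rule Bochner_Integration.integrable_sum)
  fix i :: 'a assume i: "i \<in> Basis"
  have "integrable M (\<lambda>x. weak_partial S i u x * cnj (weak_partial S i v x) * of_real ((\<lambda>_. 1) x))"
    by (rule integrable_L2_product[where C = 1]) (use L2_D[OF weak_partial_D(1)[OF assms(1) i]] L2_D[OF weak_partial_D(1)[OF assms(2) i]] in auto)
  then show "integrable M (\<lambda>x. weak_partial S i u x * cnj (weak_partial S i v x))" by simp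
qed

lemma dirichlet_diag:
  assumes "u \<in> H1 S"
  shows "Re (dirichlet_form S u u) = (\<Sum>i\<in>Basis. LINT x|M. (norm (weak_partial S i u x))\<^sup>2)"
proof -
  have eq: "(\<Sum>i\<in>Basis. weak_partial S i u x * cnj (weak_partial S i u x)) = of_real (\<Sum>i\<in>Basis. (norm (weak_partial S i u x))\<^sup>2)" for x
    unfolding of_real_sum complex_norm_square ..
  have "Re (dirichlet_form S u u) = (LINT x|M. (\<Sum>i\<in>Basis. (norm (weak_partial S i u x))\<^sup>2))"
    unfolding dirichlet_form_def eq integral_complex_of_real by (rule Re_complex_of_real)
  also have "\<dots> = (\<Sum>i\<in>Basis. LINT x|M. (norm (weak_partial S i u x))\<^sup>2)"
    by (intro Bochner_Integration.integral_sum L2_D(2) weak_partial_D assms)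
  finally show ?thesis .
qed

sublocale ip: hermitian_form "H1 S" "weighted_inner S \<rho>"
proof (rule hermitian_form_subspace[OF hermitian_form_weighted_inner[of _ _ \<rho>1]])
  show "\<rho> \<in> borel_measurable M" by (rule borel_M[OF \<rho>_borel])
  show "0 \<le> \<rho> x" for x using \<rho>(1)[of x] \<rho>0 by linarith
qed (use \<rho>(2) H1_D zero_in_H1 H1_lincomb(1) in blast)+

sublocale en: hermitian_form "H1 S" "dirichlet_form S"
proof
  show "(\<lambda>_. 0) \<in> H1 S" by (rule zero_in_H1)
  show "(\<lambda>x. u x + c * v x) \<in> H1 S" if "u \<in> H1 S" "v \<in> H1 S" for u v c using that by (rule H1_lincomb(1))
  show "dirichlet_form S (\<lambda>x. u x + c * v x) w = dirichlet_form S u w + c * dirichlet_form S v w"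
    if uvw: "u \<in> H1 S" "v \<in> H1 S" "w \<in> H1 S" for u v w c
  proof -
    have ae: "AE x in M. \<forall>i\<in>Basis. weak_partial S i (\<lambda>x. u x + c * v x) x = weak_partial S i u x + c * weak_partial S i v x"
      by (rule eventually_ball_finite[OF finite_Basis]) (intro ballI H1_lincomb(2)[OF uvw(1,2)])
    have "dirichlet_form S (\<lambda>x. u x + c * v x) w
      = (LINT x|M. (\<Sum>i\<in>Basis. weak_partial S i u x * cnj (weak_partial S i w x)) + c * (\<Sum>i\<in>Basis. weak_partial S i v x * cnj (weak_partial S i w x)))"
      unfolding dirichlet_form_def
    proof (rule integral_cong_AE)
      show "(\<lambda>x. \<Sum>i\<in>Basis. weak_partial S i (\<lambda>x. u x + c * v x) x * cnj (weak_partial S i w x)) \<in> borel_measurable M"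
        using dirichlet_integrable[OF H1_lincomb(1)[OF uvw(1,2)] uvw(3)] by (rule borel_measurable_integrable)
      show "(\<lambda>x. (\<Sum>i\<in>Basis. weak_partial S i u x * cnj (weak_partial S i w x)) + c * (\<Sum>i\<in>Basis. weak_partial S i v x * cnj (weak_partial S i w x))) \<in> borel_measurable M"
        using dirichlet_integrable[OF uvw(1,3)] dirichlet_integrable[OF uvw(2,3)]
        by (intro borel_measurable_integrable Bochner_Integration.integrable_add integrable_mult_right)
      show "AE x in M. (\<Sum>i\<in>Basis. weak_partial S i (\<lambda>x. u x + c * v x) x * cnj (weak_partial S i w x))
        = (\<Sum>i\<in>Basis. weak_partial S i u x * cnj (weak_partial S i w x)) + c * (\<Sum>i\<in>Basis. weak_partial S i v x * cnj (weak_partial S i w x))"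
        using ae
      proof eventually_elim
        case (elim x)
        then have "(\<Sum>i\<in>Basis. weak_partial S i (\<lambda>x. u x + c * v x) x * cnj (weak_partial S i w x))
          = (\<Sum>i\<in>Basis. (weak_partial S i u x + c * weak_partial S i v x) * cnj (weak_partial S i w x))"
          by (intro sum.cong) auto
        then show ?case by (simp add: sum.distrib sum_distrib_left algebra_simps)
      qed
    qed
    also have "\<dots> = dirichlet_form S u w + c * dirichlet_form S v w"
      unfolding dirichlet_form_def using dirichlet_integrable[OF uvw(1,3)] dirichlet_integrable[OF uvw(2,3)] by simp
    finally show ?thesis .
  qed
  show "dirichlet_form S v u = cnj (dirichlet_form S u v)" for u v
    unfolding dirichlet_form_def Bochner_Integration.integral_cnj[symmetric]
    by (intro Bochner_Integration.integral_cong) (auto simp: mult_ac)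
  show "0 \<le> Re (dirichlet_form S u u)" if "u \<in> H1 S" for u
    unfolding dirichlet_diag[OF that] by (intro sum_nonneg Bochner_Integration.integral_nonneg) auto
qed

end

section \<open>Upper bounds for the eigenvalues\<close>

text \<open>
  Pairing with a bounded function is continuous in the square norm; it makes weak derivatives stable
  under limits.
\<close>
lemma (in weighted_domain) one_tendsto:
  assumes "\<And>m. f m \<in> L2 S" "u \<in> L2 S" "(\<lambda>m. LINT x|M. (norm (f m x - u x))\<^sup>2) \<longlonglongrightarrow> 0"
    and \<psi>: "\<psi> \<in> borel_measurable borel" "\<And>x. \<bar>\<psi> x\<bar> \<le> B"
  shows "(\<lambda>m. LINT x|M. of_real (\<psi> x) * f m x) \<longlonglongrightarrow> (LINT x|M. of_real (\<psi> x) * u x)"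
  unfolding bounded_mult_as_inner
  by (rule one.sq_tendsto(1)[OF assms(1,2) _ bounded_in_L2[OF \<psi>]]) (use assms(3) in \<open>simp add: weighted_inner_diag\<close>)

lemma (in weighted_domain) ip_bounds:
  assumes "u \<in> L2 S"
  shows "\<rho>0 * (LINT x|M. (norm (u x))\<^sup>2) \<le> Re (weighted_inner S \<rho> u u)"
    "Re (weighted_inner S \<rho> u u) \<le> \<rho>1 * (LINT x|M. (norm (u x))\<^sup>2)"
proof -
  note i2 = L2_D(2)[OF assms]
  have i: "integrable M (\<lambda>x. (norm (u x))\<^sup>2 * \<rho> x)"
  proof (rule Bochner_Integration.integrable_bound)
    show "integrable M (\<lambda>x. (norm (u x))\<^sup>2 * \<rho>1)" using i2 by auto
    show "(\<lambda>x. (norm (u x))\<^sup>2 * \<rho> x) \<in> borel_measurable M"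
      using i2 by (intro borel_measurable_times borel_measurable_integrable borel_M[OF \<rho>_borel])
    have "\<bar>\<rho> x\<bar> \<le> \<bar>\<rho>1\<bar>" for x using \<rho>[of x] \<rho>0 by linarith
    then show "AE x in M. norm ((norm (u x))\<^sup>2 * \<rho> x) \<le> norm ((norm (u x))\<^sup>2 * \<rho>1)"
      by (intro AE_I2) (simp add: abs_mult mult_left_mono)
  qed
  have "\<rho>0 * (LINT x|M. (norm (u x))\<^sup>2) = (LINT x|M. (norm (u x))\<^sup>2 * \<rho>0)" by simp
  also have "\<dots> \<le> (LINT x|M. (norm (u x))\<^sup>2 * \<rho> x)"
    using i i2 \<rho> by (intro Bochner_Integration.integral_mono mult_left_mono) auto
  finally show "\<rho>0 * (LINT x|M. (norm (u x))\<^sup>2) \<le> Re (weighted_inner S \<rho> u u)" by (simp add: weighted_inner_diag)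
  have "(LINT x|M. (norm (u x))\<^sup>2 * \<rho> x) \<le> (LINT x|M. (norm (u x))\<^sup>2 * \<rho>1)"
    using i i2 \<rho> by (intro Bochner_Integration.integral_mono mult_left_mono) auto
  also have "\<dots> = \<rho>1 * (LINT x|M. (norm (u x))\<^sup>2)" by simp
  finally show "Re (weighted_inner S \<rho> u u) \<le> \<rho>1 * (LINT x|M. (norm (u x))\<^sup>2)" by (simp add: weighted_inner_diag)
qed

lemma (in weighted_domain) weak_partial_diff:
  assumes "u \<in> H1 S" "v \<in> H1 S" "i \<in> Basis"
  shows "AE x in M. weak_partial S i (\<lambda>x. u x - v x) x = weak_partial S i u x - weak_partial S i v x"
  using H1_lincomb(2)[OF assms, of "-1"] by simp

lemma (in weighted_domain) sq_weak_partial_diff: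
  assumes "u \<in> H1 S" "v \<in> H1 S" "i \<in> Basis"
  shows "(LINT x|M. (norm (weak_partial S i (\<lambda>x. u x - v x) x))\<^sup>2)
    = (LINT x|M. (norm (weak_partial S i u x - weak_partial S i v x))\<^sup>2)"
proof (rule integral_cong_AE)
  note m[measurable] = L2_D(1)[OF weak_partial_D(1)[OF assms(1,3)]] L2_D(1)[OF weak_partial_D(1)[OF assms(2,3)]]
    L2_D(1)[OF weak_partial_D(1)[OF ip.sub[OF assms(1,2)] assms(3)]]
  show "(\<lambda>x. (norm (weak_partial S i (\<lambda>x. u x - v x) x))\<^sup>2) \<in> borel_measurable M" by measurable
  show "(\<lambda>x. (norm (weak_partial S i u x - weak_partial S i v x))\<^sup>2) \<in> borel_measurable M" by measurable
  show "AE x in M. (norm (weak_partial S i (\<lambda>x. u x - v x) x))\<^sup>2 = (norm (weak_partial S i u x - weak_partial S i v x))\<^sup>2"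
    using weak_partial_diff[OF assms] by eventually_elim simp
qed

text \<open>
  Completeness of the Sobolev space: limits of the functions and of their weak derivatives exist in the
  square norm, and the latter are the weak derivatives of the former.
\<close>
sublocale weighted_domain \<subseteq> form_pair "H1 S" "weighted_inner S \<rho>" "dirichlet_form S"
proof
  fix f :: "nat \<Rightarrow> 'a \<Rightarrow> complex"
  assume f: "\<And>m. f m \<in> H1 S"
    and cauchy: "\<And>e. e > 0 \<Longrightarrow> \<exists>N. \<forall>m\<ge>N. \<forall>p\<ge>N. ip.sq (\<lambda>x. f m x - f p x) < e \<and> en.sq (\<lambda>x. f m x - f p x) < e"
  have fL2: "f m \<in> L2 S" for m by (rule H1_D[OF f])
  have diffH1: "(\<lambda>x. f m x - f p x) \<in> H1 S" for m p by (rule ip.sub[OF f f])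
  have "\<exists>u. u \<in> borel_measurable M \<and> integrable M (\<lambda>x. (norm (u x))\<^sup>2) \<and> (\<lambda>m. LINT x|M. (norm (f m x - u x))\<^sup>2) \<longlonglongrightarrow> 0"
  proof (rule L2_complete[OF fin.finite_measure_axioms L2_D[OF fL2]])
    fix e :: real assume e: "e > 0"
    then obtain N where N: "\<forall>m\<ge>N. \<forall>p\<ge>N. ip.sq (\<lambda>x. f m x - f p x) < \<rho>0 * e \<and> en.sq (\<lambda>x. f m x - f p x) < \<rho>0 * e"
      using cauchy[of "\<rho>0 * e"] \<rho>0 by auto
    have "(LINT x|M. (norm (f m x - f p x))\<^sup>2) < e" if "m \<ge> N" "p \<ge> N" for m p
    proof -
      have "\<rho>0 * (LINT x|M. (norm (f m x - f p x))\<^sup>2) \<le> ip.sq (\<lambda>x. f m x - f p x)"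
        by (rule ip_bounds(1)[OF H1_D[OF diffH1]])
      also have "\<dots> < \<rho>0 * e" using N that by blast
      finally show ?thesis using \<rho>0 by simp
    qed
    then show "\<exists>N. \<forall>m\<ge>N. \<forall>p\<ge>N. (LINT x|M. (norm (f m x - f p x))\<^sup>2) < e" by blast
  qed
  then obtain u where u: "u \<in> borel_measurable M" "integrable M (\<lambda>x. (norm (u x))\<^sup>2)" "(\<lambda>m. LINT x|M. (norm (f m x - u x))\<^sup>2) \<longlonglongrightarrow> 0"
    by (elim exE conjE)
  have uL2: "u \<in> L2 S" using u by (simp add: L2_def)
  have "\<forall>i\<in>Basis. \<exists>g. g \<in> L2 S \<and> (\<lambda>m. LINT x|M. (norm (weak_partial S i (f m) x - g x))\<^sup>2) \<longlonglongrightarrow> 0"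
  proof
    fix i :: 'a assume i: "i \<in> Basis"
    have "\<exists>g. g \<in> borel_measurable M \<and> integrable M (\<lambda>x. (norm (g x))\<^sup>2) \<and> (\<lambda>m. LINT x|M. (norm (weak_partial S i (f m) x - g x))\<^sup>2) \<longlonglongrightarrow> 0"
    proof (rule L2_complete[OF fin.finite_measure_axioms L2_D[OF weak_partial_D(1)[OF f i]]])
      fix e :: real assume e: "e > 0"
      then obtain N where N: "\<forall>m\<ge>N. \<forall>p\<ge>N. ip.sq (\<lambda>x. f m x - f p x) < e \<and> en.sq (\<lambda>x. f m x - f p x) < e"
        using cauchy[of e] by auto
      have "(LINT x|M. (norm (weak_partial S i (f m) x - weak_partial S i (f p) x))\<^sup>2) < e" if "m \<ge> N" "p \<ge> N" for m p
      proof -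
        have "(LINT x|M. (norm (weak_partial S i (f m) x - weak_partial S i (f p) x))\<^sup>2)
          = (LINT x|M. (norm (weak_partial S i (\<lambda>x. f m x - f p x) x))\<^sup>2)"
          by (rule sq_weak_partial_diff[OF f f i, symmetric])
        also have "\<dots> \<le> (\<Sum>i\<in>Basis. LINT x|M. (norm (weak_partial S i (\<lambda>x. f m x - f p x) x))\<^sup>2)"
          using i by (intro member_le_sum[where f = "\<lambda>i. LINT x|M. (norm (weak_partial S i (\<lambda>x. f m x - f p x) x))\<^sup>2"] Bochner_Integration.integral_nonneg) auto
        also have "\<dots> = en.sq (\<lambda>x. f m x - f p x)" by (rule dirichlet_diag[OF diffH1, symmetric])
        also have "\<dots> < e" using N that by blast
        finally show ?thesis .
      qed
      then show "\<exists>N. \<forall>m\<ge>N. \<forall>p\<ge>N. (LINT x|M. (norm (weak_partial S i (f m) x - weak_partial S i (f p) x))\<^sup>2) < e" by blast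
    qed
    then show "\<exists>g. g \<in> L2 S \<and> (\<lambda>m. LINT x|M. (norm (weak_partial S i (f m) x - g x))\<^sup>2) \<longlonglongrightarrow> 0"
      by (elim exE conjE, intro exI conjI) (simp_all add: L2_def)
  qed
  from bchoice[OF this] obtain G where G: "\<forall>i\<in>Basis. G i \<in> L2 S \<and> (\<lambda>m. LINT x|M. (norm (weak_partial S i (f m) x - G i x))\<^sup>2) \<longlonglongrightarrow> 0"
    by (elim exE)
  have weak: "has_weak_partial S i u (G i)" if i: "i \<in> Basis" for i
    unfolding has_weak_partial_def
  proof (intro allI impI)
    fix \<phi> assume \<phi>: "test_function S \<phi>"
    obtain B where B: "\<And>x. \<bar>\<phi> x\<bar> \<le> B" "\<And>x. \<bar>frechet_derivative \<phi> (at x) i\<bar> \<le> B"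
      by (rule test_function_bounded[OF \<phi>, of i]) (rule that)
    have 1: "(\<lambda>m. LINT x|M. of_real (frechet_derivative \<phi> (at x) i) * f m x) \<longlonglongrightarrow> (LINT x|M. of_real (frechet_derivative \<phi> (at x) i) * u x)"
      by (rule one_tendsto[OF fL2 uL2 u(3) test_function_measurable(2)[OF \<phi>] B(2)])
    have 2: "(\<lambda>m. LINT x|M. of_real (\<phi> x) * weak_partial S i (f m) x) \<longlonglongrightarrow> (LINT x|M. of_real (\<phi> x) * G i x)"
      by (rule one_tendsto[OF weak_partial_D(1)[OF f i] _ _ test_function_measurable(1)[OF \<phi>] B(1)]) (use G i in auto)
    have eq: "(LINT x|M. of_real (frechet_derivative \<phi> (at x) i) * f m x) = - (LINT x|M. of_real (\<phi> x) * weak_partial S i (f m) x)" for m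
      using weak_partial_D(2)[OF f i, of m] \<phi> unfolding has_weak_partial_def by blast
    show "(LINT x|M. of_real (frechet_derivative \<phi> (at x) i) * u x) = - (LINT x|M. of_real (\<phi> x) * G i x)"
      by (rule LIMSEQ_unique[OF 1]) (unfold eq, rule tendsto_minus[OF 2])
  qed
  have uH1: "u \<in> H1 S" using uL2 weak G unfolding H1_def by blast
  have ae: "AE x in M. weak_partial S i u x = G i x" if i: "i \<in> Basis" for i
    by (rule weak_partial_unique[OF weak_partial_D[OF uH1 i] _ weak[OF i]]) (use G i in blast)
  have dH1: "(\<lambda>x. f m x - u x) \<in> H1 S" for m by (rule ip.sub[OF f uH1])
  have "(\<lambda>m. ip.sq (\<lambda>x. f m x - u x)) \<longlonglongrightarrow> 0"
  proof (rule tendsto_sandwich[OF always_eventually always_eventually])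
    show "\<forall>m. 0 \<le> ip.sq (\<lambda>x. f m x - u x)" using ip.pos[OF dH1] by blast
    show "\<forall>m. ip.sq (\<lambda>x. f m x - u x) \<le> \<rho>1 * (LINT x|M. (norm (f m x - u x))\<^sup>2)"
      using ip_bounds(2)[OF H1_D[OF dH1]] by blast
    show "(\<lambda>m. \<rho>1 * (LINT x|M. (norm (f m x - u x))\<^sup>2)) \<longlonglongrightarrow> 0"
      using tendsto_mult[OF tendsto_const u(3), of \<rho>1] by simp
  qed simp
  moreover have "(\<lambda>m. en.sq (\<lambda>x. f m x - u x)) \<longlonglongrightarrow> 0"
  proof -
    have "en.sq (\<lambda>x. f m x - u x) = (\<Sum>i\<in>Basis. LINT x|M. (norm (weak_partial S i (f m) x - G i x))\<^sup>2)" for m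
      unfolding dirichlet_diag[OF dH1]
    proof (rule sum.cong[OF refl])
      fix i :: 'a assume i: "i \<in> Basis"
      note m[measurable] = L2_D(1)[OF weak_partial_D(1)[OF f i]] L2_D(1)[OF weak_partial_D(1)[OF uH1 i]]
      have Gm[measurable]: "G i \<in> borel_measurable M" using G i L2_D(1) by blast
      have "(LINT x|M. (norm (weak_partial S i (\<lambda>x. f m x - u x) x))\<^sup>2) = (LINT x|M. (norm (weak_partial S i (f m) x - weak_partial S i u x))\<^sup>2)"
        by (rule sq_weak_partial_diff[OF f uH1 i])
      also have "\<dots> = (LINT x|M. (norm (weak_partial S i (f m) x - G i x))\<^sup>2)"
      proof (rule integral_cong_AE)
        show "(\<lambda>x. (norm (weak_partial S i (f m) x - weak_partial S i u x))\<^sup>2) \<in> borel_measurable M" by measurable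
        show "(\<lambda>x. (norm (weak_partial S i (f m) x - G i x))\<^sup>2) \<in> borel_measurable M" by measurable
        show "AE x in M. (norm (weak_partial S i (f m) x - weak_partial S i u x))\<^sup>2 = (norm (weak_partial S i (f m) x - G i x))\<^sup>2"
          using ae[OF i] by eventually_elim simp
      qed
      finally show "(LINT x|M. (norm (weak_partial S i (\<lambda>x. f m x - u x) x))\<^sup>2) = (LINT x|M. (norm (weak_partial S i (f m) x - G i x))\<^sup>2)" .
    qed
    moreover have "(\<lambda>m. \<Sum>i\<in>Basis. LINT x|M. (norm (weak_partial S i (f m) x - G i x))\<^sup>2) \<longlonglongrightarrow> (\<Sum>i\<in>(Basis::'a set). 0)"
      by (rule tendsto_sum) (use G in blast)
    ultimately show ?thesis by simp
  qed
  ultimately show "\<exists>u\<in>H1 S. (\<lambda>m. ip.sq (\<lambda>x. f m x - u x)) \<longlonglongrightarrow> 0 \<and> (\<lambda>m. en.sq (\<lambda>x. f m x - u x)) \<longlonglongrightarrow> 0"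
    using uH1 by blast
qed

context weighted_domain
begin

definition functional :: "'a set \<Rightarrow> ('a \<Rightarrow> complex) \<Rightarrow> complex" where
  "functional Q u = (LINT x|M. of_real (indicator Q x) * u x)"

lemma indicator_bounds: "\<bar>indicator Q x :: real\<bar> \<le> 1"
  by (auto split: split_indicator)

lemma functional_diff:
  assumes "Q \<in> sets borel" "u \<in> H1 S" "w \<in> H1 S"
  shows "functional Q (\<lambda>x. u x - w x) = functional Q u - functional Q w"
proof -
  have "(\<lambda>x. complex_of_real (indicator Q x)) \<in> L2 S"
    by (rule bounded_in_L2[OF _ indicator_bounds]) (use assms in measurable)
  then show ?thesis unfolding functional_def bounded_mult_as_inner
    using one.s_sub[OF H1_D[OF assms(2)] H1_D[OF assms(3)]] by simp
qed

lemma functional_bound: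
  assumes "Q \<in> sets borel" "u \<in> H1 S"
  shows "(norm (functional Q u))\<^sup>2 \<le> measure lebesgue S / \<rho>0 * ip.sq u"
proof -
  have ind: "(\<lambda>x. complex_of_real (indicator Q x)) \<in> L2 S"
    by (rule bounded_in_L2[OF _ indicator_bounds]) (use assms in measurable)
  have "(norm (functional Q u))\<^sup>2 \<le> one.sq u * one.sq (\<lambda>x. complex_of_real (indicator Q x))"
    unfolding functional_def bounded_mult_as_inner by (rule one.cauchy_schwarz[OF H1_D[OF assms(2)] ind])
  also have "one.sq (\<lambda>x. complex_of_real (indicator Q x)) \<le> (LINT x|M. 1)"
    unfolding one_diag
  proof (rule Bochner_Integration.integral_mono)
    show "integrable M (\<lambda>x. (norm (complex_of_real (indicator Q x)))\<^sup>2)" by (rule L2_D(2)[OF ind])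
  qed (auto split: split_indicator)
  also have "(LINT x|M. 1) = measure lebesgue S"
    using S_lebesgue by (simp add: measure_restrict_space)
  finally have "(norm (functional Q u))\<^sup>2 \<le> one.sq u * measure lebesgue S"
    using one.pos[OF H1_D[OF assms(2)]] by (simp add: mult_left_mono)
  also have "one.sq u \<le> ip.sq u / \<rho>0"
    using ip_bounds(1)[OF H1_D[OF assms(2)]] \<rho>0 by (simp add: one_diag le_divide_eq mult.commute)
  finally show ?thesis by (simp add: mult.commute mult_right_mono)
qed

lemma coercivity:
  assumes "\<delta> > 0"
  shows "\<exists>F C. finite F \<and> F \<subseteq> sets borel \<and>
    (\<forall>u\<in>H1 S. ip.sq u \<le> \<delta> * en.sq u + C * (\<Sum>Q\<in>F. (norm (functional Q u))\<^sup>2))"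
proof -
  have \<rho>1: "\<rho>1 > 0" using \<rho>[of 0] \<rho>0 by linarith
  have "\<delta> / \<rho>1 > 0" using assms \<rho>1 by simp
  from coercive_onE[OF coercive this] obtain F C where F: "finite F" "F \<subseteq> sets borel" "0 \<le> C"
     "\<And>u g. weak_gradient S0 u g \<Longrightarrow>
        (LINT x|lborel. indicator S x * (norm (u x))\<^sup>2) \<le> \<delta> / \<rho>1 * (LINT x|lborel. indicator S0 x * energy g x)
          + C * (\<Sum>Q\<in>F. (norm (LINT x|lborel. of_real (indicator Q x) * u x))\<^sup>2)"
    by this (rule that)
  have "ip.sq u \<le> \<delta> * en.sq u + \<rho>1 * C * (\<Sum>Q\<in>F. (norm (functional Q u))\<^sup>2)" if u: "u \<in> H1 S" for u
  proof -
    have uL2: "u \<in> L2 S" by (rule H1_D[OF u])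
    obtain u0 where u0: "u0 \<in> borel_measurable borel" "AE x in lborel. u0 x = (if x \<in> S then u x else 0)"
      using representative[OF L2_D(1)[OF uL2]] by (elim exE conjE)
    have "\<forall>i\<in>Basis. \<exists>g. g \<in> borel_measurable borel \<and> (AE x in lborel. g x = (if x \<in> S then weak_partial S i u x else 0))"
      using representative[OF L2_D(1)[OF weak_partial_D(1)[OF u]]] by blast
    from bchoice[OF this] obtain g where g: "\<forall>i\<in>Basis. g i \<in> borel_measurable borel \<and> (AE x in lborel. g i x = (if x \<in> S then weak_partial S i u x else 0))"
      by (elim exE)
    note rg = rep_properties[OF weak_partial_D(1)[OF u]]
    have wg: "weak_gradient S0 u0 g"
      unfolding weak_gradient_def
    proof (intro conjI ballI)
      show "integrable lborel u0" "integrable lborel (\<lambda>x. (norm (u0 x))\<^sup>2)" by (rule rep_properties[OF uL2 u0])+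
      fix i :: 'a assume i: "i \<in> Basis"
      have gi: "g i \<in> borel_measurable borel" "AE x in lborel. g i x = (if x \<in> S then weak_partial S i u x else 0)"
        using g i by blast+
      show "integrable lborel (g i)" "integrable lborel (\<lambda>x. (norm (g i x))\<^sup>2)" by (rule rg[OF i gi])+
      show "weak_directional S0 i u0 (g i)" by (rule weak_rep[OF uL2 u0 weak_partial_D(1)[OF u i] gi weak_partial_D(2)[OF u i]])
    qed
    have 1: "(LINT x|lborel. indicator S x * (norm (u0 x))\<^sup>2) = (LINT x|M. (norm (u x))\<^sup>2)"
    proof (rule transfer_integral(1)[symmetric])
      show "(\<lambda>x. (norm (u x))\<^sup>2) \<in> borel_measurable M" using L2_D(2)[OF uL2] by (rule borel_measurable_integrable)
      show "(\<lambda>x. indicator S x * (norm (u0 x))\<^sup>2) \<in> borel_measurable borel" using u0(1) S_borel by measurable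
      show "AE x in lborel. indicator S x * (norm (u0 x))\<^sup>2 = (if x \<in> S then (norm (u x))\<^sup>2 else 0)"
        using u0(2) by eventually_elim auto
    qed
    have 2: "(LINT x|lborel. of_real (indicator Q x) * u0 x) = functional Q u" if "Q \<in> F" for Q
      unfolding functional_def
    proof (rule transfer_integral(1)[symmetric])
      have Q: "indicator Q \<in> borel_measurable borel" using F(2) that by auto
      show "(\<lambda>x. of_real (indicator Q x) * u x) \<in> borel_measurable M"
        by (intro borel_measurable_times borel_measurable_of_real_fun borel_M Q L2_D(1)[OF uL2])
      show "(\<lambda>x. of_real (indicator Q x) * u0 x) \<in> borel_measurable borel"
        by (intro borel_measurable_times borel_measurable_of_real_fun Q u0(1))
      show "AE x in lborel. of_real (indicator Q x) * u0 x = (if x \<in> S then of_real (indicator Q x) * u x else 0)"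
        using u0(2) by eventually_elim auto
    qed
    have 3: "(LINT x|lborel. indicator S0 x * energy g x) \<le> en.sq u"
    proof -
      have "(LINT x|lborel. indicator S0 x * energy g x) \<le> (LINT x|lborel. energy g x)"
        using weak_gradient_integrable(1)[OF wg] S0(1)
        by (intro Bochner_Integration.integral_mono integrable_indicator_mult) (auto split: split_indicator)
      also have "\<dots> = (\<Sum>i\<in>Basis. LINT x|lborel. (norm (g i x))\<^sup>2)"
        unfolding energy_def using wg by (intro Bochner_Integration.integral_sum) (auto simp: weak_gradient_def)
      also have "\<dots> = (\<Sum>i\<in>Basis. LINT x|M. (norm (weak_partial S i u x))\<^sup>2)"
      proof (rule sum.cong[OF refl])
        fix i :: 'a assume i: "i \<in> Basis"
        have gi: "g i \<in> borel_measurable borel" "AE x in lborel. g i x = (if x \<in> S then weak_partial S i u x else 0)"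
          using g i by blast+
        show "(LINT x|lborel. (norm (g i x))\<^sup>2) = (LINT x|M. (norm (weak_partial S i u x))\<^sup>2)"
        proof (rule transfer_integral(1)[symmetric])
          show "(\<lambda>x. (norm (weak_partial S i u x))\<^sup>2) \<in> borel_measurable M"
            using L2_D(2)[OF weak_partial_D(1)[OF u i]] by (rule borel_measurable_integrable)
          show "(\<lambda>x. (norm (g i x))\<^sup>2) \<in> borel_measurable borel" using gi(1) by measurable
          show "AE x in lborel. (norm (g i x))\<^sup>2 = (if x \<in> S then (norm (weak_partial S i u x))\<^sup>2 else 0)"
            using gi(2) by eventually_elim auto
        qed
      qed
      also have "\<dots> = en.sq u" by (rule dirichlet_diag[OF u, symmetric])
      finally show ?thesis .
    qed
    have 4: "(\<Sum>Q\<in>F. (norm (LINT x|lborel. of_real (indicator Q x) * u0 x))\<^sup>2) = (\<Sum>Q\<in>F. (norm (functional Q u))\<^sup>2)"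
      by (rule sum.cong[OF refl]) (simp only: 2)
    have "ip.sq u \<le> \<rho>1 * (LINT x|M. (norm (u x))\<^sup>2)" by (rule ip_bounds(2)[OF uL2])
    also have "\<dots> \<le> \<rho>1 * (\<delta> / \<rho>1 * en.sq u + C * (\<Sum>Q\<in>F. (norm (functional Q u))\<^sup>2))"
    proof (rule mult_left_mono)
      have "\<delta> / \<rho>1 * (LINT x|lborel. indicator S0 x * energy g x) \<le> \<delta> / \<rho>1 * en.sq u"
        using 3 \<open>\<delta> / \<rho>1 > 0\<close> by (intro mult_left_mono) auto
      then show "(LINT x|M. (norm (u x))\<^sup>2) \<le> \<delta> / \<rho>1 * en.sq u + C * (\<Sum>Q\<in>F. (norm (functional Q u))\<^sup>2)"
        using F(4)[OF wg] unfolding 1 4 by linarith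
    qed (use \<rho>1 in simp)
    also have "\<dots> = \<delta> * en.sq u + \<rho>1 * C * (\<Sum>Q\<in>F. (norm (functional Q u))\<^sup>2)"
      using \<rho>1 by (simp add: distrib_left mult.assoc)
    finally show ?thesis .
  qed
  then show ?thesis using F(1,2) by (intro exI[of _ F] exI[of _ "\<rho>1 * C"]) blast
qed

text \<open>
  Suppose \<open>\<Lambda> k > \<mu>\<close>. The eigenfunctions for the eigenvalues up to \<open>\<mu>\<close>, indexed by the set \<open>J\<close>, number at
  most \<open>k\<close>, so some nontrivial combination \<open>w\<close> of the \<open>k + 1\<close> trial functions is orthogonal to them. The
  new eigenfunction \<open>u\<close> that it produces belongs to an eigenvalue up to \<open>\<mu>\<close>, hence is a combination of
  the listed ones almost everywhere, yet is orthogonal to them.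
\<close>
theorem eigenvalue_upper_bound:
  assumes \<Lambda>: "eigenvalue_sequence S \<rho> \<Lambda>" and \<mu>: "0 \<le> \<mu>"
    and v: "\<And>j. j \<in> {..k} \<Longrightarrow> v j \<in> H1 S"
    and orth: "\<And>i j. i \<in> {..k} \<Longrightarrow> j \<in> {..k} \<Longrightarrow> i \<noteq> j \<Longrightarrow> weighted_inner S \<rho> (v i) (v j) = 0"
      "\<And>i j. i \<in> {..k} \<Longrightarrow> j \<in> {..k} \<Longrightarrow> i \<noteq> j \<Longrightarrow> dirichlet_form S (v i) (v j) = 0"
    and pos: "\<And>j. j \<in> {..k} \<Longrightarrow> 0 < ip.sq (v j)"
    and le: "\<And>j. j \<in> {..k} \<Longrightarrow> en.sq (v j) \<le> \<mu> * ip.sq (v j)"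
  shows "\<Lambda> k \<le> \<mu>"
proof (rule ccontr)
  assume "\<not> \<Lambda> k \<le> \<mu>"
  then have big: "\<mu> < \<Lambda> k" by simp
  have mono: "mono \<Lambda>" and fin: "finite {j. \<Lambda> j = \<nu>}"
    and dim: "has_dim_ae M (eigenspace (neumann_op S \<rho>) (of_real \<nu>)) (card {j. \<Lambda> j = \<nu>})" for \<nu>
    using \<Lambda> unfolding eigenvalue_sequence_def by blast+
  define d where "d \<nu> = card {j. \<Lambda> j = \<nu>}" for \<nu>
  have "\<forall>\<nu>. \<exists>e :: nat \<Rightarrow> 'a \<Rightarrow> complex. (\<forall>j<d \<nu>. e j \<in> eigenspace (neumann_op S \<rho>) (of_real \<nu>)) \<and>
     (\<forall>u\<in>eigenspace (neumann_op S \<rho>) (of_real \<nu>). \<exists>c. AE x in M. u x = (\<Sum>j<d \<nu>. c j * e j x))"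
  proof
    fix \<nu>
    from dim[of \<nu>] show "\<exists>e :: nat \<Rightarrow> 'a \<Rightarrow> complex. (\<forall>j<d \<nu>. e j \<in> eigenspace (neumann_op S \<rho>) (of_real \<nu>)) \<and>
     (\<forall>u\<in>eigenspace (neumann_op S \<rho>) (of_real \<nu>). \<exists>c. AE x in M. u x = (\<Sum>j<d \<nu>. c j * e j x))"
      unfolding has_dim_ae_def d_def by (elim exE conjE) (intro exI conjI)
  qed
  from choice[OF this] obtain e :: "real \<Rightarrow> nat \<Rightarrow> 'a \<Rightarrow> complex" where
    e: "\<forall>\<nu>. (\<forall>j<d \<nu>. e \<nu> j \<in> eigenspace (neumann_op S \<rho>) (of_real \<nu>)) \<and>
     (\<forall>u\<in>eigenspace (neumann_op S \<rho>) (of_real \<nu>). \<exists>c. AE x in M. u x = (\<Sum>j<d \<nu>. c j * e \<nu> j x))"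
    by (elim exE)
  define N where "N = {j. \<Lambda> j \<le> \<mu>}"
  have N: "N \<subseteq> {..<k}"
  proof
    fix j assume "j \<in> N"
    then have "\<Lambda> j < \<Lambda> k" using big by (simp add: N_def)
    then have "\<not> k \<le> j" using monoD[OF mono, of k j] by auto
    then show "j \<in> {..<k}" by simp
  qed
  define J where "J = Sigma (\<Lambda> ` N) (\<lambda>\<nu>. {..<d \<nu>})"
  have finN: "finite N" by (rule finite_subset[OF N]) simp
  then have finJ: "finite J" by (auto simp: J_def)
  have "card J = (\<Sum>\<nu>\<in>\<Lambda> ` N. d \<nu>)" unfolding J_def using finN by (subst card_SigmaI) auto
  also have "\<dots> = card (\<Union>\<nu>\<in>\<Lambda> ` N. {j. \<Lambda> j = \<nu>})"
    unfolding d_def using finN fin by (intro card_UN_disjoint[symmetric]) auto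
  also have "(\<Union>\<nu>\<in>\<Lambda> ` N. {j. \<Lambda> j = \<nu>}) = N" by (auto simp: N_def)
  also have "card N \<le> k" using card_mono[OF _ N] by simp
  finally have cardJ: "card J < card {..k}" by simp
  define ee where "ee p = e (fst p) (snd p)" for p
  have ee_eig: "ee p \<in> H1 S" "\<forall>w\<in>H1 S. dirichlet_form S (ee p) w = of_real (fst p) * weighted_inner S \<rho> (ee p) w"
    if "p \<in> J" for p
  proof -
    have "ee p \<in> eigenspace (neumann_op S \<rho>) (of_real (fst p))"
      using e that unfolding ee_def J_def by auto
    then have 1: "ee p \<in> H1 S" "\<forall>w\<in>H1 S. dirichlet_form S (ee p) w = weighted_inner S \<rho> (\<lambda>x. of_real (fst p) * ee p x) w"
      unfolding eigenspace_def neumann_op_def by auto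
    show "ee p \<in> H1 S" by (rule 1(1))
    have "weighted_inner S \<rho> (\<lambda>x. of_real (fst p) * ee p x) w = of_real (fst p) * weighted_inner S \<rho> (ee p) w" for w
      unfolding weighted_inner_def by (simp add: mult.assoc)
    then show "\<forall>w\<in>H1 S. dirichlet_form S (ee p) w = of_real (fst p) * weighted_inner S \<rho> (ee p) w"
      using 1(2) by simp
  qed
  obtain c where c: "\<exists>j\<in>{..k}. c j \<noteq> 0" "\<forall>p\<in>J. (\<Sum>j\<in>{..k}. c j * weighted_inner S \<rho> (v j) (ee p)) = 0"
    using homogeneous_system_nontrivial[OF finJ finite_atMost cardJ, of "\<lambda>p j. weighted_inner S \<rho> (v j) (ee p)"]
    by (elim exE conjE)
  define w where "w x = (\<Sum>j\<in>{..k}. c j * v j x)" for x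
  have wH1: "w \<in> H1 S" unfolding w_def[abs_def] by (rule ip.sum_mem[OF finite_atMost v])
  have w_orth: "weighted_inner S \<rho> w (ee p) = 0" if "p \<in> J" for p
    unfolding w_def[abs_def] using ip.s_sum[of "{..k}" v "ee p" c, OF finite_atMost v ee_eig(1)[OF that]] c(2) that by simp
  have ipw: "ip.sq w = (\<Sum>j\<in>{..k}. (norm (c j))\<^sup>2 * ip.sq (v j))"
    unfolding w_def[abs_def] by (rule ip.sq_sum_orthogonal[OF finite_atMost v orth(1)])
  have enw: "en.sq w = (\<Sum>j\<in>{..k}. (norm (c j))\<^sup>2 * en.sq (v j))"
    unfolding w_def[abs_def] by (rule en.sq_sum_orthogonal[OF finite_atMost v orth(2)])
  have w_pos: "0 < ip.sq w"
  proof -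
    obtain j0 where j0: "j0 \<in> {..k}" "c j0 \<noteq> 0" using c(1) by blast
    have "0 < (norm (c j0))\<^sup>2 * ip.sq (v j0)" using j0 pos by simp
    also have "\<dots> \<le> ip.sq w" unfolding ipw
      using j0 pos by (intro member_le_sum[where f = "\<lambda>j. (norm (c j))\<^sup>2 * ip.sq (v j)"]) (auto simp: less_imp_le)
    finally show ?thesis .
  qed
  have w_le: "en.sq w \<le> \<mu> * ip.sq w"
    unfolding ipw enw sum_distrib_left
  proof (rule sum_mono)
    fix j assume "j \<in> {..k}"
    from mult_left_mono[OF le[OF this], of "(norm (c j))\<^sup>2"]
    show "(norm (c j))\<^sup>2 * en.sq (v j) \<le> \<mu> * ((norm (c j))\<^sup>2 * ip.sq (v j))" by (simp add: mult_ac)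
  qed
  \<comment> \<open>small enough for the minimisation, which needs \<open>\<delta> * \<mu> < 1\<close>\<close>
  define \<delta> where "\<delta> = 1 / (\<mu> + 1)"
  have \<delta>: "\<delta> > 0" "\<delta> * \<mu> < 1" using \<mu> by (simp_all add: \<delta>_def)
  obtain F C where F: "finite F" "F \<subseteq> sets borel"
    "\<forall>u\<in>H1 S. ip.sq u \<le> \<delta> * en.sq u + C * (\<Sum>Q\<in>F. (norm (functional Q u))\<^sup>2)"
    using coercivity[OF \<delta>(1)] by (elim exE conjE)
  have "\<exists>\<nu> u. \<nu> \<le> \<mu> \<and> u \<in> H1 S \<and> ip.sq u = 1 \<and> (\<forall>p\<in>J. weighted_inner S \<rho> u (ee p) = 0) \<and>
    (\<forall>w\<in>H1 S. dirichlet_form S u w = of_real \<nu> * weighted_inner S \<rho> u w)"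
  proof (rule exists_new_eigenvector[where J = J and e = ee and ev = fst and v = w and L = F and l = functional
        and K = "measure lebesgue S / \<rho>0" and \<delta> = \<delta> and C = C])
    show "finite J" by (rule finJ)
    show "ee p \<in> H1 S" if "p \<in> J" for p by (rule ee_eig(1)[OF that])
    show "dirichlet_form S (ee p) w = of_real (fst p) * weighted_inner S \<rho> (ee p) w" if "p \<in> J" "w \<in> H1 S" for p w
      using ee_eig(2)[OF that(1)] that(2) by blast
    show "w \<in> H1 S" "0 < ip.sq w" "en.sq w \<le> \<mu> * ip.sq w" by (rule wH1 w_pos w_le)+
    show "weighted_inner S \<rho> w (ee p) = 0" if "p \<in> J" for p by (rule w_orth[OF that])
    show "finite F" by (rule F(1))
    show "functional Q (\<lambda>x. u x - w x) = functional Q u - functional Q w" if "Q \<in> F" "u \<in> H1 S" "w \<in> H1 S" for Q u w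
      using functional_diff[OF _ that(2,3)] F(2) that(1) by blast
    show "(norm (functional Q u))\<^sup>2 \<le> measure lebesgue S / \<rho>0 * ip.sq u" if "Q \<in> F" "u \<in> H1 S" for Q u
      using functional_bound[OF _ that(2)] F(2) that(1) by blast
    show "ip.sq u \<le> \<delta> * en.sq u + C * (\<Sum>Q\<in>F. (norm (functional Q u))\<^sup>2)" if "u \<in> H1 S" for u
      using F(3) that by blast
    show "0 \<le> \<delta>" "\<delta> * \<mu> < 1" using \<delta> by auto
  qed
  then obtain \<nu> u where u: "\<nu> \<le> \<mu>" "u \<in> H1 S" "ip.sq u = 1" "\<forall>p\<in>J. weighted_inner S \<rho> u (ee p) = 0"
    "\<forall>w\<in>H1 S. dirichlet_form S u w = of_real \<nu> * weighted_inner S \<rho> u w"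
    by (elim exE conjE)
  have "u \<in> eigenspace (neumann_op S \<rho>) (of_real \<nu>)"
    unfolding eigenspace_def neumann_op_def
  proof (intro CollectI case_prodI conjI ballI)
    show "u \<in> H1 S" by (rule u(2))
    show "(\<lambda>x. complex_of_real \<nu> * u x) \<in> L2 S"
      using L2_lincomb[OF zero_in_L2 H1_D[OF u(2)], of "of_real \<nu>"] by simp
    fix w assume "w \<in> H1 S"
    then have "dirichlet_form S u w = of_real \<nu> * weighted_inner S \<rho> u w" using u(5) by blast
    then show "dirichlet_form S u w = weighted_inner S \<rho> (\<lambda>x. of_real \<nu> * u x) w"
      unfolding weighted_inner_def by (simp add: mult.assoc)
  qed
  then obtain c where c: "AE x in M. u x = (\<Sum>j<d \<nu>. c j * e \<nu> j x)" using e by blast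
  have inJ: "(\<nu>, j) \<in> J" if "j < d \<nu>" for j
  proof -
    have "{j. \<Lambda> j = \<nu>} \<noteq> {}" using that unfolding d_def by (metis card.empty not_less0)
    then have "\<nu> \<in> \<Lambda> ` N" using u(1) by (auto simp: N_def)
    then show ?thesis using that by (simp add: J_def)
  qed
  define p where "p x = (\<Sum>j\<in>{..<d \<nu>}. c j * e \<nu> j x)" for x
  have eH1: "e \<nu> j \<in> H1 S" if "j \<in> {..<d \<nu>}" for j
    using ee_eig(1)[OF inJ, of j] that by (simp add: ee_def)
  have pH1: "p \<in> H1 S" unfolding p_def[abs_def] by (rule ip.sum_mem[OF finite_lessThan eH1])
  have "weighted_inner S \<rho> u p = 0"
  proof -
    have "weighted_inner S \<rho> u p = (\<Sum>j\<in>{..<d \<nu>}. cnj (c j) * weighted_inner S \<rho> u (e \<nu> j))"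
      unfolding p_def[abs_def] by (rule ip.s_sum_right[OF finite_lessThan eH1 u(2)])
    also have "\<dots> = 0"
      using u(4) inJ by (intro sum.neutral) (force simp: ee_def)
    finally show ?thesis .
  qed
  moreover have "weighted_inner S \<rho> u u = weighted_inner S \<rho> u p"
    unfolding weighted_inner_def
  proof (rule integral_cong_AE)
    have "\<rho> \<in> borel_measurable M" by (rule borel_M[OF \<rho>_borel])
    then show "(\<lambda>x. u x * cnj (u x) * of_real (\<rho> x)) \<in> borel_measurable M" "(\<lambda>x. u x * cnj (p x) * of_real (\<rho> x)) \<in> borel_measurable M"
      using L2_D(1)[OF H1_D[OF u(2)]] L2_D(1)[OF H1_D[OF pH1]]
      by (auto intro!: borel_measurable_times borel_measurable_of_real_fun borel_measurable_cnj_fun)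
    show "AE x in M. u x * cnj (u x) * of_real (\<rho> x) = u x * cnj (p x) * of_real (\<rho> x)"
      using c by eventually_elim (simp add: p_def)
  qed
  ultimately show False using u(3) by simp
qed

end

section \<open>The number of rooms\<close>

text \<open>
  If the boundary contains a piece of the hyperplane orthogonal to \<open>w\<close> near \<open>p\<close>, then this piece is part
  of the graph of \<open>\<phi>\<close>. The epigraph direction \<open>e\<close> points to the side of \<open>S\<close>, so each nearby point on that
  side lies above a point of the piece in direction \<open>e\<close>, hence in the epigraph.
\<close>
lemma lipschitz_flat_boundary:
  fixes S :: "'a::euclidean_space set"
  assumes S: "open S" and lip: "lipschitz_boundary S" and half: "S \<subseteq> {x. 0 < x \<bullet> w}"
    and p: "p \<bullet> w = 0" and \<rho>: "\<rho> > 0" and flat: "\<And>y. y \<in> ball p \<rho> \<Longrightarrow> y \<bullet> w = 0 \<Longrightarrow> y \<in> frontier S"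
  shows "\<exists>r>0. \<forall>x\<in>ball p r. 0 < x \<bullet> w \<longrightarrow> x \<in> S"
proof -
  have "p \<in> frontier S" using flat[of p] p \<rho> by simp
  then obtain r e L \<phi> where r: "r > 0" and e: "norm e = 1" and L: "L-lipschitz_on {y. y \<bullet> e = 0} \<phi>"
    and eq: "S \<inter> ball p r = {x \<in> ball p r. \<phi> (x - (x \<bullet> e) *\<^sub>R e) < x \<bullet> e}"
    using lip unfolding lipschitz_boundary_def by blast
  have ee: "e \<bullet> e = 1" using e by (simp add: dot_square_norm)
  define H where "H x = \<phi> (x - (x \<bullet> e) *\<^sub>R e)" for x
  have cont: "continuous_on UNIV H" unfolding H_def[abs_def]
    by (rule continuous_on_compose2[OF lipschitz_on_continuous_on[OF L]])
      (auto intro!: continuous_intros simp: inner_diff_left ee)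
  have H_shift: "H (x + t *\<^sub>R e) = H x" for x t
    unfolding H_def by (simp add: inner_add_left ee scaleR_add_left)
  have mem: "x \<in> S \<longleftrightarrow> H x < x \<bullet> e" if "x \<in> ball p r" for x
    using eq that unfolding H_def by blast
  have graph: "H x = x \<bullet> e" if "x \<in> frontier S" "x \<in> ball p r" for x
  proof (rule antisym)
    have "closed {x. H x \<le> x \<bullet> e}" by (intro closed_Collect_le cont continuous_intros)
    moreover have "S \<inter> ball p r \<subseteq> {x. H x \<le> x \<bullet> e}" using mem by auto
    ultimately have "closure (S \<inter> ball p r) \<subseteq> {x. H x \<le> x \<bullet> e}" by (rule closure_minimal[rotated])
    moreover have "x \<in> closure (S \<inter> ball p r)"
      using that open_Int_closure_subset[of "ball p r" S] by (auto simp: frontier_def Int_commute)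
    ultimately show "H x \<le> x \<bullet> e" by blast
    have "x \<notin> S" using that(1) S by (simp add: frontier_def interior_open)
    then show "x \<bullet> e \<le> H x" using mem[OF that(2)] by simp
  qed
  have ew: "e \<bullet> w > 0"
  proof -
    have "p + (r / 2) *\<^sub>R e \<in> ball p r" using r e by (simp add: dist_norm)
    moreover have "H (p + (r / 2) *\<^sub>R e) < (p + (r / 2) *\<^sub>R e) \<bullet> e"
      using graph[OF \<open>p \<in> frontier S\<close>] r by (simp add: H_shift inner_add_left ee)
    ultimately have "p + (r / 2) *\<^sub>R e \<in> S" using mem by blast
    then have "0 < (p + (r / 2) *\<^sub>R e) \<bullet> w" using half by blast
    then show ?thesis using p r by (simp add: inner_add_left zero_less_mult_iff)
  qed
  define c where "c = 1 + norm w / (e \<bullet> w)"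
  have c: "c \<ge> 1" using ew by (simp add: c_def)
  show ?thesis
  proof (intro exI[of _ "min r \<rho> / c"] conjI ballI impI)
    show "0 < min r \<rho> / c" using r \<rho> c by simp
    fix x assume x: "x \<in> ball p (min r \<rho> / c)" and xw: "0 < x \<bullet> w"
    have x_lt: "norm (x - p) * c < min r \<rho>"
      using x c by (simp add: dist_norm norm_minus_commute pos_less_divide_eq)
    have "norm (x - p) \<le> norm (x - p) * c" using c mult_left_mono[of 1 c "norm (x - p)"] by simp
    then have x_ball: "x \<in> ball p r" using x_lt by (simp add: dist_norm norm_minus_commute)
    define t where "t = (x \<bullet> w) / (e \<bullet> w)"
    have t: "t > 0" using xw ew by (simp add: t_def)
    define y where "y = x + (- t) *\<^sub>R e"
    have yw: "y \<bullet> w = 0" using ew by (simp add: y_def t_def inner_diff_left)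
    have "x \<bullet> w \<le> norm (x - p) * norm w"
      using norm_cauchy_schwarz[of "x - p" w] p by (simp add: inner_diff_left)
    then have "t \<le> norm (x - p) * (norm w / (e \<bullet> w))"
      using divide_right_mono[of "x \<bullet> w" _ "e \<bullet> w"] ew by (simp add: t_def)
    moreover have "norm (y - p) \<le> norm (x - p) + t"
      using norm_triangle_ineq4[of "x - p" "t *\<^sub>R e"] e t by (simp add: y_def algebra_simps)
    ultimately have "norm (y - p) < min r \<rho>" using x_lt by (simp add: c_def distrib_left)
    then have y: "y \<in> ball p r" "y \<in> ball p \<rho>" by (auto simp: dist_norm norm_minus_commute)
    have "H y = y \<bullet> e" by (rule graph[OF flat[OF y(2) yw] y(1)])
    then have "H x = x \<bullet> e - t" unfolding y_def H_shift by (simp add: inner_diff_left ee)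
    then show "x \<in> S" using mem[OF x_ball] t by simp
  qed
qed

text \<open>
  Going down from a point of the set, one meets the boundary strictly below the hyperplane.
\<close>
lemma nonflat_frontier_nonempty:
  fixes \<Omega> :: "((real ^ 'm) \<times> real) set"
  assumes "\<Omega> \<noteq> {}" "bounded \<Omega>" "\<Omega> \<subseteq> {x. snd x < 0}"
  shows "frontier \<Omega> - flat_part \<Omega> \<noteq> {}"
proof -
  obtain x where x: "x \<in> \<Omega>" using assms by blast
  obtain M where M: "\<And>y. y \<in> \<Omega> \<Longrightarrow> norm y \<le> M" using assms(2) by (auto simp: bounded_iff)
  have M0: "M \<ge> 0" using M[OF x] norm_ge_zero order_trans by blast
  define y where "y = x - (0, M + 1)"
  have sx: "snd x < 0" using x assms(3) by blast
  have "norm y \<ge> \<bar>snd y\<bar>" using norm_snd_le[of "snd y" "fst y"] by simp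
  then have "norm y > M" using sx M0 by (simp add: y_def)
  then have y: "y \<notin> \<Omega>" using M[of y] by auto
  have "closed_segment x y \<inter> frontier \<Omega> \<noteq> {}"
    using x y by (intro connected_Int_frontier) (auto simp: convex_connected)
  then obtain z where z: "z \<in> closed_segment x y" "z \<in> frontier \<Omega>" by blast
  obtain u where u: "0 \<le> u" "u \<le> 1" "z = (1 - u) *\<^sub>R x + u *\<^sub>R y" using z(1) by (auto simp: in_segment)
  have "snd z = snd x - u * (M + 1)" unfolding u(3) y_def by (simp add: algebra_simps)
  then have "snd z < 0" using sx u M0 mult_nonneg_nonneg[of u "M + 1"] by linarith
  then show ?thesis using z(2) by (auto simp: flat_part_def)
qed

text \<open>
  Around an interior point \<open>x0\<close> of the flat part, the rest of the boundary stays at a fixed distance,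
  so every lattice point close enough to \<open>x0\<close> carries a room once \<open>\<epsilon>\<close> is small. The lattice points
  chosen are those at steps \<open>0, \<dots>, k\<close> along the diagonal, starting from the cell of \<open>x0\<close>.
\<close>
lemma many_rooms:
  fixes \<Omega> :: "((real ^ 'm) \<times> real) set"
  assumes \<Omega>: "open \<Omega>" "bounded \<Omega>" "lipschitz_boundary \<Omega>" "\<Omega> \<subseteq> {x. snd x < 0}"
    and \<Gamma>: "interior {x'. (x', 0) \<in> flat_part \<Omega>} \<noteq> {}"
  shows "\<forall>\<^sub>F \<epsilon> in at_right 0. \<exists>\<iota> :: nat \<Rightarrow> int ^ 'm. inj_on \<iota> {..k} \<and> \<iota> ` {..k} \<subseteq> room_indices \<Omega> \<epsilon>"
proof -
  obtain x0 \<rho> where \<rho>: "\<rho> > 0" "ball x0 \<rho> \<subseteq> {x'. (x', 0) \<in> flat_part \<Omega>}"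
    using \<Gamma> by (auto simp: mem_interior)
  define p :: "(real ^ 'm) \<times> real" where "p = (x0, 0)"
  define w :: "(real ^ 'm) \<times> real" where "w = (0, - 1)"
  have iw: "x \<bullet> w = - snd x" for x by (simp add: w_def inner_prod_def)
  have flat: "y \<in> frontier \<Omega>" if "y \<in> ball p \<rho>" "y \<bullet> w = 0" for y
  proof -
    have "dist x0 (fst y) < \<rho>" using that(1) dist_fst_le[of p y] by (simp add: p_def)
    then have "(fst y, 0) \<in> flat_part \<Omega>" using \<rho>(2) by auto
    moreover have "y = (fst y, 0)" using that(2) iw by (simp add: prod_eq_iff)
    ultimately show ?thesis by (simp add: flat_part_def)
  qed
  have "\<exists>r>0. \<forall>x\<in>ball p r. 0 < x \<bullet> w \<longrightarrow> x \<in> \<Omega>"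
  proof (rule lipschitz_flat_boundary[OF \<Omega>(1,3) _ _ \<rho>(1)])
    show "\<Omega> \<subseteq> {x. 0 < x \<bullet> w}" using \<Omega>(4) by (auto simp: iw)
    show "p \<bullet> w = 0" by (simp add: iw p_def)
  qed (rule flat)
  then obtain r where r: "r > 0" "\<forall>x\<in>ball p r. 0 < x \<bullet> w \<longrightarrow> x \<in> \<Omega>" by blast
  have "p \<in> frontier \<Omega>" using flat[of p] \<rho>(1) iw by (simp add: p_def)
  then have "\<Omega> \<noteq> {}" by auto
  then have ne: "frontier \<Omega> - flat_part \<Omega> \<noteq> {}" by (rule nonflat_frontier_nonempty[OF _ \<Omega>(2,4)])
  have cl: "snd x \<le> 0" if "x \<in> closure \<Omega>" for x
  proof -
    have "closed {x :: (real ^ 'm) \<times> real. snd x \<le> 0}" by (intro closed_Collect_le continuous_intros)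
    then have "closure \<Omega> \<subseteq> {x. snd x \<le> 0}" using \<Omega>(4) by (intro closure_minimal) auto
    then show ?thesis using that by blast
  qed
  have far: "r \<le> dist p y" if "y \<in> frontier \<Omega> - flat_part \<Omega>" for y
  proof (rule ccontr)
    assume "\<not> r \<le> dist p y"
    then have "y \<in> ball p r" by simp
    have "y \<notin> \<Omega>" using that \<Omega>(1) by (auto simp: frontier_def interior_open)
    then have "\<not> 0 < y \<bullet> w" using r(2) \<open>y \<in> ball p r\<close> by blast
    moreover have "snd y \<le> 0" using that cl by (auto simp: frontier_def)
    ultimately have "snd y = 0" by (simp add: iw)
    then show False using that by (simp add: flat_part_def)
  qed
  define s where "s = min r \<rho>"
  have s: "s > 0" using r \<rho> by (simp add: s_def)
  define m where "m = real CARD('m)"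
  have ev1: "\<forall>\<^sub>F \<epsilon> in at_right 0. \<epsilon> * (m * (real k + 1)) < s / 2"
  proof (rule order_tendstoD(2))
    show "((\<lambda>\<epsilon>. \<epsilon> * (m * (real k + 1))) \<longlongrightarrow> 0 * (m * (real k + 1))) (at_right 0)" by (intro tendsto_intros)
  qed (use s in simp)
  have ev2: "\<forall>\<^sub>F \<epsilon> in at_right 0. \<epsilon> * sqrt (real (CARD('m) + 1)) / 2 < s / 2"
  proof (rule order_tendstoD(2))
    show "((\<lambda>\<epsilon>. \<epsilon> * sqrt (real (CARD('m) + 1)) / 2) \<longlongrightarrow> 0 * sqrt (real (CARD('m) + 1)) / 2) (at_right 0)"
      by (intro tendsto_intros) simp
  qed (use s in simp)
  show ?thesis
    using ev1 ev2 eventually_at_right_less[of 0]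
  proof eventually_elim
    case (elim \<epsilon>)
    define \<iota> :: "nat \<Rightarrow> int ^ 'm" where "\<iota> l = (\<chi> j. \<lfloor>x0 $ j / \<epsilon>\<rfloor> + int l)" for l
    have "inj_on \<iota> {..k}"
      by (rule inj_onI) (auto simp: \<iota>_def vec_eq_iff)
    moreover have "\<iota> l \<in> room_indices \<Omega> \<epsilon>" if l: "l \<in> {..k}" for l
    proof -
      define z where "z = lattice_point \<epsilon> (\<iota> l)"
      have comp: "\<bar>(z - x0) $ j\<bar> \<le> \<epsilon> * (real k + 1)" for j
      proof -
        have f: "x0 $ j / \<epsilon> - 1 \<le> of_int \<lfloor>x0 $ j / \<epsilon>\<rfloor>" "of_int \<lfloor>x0 $ j / \<epsilon>\<rfloor> \<le> x0 $ j / \<epsilon>" by linarith+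
        note mult_left_mono[OF f(1) less_imp_le[OF elim(3)]] mult_left_mono[OF f(2) less_imp_le[OF elim(3)]]
        moreover have "\<epsilon> * (x0 $ j / \<epsilon>) = x0 $ j" using elim(3) by simp
        ultimately have 1: "x0 $ j - \<epsilon> \<le> \<epsilon> * of_int \<lfloor>x0 $ j / \<epsilon>\<rfloor>" "\<epsilon> * of_int \<lfloor>x0 $ j / \<epsilon>\<rfloor> \<le> x0 $ j"
          unfolding right_diff_distrib by linarith+
        have 2: "0 \<le> \<epsilon> * real l" "\<epsilon> * real l \<le> \<epsilon> * real k" using l elim by auto
        have 3: "z $ j = \<epsilon> * of_int \<lfloor>x0 $ j / \<epsilon>\<rfloor> + \<epsilon> * real l"
          by (simp add: z_def lattice_point_def \<iota>_def distrib_left)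
        show ?thesis using 1 2 elim(3) unfolding vector_minus_component 3 distrib_left by linarith
      qed
      have "norm (z - x0) \<le> (\<Sum>j\<in>UNIV. \<bar>(z - x0) $ j\<bar>)" by (rule norm_le_l1_cart)
      also have "\<dots> \<le> m * (\<epsilon> * (real k + 1))"
        using sum_bounded_above[of UNIV "\<lambda>j. \<bar>(z - x0) $ j\<bar>" "\<epsilon> * (real k + 1)"] comp by (simp add: m_def)
      also have "\<dots> < s / 2" using elim(1) by (simp add: mult_ac)
      finally have nz: "norm (z - x0) < s / 2" .
      have "z \<in> ball x0 \<rho>" using nz s by (simp add: dist_norm norm_minus_commute s_def)
      then have 1: "(z, 0) \<in> flat_part \<Omega>" using \<rho>(2) by blast
      have dz: "dist p (z, 0) < s / 2" using nz by (simp add: p_def dist_Pair_Pair dist_norm norm_minus_commute)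
      have "s / 2 \<le> infdist (z, 0) (frontier \<Omega> - flat_part \<Omega>)"
        unfolding infdist_notempty[OF ne]
      proof (rule cINF_greatest[OF ne])
        fix y assume y: "y \<in> frontier \<Omega> - flat_part \<Omega>"
        have "s \<le> dist p y" using far[OF y] by (simp add: s_def)
        also have "\<dots> \<le> dist p (z, 0) + dist (z, 0) y" by (rule dist_triangle)
        finally show "s / 2 \<le> dist (z, 0) y" using dz by linarith
      qed
      then show ?thesis using 1 elim(2) by (simp add: room_indices_def z_def)
    qed
    ultimately show "\<exists>\<iota> :: nat \<Rightarrow> int ^ 'm. inj_on \<iota> {..k} \<and> \<iota> ` {..k} \<subseteq> room_indices \<Omega> \<epsilon>"
      by (intro exI[of _ \<iota>]) auto
  qed
qed

section \<open>The perturbed domain\<close>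

text \<open>
  The geometry at a single value of \<open>\<epsilon>\<close>.
\<close>
locale rooms_and_passages =
  fixes \<Omega> B :: "((real ^ 'm) \<times> real) set" and D :: "(real ^ 'm) set" and R \<epsilon> b d h \<sigma> :: real
  assumes \<Omega>: "open \<Omega>" "bounded \<Omega>" "lipschitz_boundary \<Omega>" "\<Omega> \<subseteq> {x. snd x < 0}"
    and B: "open B" "bounded B" "lipschitz_boundary B" "B \<noteq> {}"
      "B \<subseteq> {x. (\<forall>j. - (1 / 2) < fst x $ j \<and> fst x $ j < 1 / 2) \<and> 0 < snd x}"
    and D: "open D" "bounded D" "lipschitz_boundary D" "D \<subseteq> {x'. norm x' < R}"
    and R: "R < 1 / 2"
    and pos: "0 < b" "0 < d" "0 < h" "0 < \<sigma>" and le: "d \<le> b" "b \<le> \<epsilon>"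
begin

abbreviation I where "I \<equiv> room_indices \<Omega> \<epsilon>"
abbreviation S where "S \<equiv> perturbed_domain \<Omega> B D \<epsilon> b d h"
abbreviation \<rho> where "\<rho> \<equiv> mass_density \<Omega> B \<epsilon> b h \<sigma>"
abbreviation room_at where "room_at \<equiv> room B \<epsilon> b h"
abbreviation passage_at where "passage_at \<equiv> passage D \<epsilon> d h"

definition open_passage :: "int ^ 'm \<Rightarrow> ((real ^ 'm) \<times> real) set" where
  "open_passage i = {x. (1 / d) *\<^sub>R (fst x - lattice_point \<epsilon> i) \<in> D \<and> 0 < snd x \<and> snd x < h}"

text \<open>
  The open column over the cell of the lattice around the point with index \<open>i\<close>. Distinct columns are
  disjoint, and the part of the domain in the upper half-space is contained in them.
\<close>
definition column :: "int ^ 'm \<Rightarrow> ((real ^ 'm) \<times> real) set" where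
  "column i = {x. \<forall>j. \<bar>fst x $ j - \<epsilon> * of_int (i $ j)\<bar> < \<epsilon> / 2}"

text \<open>
  The union of the three kinds of open sets with inward translations, without the mouths of the
  passages, which lie in two hyperplanes.
\<close>
definition core :: "((real ^ 'm) \<times> real) set" where
  "core = \<Omega> \<union> (\<Union>i\<in>I. open_passage i \<union> room_at i)"

lemma \<epsilon>_pos: "0 < \<epsilon>"
  using pos le by linarith

lemma room_in_column: "x \<in> room_at i \<Longrightarrow> x \<in> column i \<and> h < snd x"
proof -
  assume "x \<in> room_at i"
  then have y: "(1 / b) *\<^sub>R (x - (lattice_point \<epsilon> i, 0) - (0, h)) \<in> B" by (simp add: room_def)
  have 1: "- (1 / 2) < (1 / b) * (fst x $ j - \<epsilon> * of_int (i $ j)) \<and> (1 / b) * (fst x $ j - \<epsilon> * of_int (i $ j)) < 1 / 2" for j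
    using subsetD[OF B(5) y] by (simp add: lattice_point_def)
  have 2: "0 < (1 / b) * (snd x - h)" using subsetD[OF B(5) y] by simp
  have "\<bar>fst x $ j - \<epsilon> * of_int (i $ j)\<bar> < \<epsilon> / 2" for j
  proof -
    have "- (b / 2) < fst x $ j - \<epsilon> * of_int (i $ j) \<and> fst x $ j - \<epsilon> * of_int (i $ j) < b / 2"
      using 1[of j] pos(1) by (simp add: field_simps)
    then show ?thesis using le by linarith
  qed
  moreover have "h < snd x" using 2 pos(1) by (simp add: zero_less_divide_iff)
  ultimately show ?thesis by (simp add: column_def)
qed

lemma passage_in_column: "(1 / d) *\<^sub>R (fst x - lattice_point \<epsilon> i) \<in> D \<Longrightarrow> x \<in> column i"
proof -
  assume "(1 / d) *\<^sub>R (fst x - lattice_point \<epsilon> i) \<in> D"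
  then have "norm ((1 / d) *\<^sub>R (fst x - lattice_point \<epsilon> i)) < R" using D(4) by blast
  then have n: "norm (fst x - lattice_point \<epsilon> i) < d * R" using pos(2) by (simp add: pos_divide_less_eq mult.commute)
  have "d * R \<le> d * (1 / 2)" using R pos(2) by (intro mult_left_mono) auto
  then have n2: "norm (fst x - lattice_point \<epsilon> i) < \<epsilon> / 2" using n le by linarith
  have "\<bar>fst x $ j - \<epsilon> * of_int (i $ j)\<bar> < \<epsilon> / 2" for j
    using component_le_norm_cart[of "fst x - lattice_point \<epsilon> i" j] n2 by (simp add: lattice_point_def)
  then show ?thesis by (simp add: column_def)
qed

lemma columns_disjoint: "x \<in> column i \<Longrightarrow> x \<in> column k \<Longrightarrow> i = k"
proof -
  assume x: "x \<in> column i" "x \<in> column k"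
  have "i $ j = k $ j" for j
  proof -
    have "\<bar>fst x $ j - \<epsilon> * of_int (i $ j)\<bar> < \<epsilon> / 2" "\<bar>fst x $ j - \<epsilon> * of_int (k $ j)\<bar> < \<epsilon> / 2"
      using x by (auto simp: column_def)
    then have "\<bar>\<epsilon> * of_int (i $ j) - \<epsilon> * of_int (k $ j)\<bar> < \<epsilon>" by linarith
    then have "\<epsilon> * \<bar>of_int (i $ j - k $ j)\<bar> < \<epsilon> * 1"
      using \<epsilon>_pos by (simp add: abs_mult flip: right_diff_distrib)
    then have "\<bar>of_int (i $ j - k $ j) :: real\<bar> < 1" using \<epsilon>_pos by (simp only: mult_less_cancel_left_pos)
    then show ?thesis by linarith
  qed
  then show ?thesis by (simp add: vec_eq_iff)
qed

lemma open_column: "open (column i)"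
proof -
  have "column i = (\<Inter>j. {x. \<bar>fst x $ j - \<epsilon> * of_int (i $ j)\<bar> < \<epsilon> / 2})" by (auto simp: column_def)
  moreover have "open {x :: (real ^ 'm) \<times> real. \<bar>fst x $ j - \<epsilon> * of_int (i $ j)\<bar> < \<epsilon> / 2}" for j
    by (intro open_Collect_less continuous_intros)
  ultimately show ?thesis by auto
qed

lemma upper_part: "x \<in> S \<Longrightarrow> 0 \<le> snd x \<Longrightarrow> \<exists>k. x \<in> column k"
proof -
  assume x: "x \<in> S" "0 \<le> snd x"
  then have "x \<notin> \<Omega>" using \<Omega>(4) by auto
  then obtain k where "x \<in> passage_at k \<or> x \<in> room_at k" using x(1) unfolding perturbed_domain_def by blast
  then have "x \<in> column k" using passage_in_column[of x k] room_in_column[of x k] unfolding passage_def by blast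
  then show ?thesis by blast
qed

lemma finite_I: "finite I"
proof -
  have "bounded (closure \<Omega>)" using \<Omega>(2) by (rule bounded_closure)
  then obtain M where M: "\<And>x. x \<in> closure \<Omega> \<Longrightarrow> norm x \<le> M" by (auto simp: bounded_iff)
  define N where "N = \<lceil>M / \<epsilon>\<rceil>"
  have "I \<subseteq> (\<lambda>f. \<chi> j. f j) ` {f. \<forall>j. (j \<in> (UNIV :: 'm set) \<longrightarrow> f j \<in> {- N..N}) \<and> (j \<notin> UNIV \<longrightarrow> f j = 0)}"
  proof
    fix i assume "i \<in> I"
    then have "(lattice_point \<epsilon> i, 0) \<in> closure \<Omega>"
      by (simp add: room_indices_def flat_part_def frontier_def)
    then have "norm (lattice_point \<epsilon> i, 0 :: real) \<le> M" by (rule M)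
    then have n: "norm (lattice_point \<epsilon> i) \<le> M" using norm_fst_le[of "lattice_point \<epsilon> i" "0::real"] by linarith
    have "i $ j \<in> {- N..N}" for j
    proof -
      have "\<bar>lattice_point \<epsilon> i $ j\<bar> \<le> M" using component_le_norm_cart[of "lattice_point \<epsilon> i" j] n by linarith
      then have "\<bar>of_int (i $ j)\<bar> * \<epsilon> \<le> M" using \<epsilon>_pos by (simp add: lattice_point_def abs_mult mult.commute)
      then have "\<bar>of_int (i $ j)\<bar> \<le> M / \<epsilon>" using \<epsilon>_pos by (simp add: pos_le_divide_eq)
      then have "\<bar>of_int (i $ j)\<bar> \<le> real_of_int N" unfolding N_def by linarith
      then show ?thesis by auto
    qed
    then show "i \<in> (\<lambda>f. \<chi> j. f j) ` {f. \<forall>j. (j \<in> (UNIV :: 'm set) \<longrightarrow> f j \<in> {- N..N}) \<and> (j \<notin> UNIV \<longrightarrow> f j = 0)}"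
      by (intro image_eqI[of _ _ "\<lambda>j. i $ j"]) (auto simp: vec_eq_iff)
  qed
  then show ?thesis by (rule finite_subset) (intro finite_imageI finite_set_of_finite_funs; simp)
qed

lemma room_image: "room_at i = (\<lambda>x. (lattice_point \<epsilon> i, h) + x) ` ((\<lambda>x. b *\<^sub>R x) ` B)"
proof -
  have "x \<in> room_at i \<longleftrightarrow> x \<in> (\<lambda>x. (lattice_point \<epsilon> i, h) + x) ` ((\<lambda>x. b *\<^sub>R x) ` B)" for x
  proof
    assume "x \<in> room_at i"
    then have "(1 / b) *\<^sub>R (x - (lattice_point \<epsilon> i, 0) - (0, h)) \<in> B" by (simp add: room_def)
    moreover have "x = (lattice_point \<epsilon> i, h) + b *\<^sub>R ((1 / b) *\<^sub>R (x - (lattice_point \<epsilon> i, 0) - (0, h)))"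
      using pos(1) by (simp add: prod_eq_iff)
    ultimately show "x \<in> (\<lambda>x. (lattice_point \<epsilon> i, h) + x) ` ((\<lambda>x. b *\<^sub>R x) ` B)" by blast
  next
    assume "x \<in> (\<lambda>x. (lattice_point \<epsilon> i, h) + x) ` ((\<lambda>x. b *\<^sub>R x) ` B)"
    then obtain y where y: "y \<in> B" "x = (lattice_point \<epsilon> i, h) + b *\<^sub>R y" by blast
    have "(1 / b) *\<^sub>R (x - (lattice_point \<epsilon> i, 0) - (0, h)) = y"
      using pos(1) by (simp add: y(2) prod_eq_iff)
    then show "x \<in> room_at i" using y(1) by (simp add: room_def)
  qed
  then show ?thesis by blast
qed

definition passage_base :: "int ^ 'm \<Rightarrow> (real ^ 'm) set" where
  "passage_base i = (\<lambda>x. lattice_point \<epsilon> i + x) ` ((\<lambda>x. d *\<^sub>R x) ` D)"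

lemma passage_base_iff: "y \<in> passage_base i \<longleftrightarrow> (1 / d) *\<^sub>R (y - lattice_point \<epsilon> i) \<in> D"
proof
  assume "(1 / d) *\<^sub>R (y - lattice_point \<epsilon> i) \<in> D"
  moreover have "y = lattice_point \<epsilon> i + d *\<^sub>R ((1 / d) *\<^sub>R (y - lattice_point \<epsilon> i))" using pos(2) by simp
  ultimately show "y \<in> passage_base i" unfolding passage_base_def by blast
next
  assume "y \<in> passage_base i"
  then show "(1 / d) *\<^sub>R (y - lattice_point \<epsilon> i) \<in> D" using pos(2) by (auto simp: passage_base_def)
qed

lemma open_passage_eq: "open_passage i = passage_base i \<times> {0<..<h}"
  by (auto simp: open_passage_def passage_base_iff)

lemma passage_at_eq: "passage_at i = passage_base i \<times> {0..h}"
  by (auto simp: passage_def passage_base_iff)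

lemma open_room: "open (room_at i)"
  unfolding room_image using B(1) pos(1) by (intro open_translation open_scaling) auto

lemma open_passage_base: "open (passage_base i)"
  unfolding passage_base_def using D(1) pos(2) by (intro open_translation open_scaling) auto

lemma open_open_passage: "open (open_passage i)"
  unfolding open_passage_eq using open_passage_base by (intro open_Times) auto

lemma bounded_room: "bounded (room_at i)"
  unfolding room_image using B(2) by (intro bounded_translation bounded_scaling)

lemma bounded_passage_base: "bounded (passage_base i)"
  unfolding passage_base_def using D(2) by (intro bounded_translation bounded_scaling)

lemma bounded_passage: "bounded (open_passage i)" "bounded (passage_at i)"
  unfolding open_passage_eq passage_at_eq using bounded_passage_base by (auto intro: bounded_Times)

lemma inward_room: "inward (room_at i)"
  unfolding room_image using lipschitz_boundary_inward[OF B(1,3)] pos(1)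
  by (intro inward_translation inward_scaling)

lemma inward_open_passage: "inward (open_passage i)"
  unfolding open_passage_eq passage_base_def using lipschitz_boundary_inward[OF D(1,3)] pos(2)
  by (intro inward_Times inward_interval inward_translation inward_scaling)

lemma open_passage_subset: "open_passage i \<subseteq> passage_at i"
  by (auto simp: open_passage_eq passage_at_eq)

lemma open_core: "open core"
  unfolding core_def using \<Omega>(1) open_open_passage open_room by (intro open_Un open_UN) auto

lemma core_subset: "core \<subseteq> S"
  unfolding core_def perturbed_domain_def using open_passage_subset by blast

lemma S_borel: "S \<in> sets borel"
proof -
  have "passage_at i \<in> sets borel" for i
  proof -
    have "passage_at i = (passage_base i \<times> UNIV) \<inter> (UNIV \<times> {0..h})" by (auto simp: passage_at_eq)
    moreover have "open (passage_base i \<times> (UNIV :: real set))" "closed ((UNIV :: (real ^ 'm) set) \<times> {0..h})"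
      using open_passage_base by (auto intro: open_Times closed_Times)
    ultimately show ?thesis by auto
  qed
  moreover have "room_at i \<in> sets borel" for i using open_room by auto
  ultimately show ?thesis unfolding perturbed_domain_def
    using \<Omega>(1) finite_I by (intro sets.Un sets.finite_UN) auto
qed

lemma S_bounded: "bounded S"
  unfolding perturbed_domain_def using \<Omega>(2) finite_I bounded_passage bounded_room by auto

lemma AE_off_level: "AE x in lborel. snd (x :: (real ^ 'm) \<times> real) \<noteq> c"
proof -
  have "negligible {x :: (real ^ 'm) \<times> real. (0, 1) \<bullet> x = c}"
    by (rule negligible_hyperplane) (simp add: prod_eq_iff)
  then have "{x :: (real ^ 'm) \<times> real. snd x = c} \<in> null_sets lebesgue"
    by (simp add: negligible_iff_null_sets inner_prod_def)
  then have "AE x in lebesgue. x \<notin> {x :: (real ^ 'm) \<times> real. snd x = c}" by (rule AE_not_in)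
  then show ?thesis by (simp add: AE_completion_iff)
qed

lemma AE_core: "AE x in lborel. x \<in> S \<longrightarrow> x \<in> core"
  using AE_off_level[of 0] AE_off_level[of h]
proof eventually_elim
  case (elim x)
  have "x \<in> open_passage i" if "x \<in> passage_at i" for i
    using that elim unfolding open_passage_eq passage_at_eq by (auto simp: less_le)
  then show ?case unfolding perturbed_domain_def core_def by blast
qed

lemma rooms_borel: "(\<Union>i\<in>I. room_at i) \<in> sets borel"
  using open_room by (intro borel_open open_UN) auto

sublocale weighted_domain S core \<rho> "min \<sigma> 1" "max \<sigma> 1"
proof
  show "S \<in> sets borel" by (rule S_borel)
  show "bounded S" by (rule S_bounded)
  show "open core" "core \<subseteq> S" by (rule open_core core_subset)+
  show "AE x in lborel. x \<in> S \<longrightarrow> x \<in> core" by (rule AE_core)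
  show "\<rho> \<in> borel_measurable borel"
    unfolding mass_density_def[abs_def] using rooms_borel by measurable
  show "0 < min \<sigma> 1" using pos by simp
  show "min \<sigma> 1 \<le> \<rho> x" "\<rho> x \<le> max \<sigma> 1" for x by (auto simp: mass_density_def)
  show "coercive_on S core"
  proof (rule coercive_on_cover[where I = "insert \<Omega> (open_passage ` I \<union> room_at ` I)" and T = "\<lambda>X. X"])
    show "finite (insert \<Omega> (open_passage ` I \<union> room_at ` I))" using finite_I by simp
    show "S \<in> sets borel" by (rule S_borel)
    show "core \<in> sets borel" using open_core by simp
    fix X assume "X \<in> insert \<Omega> (open_passage ` I \<union> room_at ` I)"
    then have X: "open X" "bounded X" "inward X" "X \<subseteq> core"
      using \<Omega>(1,2) lipschitz_boundary_inward[OF \<Omega>(1,3)] open_open_passage open_room bounded_passage(1) bounded_room inward_open_passage inward_room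
      by (auto simp: core_def)
    show "X \<in> sets borel" using X(1) by simp
    show "X \<subseteq> core" by (rule X(4))
    show "coercive_on X X" by (rule coercive_on_inward[OF X(1-3)])
  next
    show "AE x in lborel. x \<in> S \<longrightarrow> (\<exists>X\<in>insert \<Omega> (open_passage ` I \<union> room_at ` I). x \<in> X)"
      using AE_core by eventually_elim (auto simp: core_def)
  qed
qed

end

section \<open>Trial functions\<close>

context rooms_and_passages
begin

definition ramp :: "real \<Rightarrow> real" where
  "ramp t = max 0 (min 1 (t / h))"

text \<open>
  For the index of a room, the function that is 1 in the room, rises linearly in its passage, and is 0
  in the rest of the domain. Cutting off with the column instead of the room and the passage does not
  change it on the domain, but gives a simpler function on the whole space.
\<close>
definition trial :: "int ^ 'm \<Rightarrow> (real ^ 'm) \<times> real \<Rightarrow> real" where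
  "trial i x = (if x \<in> column i then ramp (snd x) else 0)"

text \<open>
  The vertical derivative of the trial function.
\<close>
definition slope :: "int ^ 'm \<Rightarrow> (real ^ 'm) \<times> real \<Rightarrow> real" where
  "slope i x = (if x \<in> column i \<and> 0 < snd x \<and> snd x < h then 1 / h else 0)"

lemma ramp_values: "t \<le> 0 \<Longrightarrow> ramp t = 0" "h \<le> t \<Longrightarrow> ramp t = 1" "0 \<le> ramp t" "ramp t \<le> 1"
proof -
  show "ramp t = 0" if "t \<le> 0"
  proof -
    have "t / h \<le> 0" using that pos(3) by (simp add: divide_le_0_iff)
    then show ?thesis by (simp add: ramp_def)
  qed
  show "ramp t = 1" if "h \<le> t" using that pos(3) by (simp add: ramp_def)
  show "0 \<le> ramp t" "ramp t \<le> 1" by (auto simp: ramp_def)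
qed

lemma continuous_ramp: "continuous_on UNIV ramp"
  unfolding ramp_def[abs_def] using pos(3) by (auto intro!: continuous_intros)

lemma ramp_derivative:
  assumes "t \<noteq> 0" "t \<noteq> h"
  shows "(ramp has_real_derivative (if 0 < t \<and> t < h then 1 / h else 0)) (at t)"
proof -
  consider "t < 0" | "0 < t \<and> t < h" | "h < t" using assms by linarith
  then show ?thesis
  proof cases
    case 1
    have "((\<lambda>_. 0) has_real_derivative 0) (at t)" by simp
    then have "(ramp has_real_derivative 0) (at t)"
      by (rule has_field_derivative_transform_within_open[of _ _ _ "{..<0}"]) (use 1 ramp_values(1) in auto)
    then show ?thesis using 1 by simp
  next
    case 2
    have "((\<lambda>s. s / h) has_real_derivative 1 / h) (at t)" using pos(3) by (auto intro!: derivative_eq_intros)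
    then have "(ramp has_real_derivative 1 / h) (at t)"
      by (rule has_field_derivative_transform_within_open[of _ _ _ "{0<..<h}"]) (use 2 pos(3) in \<open>auto simp: ramp_def\<close>)
    then show ?thesis using 2 by simp
  next
    case 3
    have "((\<lambda>_. 1) has_real_derivative 0) (at t)" by simp
    then have "(ramp has_real_derivative 0) (at t)"
      by (rule has_field_derivative_transform_within_open[of _ _ _ "{h<..}"]) (use 3 ramp_values(2) in auto)
    then show ?thesis using 3 by simp
  qed
qed

lemma trial_bounds: "\<bar>trial i x\<bar> \<le> 1"
  using ramp_values(3,4)[of "snd x"] by (auto simp: trial_def)

lemma slope_bounds: "\<bar>slope i x\<bar> \<le> 1 / h"
  using pos(3) by (auto simp: slope_def)

lemma trial_borel: "trial i \<in> borel_measurable borel" and slope_borel: "slope i \<in> borel_measurable borel"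
proof -
  have c: "column i \<in> sets borel" using open_column by (rule borel_open)
  have s: "snd \<in> borel_measurable (borel :: ((real ^ 'm) \<times> real) measure)"
    by (intro borel_measurable_continuous_onI continuous_intros)
  have r: "ramp \<in> borel_measurable borel" by (rule borel_measurable_continuous_onI[OF continuous_ramp])
  note measurable_compose[OF s r, measurable] c[measurable] s[measurable]
  show "trial i \<in> borel_measurable borel" unfolding trial_def[abs_def] by measurable
  show "slope i \<in> borel_measurable borel" unfolding slope_def[abs_def] by measurable
qed

text \<open>
  The cutoff creates no jumps against a test function: the ramp vanishes below the hyperplane, and
  above it the support of the test function lies in the domain, hence off the sides of the columns.
\<close>
lemma product_vanishes_near:
  assumes \<phi>: "test_function S \<phi>" and y: "y \<notin> column i"
  shows "\<exists>U. open U \<and> y \<in> U \<and> (\<forall>z\<in>U. \<phi> z * trial i z = 0)"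
proof -
  consider "snd y < 0" | "y \<in> closure {x. \<phi> x \<noteq> 0}" "0 \<le> snd y" | "y \<notin> closure {x. \<phi> x \<noteq> 0}" by linarith
  then show ?thesis
  proof cases
    case 1
    show ?thesis
    proof (intro exI[of _ "{z. snd z < 0}"] conjI ballI)
      show "open {z :: (real ^ 'm) \<times> real. snd z < 0}" by (intro open_Collect_less continuous_intros)
      show "\<phi> z * trial i z = 0" if "z \<in> {z. snd z < 0}" for z
        using that ramp_values(1)[of "snd z"] by (simp add: trial_def)
    qed (use 1 in simp)
  next
    case 2
    then have "y \<in> S" using \<phi> by (auto simp: test_function_def)
    then obtain k where k: "y \<in> column k" using upper_part 2(2) by blast
    show ?thesis
    proof (intro exI[of _ "column k"] conjI ballI)
      show "\<phi> z * trial i z = 0" if "z \<in> column k" for z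
        using columns_disjoint[OF that] k y by (auto simp: trial_def)
    qed (use k open_column in auto)
  next
    case 3
    show ?thesis
    proof (intro exI[of _ "- closure {x. \<phi> x \<noteq> 0}"] conjI ballI)
      show "\<phi> z * trial i z = 0" if "z \<in> - closure {x. \<phi> x \<noteq> 0}" for z
        using test_function_zero(1)[OF \<phi>, of z] that by simp
      show "y \<in> - closure {x. \<phi> x \<noteq> 0}" using 3 by blast
    qed (simp add: open_Compl)
  qed
qed

lemma product_continuous:
  assumes \<phi>: "test_function S \<phi>"
  shows "isCont (\<lambda>y. \<phi> y * trial i y) y"
proof (cases "y \<in> column i")
  case True
  have ev: "\<forall>\<^sub>F z in nhds y. \<phi> z * trial i z = \<phi> z * ramp (snd z)"
    unfolding eventually_nhds using True open_column by (intro exI[of _ "column i"]) (auto simp: trial_def)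
  have "isCont (\<lambda>z. \<phi> z * ramp (snd z)) y"
  proof -
    have "continuous_on UNIV (\<lambda>z. \<phi> z * ramp (snd z))"
      by (intro continuous_on_mult test_function_continuous[OF \<phi>] continuous_on_compose2[OF continuous_ramp continuous_on_snd])
        (auto intro: continuous_on_id)
    then show ?thesis unfolding continuous_on_eq_continuous_at[OF open_UNIV] by blast
  qed
  then show ?thesis unfolding isCont_cong[OF ev] .
next
  case False
  obtain U where U: "open U" "y \<in> U" "\<forall>z\<in>U. \<phi> z * trial i z = 0" using product_vanishes_near[OF \<phi> False] by blast
  have "\<forall>\<^sub>F z in nhds y. \<phi> z * trial i z = 0" unfolding eventually_nhds using U by blast
  then have "isCont (\<lambda>y. \<phi> y * trial i y) y \<longleftrightarrow> isCont (\<lambda>_. 0 :: real) y" by (rule isCont_cong)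
  then show ?thesis by simp
qed

lemma product_derivative:
  assumes \<phi>: "test_function S \<phi>" and y: "snd y \<noteq> 0" "snd y \<noteq> h"
  shows "((\<lambda>y. \<phi> y * trial i y) has_derivative
    (\<lambda>w. frechet_derivative \<phi> (at y) w * trial i y + \<phi> y * (snd w * slope i y))) (at y)"
proof (cases "y \<in> column i")
  case True
  let ?V' = "if 0 < snd y \<and> snd y < h then 1 / h else 0"
  have "((\<lambda>z. ramp (snd z)) has_derivative (\<lambda>w. snd w * ?V')) (at y)"
    by (rule DERIV_compose_FDERIV[where f = ramp and g = snd and g' = snd and x = y, OF ramp_derivative[OF y]])
      (rule has_derivative_snd[OF has_derivative_ident])
  from has_derivative_mult[OF test_function_has_derivative[OF \<phi>] this]
  have "((\<lambda>z. \<phi> z * ramp (snd z)) has_derivative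
    (\<lambda>w. frechet_derivative \<phi> (at y) w * trial i y + \<phi> y * (snd w * slope i y))) (at y)"
    by (rule has_derivative_eq_rhs) (use True in \<open>auto simp: fun_eq_iff trial_def slope_def\<close>)
  then show ?thesis
    by (rule has_derivative_transform_within_open[OF _ open_column True]) (simp add: trial_def)
next
  case False
  obtain U where U: "open U" "y \<in> U" "\<forall>z\<in>U. \<phi> z * trial i z = 0" using product_vanishes_near[OF \<phi> False] by blast
  have "((\<lambda>_. 0) has_derivative (\<lambda>_. 0 :: real)) (at y)" by simp
  then have "((\<lambda>y. \<phi> y * trial i y) has_derivative (\<lambda>_. 0)) (at y)"
    by (rule has_derivative_transform_within_open[OF _ U(1,2)]) (use U(3) in simp)
  then show ?thesis
    by (rule has_derivative_eq_rhs) (use False in \<open>simp add: fun_eq_iff trial_def slope_def\<close>)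
qed

text \<open>
  The product \<open>\<psi>\<close> of a test function with a trial function is continuous with compact support, and
  differentiable off two hyperplanes with derivative \<open>W\<close> in direction \<open>w\<close>. Integrate
  \<open>\<psi> (x + w) - \<psi> x = \<integral>\<^sub>0\<^sup>1 W (x + t w) dt\<close> over \<open>x\<close>: by translation invariance the left side gives 0 and
  the right side the integral of \<open>W\<close>.
\<close>
lemma integral_product_derivative:
  fixes w :: "(real ^ 'm) \<times> real" and i :: "int ^ 'm"
  assumes \<phi>: "test_function S \<phi>"
  defines "W \<equiv> (\<lambda>y. frechet_derivative \<phi> (at y) w * trial i y + \<phi> y * (snd w * slope i y))"
  shows "W \<in> borel_measurable borel" "(LINT x|lborel. complex_of_real (W x)) = 0"
proof -
  define \<psi> where "\<psi> y = \<phi> y * trial i y" for y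
  note m = test_function_measurable[OF \<phi>]
  obtain C where C: "\<And>x. \<bar>\<phi> x\<bar> \<le> C" "\<And>x. \<bar>frechet_derivative \<phi> (at x) w\<bar> \<le> C" "C \<ge> 0"
    by (rule test_function_bounded[OF \<phi>, of w]) (rule that)
  show Wm[measurable]: "W \<in> borel_measurable borel"
    unfolding W_def by (intro borel_measurable_add borel_measurable_times m trial_borel slope_borel borel_measurable_const)
  have \<psi>m[measurable]: "\<psi> \<in> borel_measurable borel"
    unfolding \<psi>_def[abs_def] by (intro borel_measurable_times m trial_borel)
  define K where "K = C + C * (\<bar>snd w\<bar> * (1 / h))"
  have K0: "0 \<le> K" using C(3) pos(3) by (simp add: K_def)
  have WK: "\<bar>W x\<bar> \<le> K" for x
  proof -
    have "\<bar>frechet_derivative \<phi> (at x) w\<bar> * \<bar>trial i x\<bar> \<le> C * 1"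
      using C trial_bounds by (intro mult_mono) auto
    moreover have "\<bar>\<phi> x\<bar> * (\<bar>snd w\<bar> * \<bar>slope i x\<bar>) \<le> C * (\<bar>snd w\<bar> * (1 / h))"
      using C slope_bounds by (intro mult_mono mult_left_mono) auto
    ultimately show ?thesis
      unfolding W_def K_def using abs_triangle_ineq[of "frechet_derivative \<phi> (at x) w * trial i x" "\<phi> x * (snd w * slope i x)"]
      by (simp add: abs_mult)
  qed
  have W0: "W x = 0" if "x \<notin> S" for x
    using test_function_zero_outside[OF \<phi> that] by (simp add: W_def)
  have iS: "integrable lborel (indicator S :: _ \<Rightarrow> real)"
    using S_borel emeasure_bounded_finite[OF S_bounded] by simp
  have Wi: "integrable lborel (\<lambda>x. complex_of_real (W x))"
  proof (rule Bochner_Integration.integrable_bound)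
    show "integrable lborel (\<lambda>x. K * indicator S x)" using iS by (rule integrable_mult_right)
    have "\<bar>W x\<bar> \<le> K * indicator S x" for x using WK[of x] W0[of x] by (cases "x \<in> S") auto
    then show "AE x in lborel. norm (complex_of_real (W x)) \<le> norm (K * indicator S x)"
      using K0 by (intro AE_I2) (simp add: abs_mult)
    show "(\<lambda>x. complex_of_real (W x)) \<in> borel_measurable lborel" using borel_measurable_of_real_fun[OF Wm] by simp
  qed
  have \<psi>i: "integrable lborel (\<lambda>x. complex_of_real (\<psi> x))"
  proof (rule Bochner_Integration.integrable_bound)
    show "integrable lborel (\<lambda>x. C * indicator S x)" using iS by (rule integrable_mult_right)
    have "\<bar>\<psi> x\<bar> \<le> C * indicator S x" for x
    proof (cases "x \<in> S")
      case True
      have "\<bar>\<phi> x\<bar> * \<bar>trial i x\<bar> \<le> C * 1" using C trial_bounds by (intro mult_mono) auto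
      then show ?thesis using True by (simp add: \<psi>_def abs_mult)
    next
      case False
      then show ?thesis using test_function_zero_outside[OF \<phi>] by (simp add: \<psi>_def)
    qed
    then show "AE x in lborel. norm (complex_of_real (\<psi> x)) \<le> norm (C * indicator S x)"
      using C(3) by (intro AE_I2) (simp add: abs_mult)
    show "(\<lambda>x. complex_of_real (\<psi> x)) \<in> borel_measurable lborel" using borel_measurable_of_real_fun[OF \<psi>m] by simp
  qed
  have ftc: "(LINT t|lborel. indicator {0..1} t * W (x + t *\<^sub>R w)) = \<psi> (x + w) - \<psi> x" if x: "snd x \<noteq> 0" "snd x \<noteq> h" for x
  proof -
    \<comment> \<open>the times at which the segment crosses the two hyperplanes; a segment within one of them is excluded by the assumption on \<open>x\<close>\<close>
    define N where "N = {t. snd (x + t *\<^sub>R w) = 0 \<or> snd (x + t *\<^sub>R w) = h}"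
    have "N \<subseteq> {(0 - snd x) / snd w, (h - snd x) / snd w}"
    proof
      fix t assume "t \<in> N"
      then have t: "snd x + t * snd w = 0 \<or> snd x + t * snd w = h" by (simp add: N_def)
      have "snd w \<noteq> 0" using t x by auto
      then have "t = (0 - snd x) / snd w \<or> t = (h - snd x) / snd w"
        unfolding nonzero_eq_divide_eq[OF \<open>snd w \<noteq> 0\<close>] using t by linarith
      then show "t \<in> {(0 - snd x) / snd w, (h - snd x) / snd w}" by blast
    qed
    then have N: "finite N" by (rule finite_subset) simp
    have hi: "((\<lambda>t. W (x + t *\<^sub>R w)) has_integral (\<psi> (x + 1 *\<^sub>R w) - \<psi> (x + 0 *\<^sub>R w))) {0..1}"
    proof (rule fundamental_theorem_of_calculus_interior_strong[OF N])
      fix t :: real assume "t \<in> {0<..<1} - N"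
      then have ne: "snd (x + t *\<^sub>R w) \<noteq> 0" "snd (x + t *\<^sub>R w) \<noteq> h" by (auto simp: N_def)
      have 1: "((\<lambda>t. x + t *\<^sub>R w) has_derivative (\<lambda>s. s *\<^sub>R w)) (at t)"
        by (auto intro!: derivative_eq_intros)
      from has_derivative_compose[OF 1 product_derivative[OF \<phi> ne]]
      show "((\<lambda>t. \<psi> (x + t *\<^sub>R w)) has_vector_derivative W (x + t *\<^sub>R w)) (at t)"
        unfolding has_vector_derivative_def \<psi>_def
        by (rule has_derivative_eq_rhs)
          (simp add: fun_eq_iff W_def linear_scale[OF test_function_linear[OF \<phi>]] algebra_simps)
    next
      have "continuous_on UNIV \<psi>"
        using product_continuous[OF \<phi>] by (simp add: continuous_on_eq_continuous_at \<psi>_def[abs_def])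
      then show "continuous_on {0..1} (\<lambda>t. \<psi> (x + t *\<^sub>R w))"
        by (rule continuous_on_compose2) (auto intro!: continuous_intros)
    qed simp
    have "set_integrable lborel {0..1} (\<lambda>t. W (x + t *\<^sub>R w))"
      unfolding set_integrable_def
    proof (rule Bochner_Integration.integrable_bound)
      show "integrable lborel (\<lambda>t. K * indicator {0..1::real} t)" by simp
      show "AE t in lborel. norm (indicator {0..1} t *\<^sub>R W (x + t *\<^sub>R w)) \<le> norm (K * indicator {0..1} t)"
        using WK K0 by (intro AE_I2) (auto split: split_indicator)
    qed measurable
    from set_borel_integral_eq_integral(2)[OF this] integral_unique[OF hi]
    show ?thesis by (simp add: set_lebesgue_integral_def)
  qed
  have ae: "AE x in lborel. (LINT t|lborel. of_real (indicator {0..1} t * 1) * complex_of_real (W (x + t *\<^sub>R w)))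
     = complex_of_real (\<psi> (x + w)) - complex_of_real (\<psi> x)"
    using AE_off_level[of 0] AE_off_level[of h]
  proof eventually_elim
    case (elim x)
    have "(LINT t|lborel. of_real (indicator {0..1} t * 1) * complex_of_real (W (x + t *\<^sub>R w)))
      = (LINT t|lborel. complex_of_real (indicator {0..1} t * W (x + t *\<^sub>R w)))"
      by (simp only: of_real_mult mult_1_right of_real_1)
    then show ?case unfolding integral_complex_of_real ftc[OF elim] by simp
  qed
  have 1: "(LINT x|lborel. (LINT t|lborel. of_real (indicator {0..1} t * 1) * complex_of_real (W (x + t *\<^sub>R w)))) = 0"
  proof -
    have sh: "integrable lborel (\<lambda>x. complex_of_real (\<psi> (x + w)))" by (rule integrable_lborel_shift[OF \<psi>i])
    have "(LINT x|lborel. (LINT t|lborel. of_real (indicator {0..1} t * 1) * complex_of_real (W (x + t *\<^sub>R w))))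
      = (LINT x|lborel. complex_of_real (\<psi> (x + w)) - complex_of_real (\<psi> x))"
    proof (rule integral_cong_AE[OF _ _ ae])
      show "(\<lambda>x. LINT t|lborel. of_real (indicator {0..1} t * 1) * complex_of_real (W (x + t *\<^sub>R w))) \<in> borel_measurable lborel"
        by (rule borel_measurable_integrable[OF LINT_segment_swap(2)[OF Wi, of "\<lambda>_ _. 1" 1]]) auto
      show "(\<lambda>x. complex_of_real (\<psi> (x + w)) - complex_of_real (\<psi> x)) \<in> borel_measurable lborel"
        by (intro borel_measurable_integrable Bochner_Integration.integrable_diff sh \<psi>i)
    qed
    also have "\<dots> = (LINT x|lborel. complex_of_real (\<psi> (x + w))) - (LINT x|lborel. complex_of_real (\<psi> x))"
      by (rule Bochner_Integration.integral_diff[OF sh \<psi>i])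
    also have "(LINT x|lborel. complex_of_real (\<psi> (x + w))) = (LINT x|lborel. complex_of_real (\<psi> x))"
      by (rule integral_lborel_shift) (rule borel_measurable_of_real_fun[OF \<psi>m])
    finally show ?thesis by simp
  qed
  have "(LINT x|lborel. (LINT t|lborel. of_real (indicator {0..1} t * 1) * complex_of_real (W (x + t *\<^sub>R w))))
    = (LINT t|lborel. (LINT x|lborel. of_real (indicator {0..1} t * 1) * complex_of_real (W (x + t *\<^sub>R w))))"
    by (rule LINT_segment_swap(1)[OF Wi, of "\<lambda>_ _. 1" 1]) auto
  also have "\<dots> = (LINT t|lborel. of_real (indicator {0..1::real} t) * (LINT x|lborel. complex_of_real (W x)))"
  proof (rule Bochner_Integration.integral_cong)
    fix t :: real
    have "(LINT x|lborel. complex_of_real (W (x + t *\<^sub>R w))) = (LINT x|lborel. complex_of_real (W x))"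
      by (rule integral_lborel_shift) (rule borel_measurable_of_real_fun[OF Wm])
    then show "(LINT x|lborel. of_real (indicator {0..1} t * 1) * complex_of_real (W (x + t *\<^sub>R w)))
      = of_real (indicator {0..1} t) * (LINT x|lborel. complex_of_real (W x))"
      by (simp only: mult_1_right integral_mult_right_zero)
  qed simp
  also have "\<dots> = (LINT x|lborel. complex_of_real (W x))"
    by (simp only: integral_mult_left_zero integral_complex_of_real) simp
  finally show "(LINT x|lborel. complex_of_real (W x)) = 0" using 1 by simp
qed

definition trial_fn :: "int ^ 'm \<Rightarrow> (real ^ 'm) \<times> real \<Rightarrow> complex" where
  "trial_fn i x = complex_of_real (trial i x)"

lemma trial_fn_L2: "trial_fn i \<in> L2 S"
  unfolding trial_fn_def[abs_def] by (rule bounded_in_L2[OF trial_borel trial_bounds])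

lemma slope_L2: "(\<lambda>x. complex_of_real (c * slope i x)) \<in> L2 S"
proof (rule bounded_in_L2)
  show "(\<lambda>x. c * slope i x) \<in> borel_measurable borel"
    by (intro borel_measurable_times borel_measurable_const slope_borel)
  show "\<bar>c * slope i x\<bar> \<le> \<bar>c\<bar> * (1 / h)" for x
    using slope_bounds by (simp only: abs_mult) (intro mult_left_mono; simp)
qed

lemma trial_fn_weak_partial: "has_weak_partial S w (trial_fn i) (\<lambda>x. complex_of_real (snd w * slope i x))"
  unfolding has_weak_partial_def
proof (intro allI impI)
  fix \<phi> assume \<phi>: "test_function S \<phi>"
  define W where "W y = frechet_derivative \<phi> (at y) w * trial i y + \<phi> y * (snd w * slope i y)" for y
  note W = integral_product_derivative[OF \<phi>, of w i, folded W_def]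
  have "(LINT x|M. complex_of_real (W x)) = (LINT x|lborel. complex_of_real (W x))"
  proof (rule transfer_integral(1))
    show "(\<lambda>x. complex_of_real (W x)) \<in> borel_measurable M" by (intro borel_measurable_of_real_fun borel_M W(1))
    show "(\<lambda>x. complex_of_real (W x)) \<in> borel_measurable borel" by (intro borel_measurable_of_real_fun W(1))
    show "AE x in lborel. complex_of_real (W x) = (if x \<in> S then complex_of_real (W x) else 0)"
      using test_function_zero_outside[OF \<phi>] by (intro AE_I2) (simp add: W_def)
  qed
  also have "\<dots> = 0" by (rule W(2))
  finally have "0 = (LINT x|M. complex_of_real (W x))" by simp
  also have "\<dots> = (LINT x|M. of_real (frechet_derivative \<phi> (at x) w) * trial_fn i x + of_real (\<phi> x) * complex_of_real (snd w * slope i x))"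
    by (intro Bochner_Integration.integral_cong refl) (simp add: W_def trial_fn_def)
  also have "\<dots> = (LINT x|M. of_real (frechet_derivative \<phi> (at x) w) * trial_fn i x) + (LINT x|M. of_real (\<phi> x) * complex_of_real (snd w * slope i x))"
    by (intro Bochner_Integration.integral_add test_integrable[OF \<phi>] trial_fn_L2 slope_L2)
  finally show "(LINT x|M. of_real (frechet_derivative \<phi> (at x) w) * trial_fn i x) = - (LINT x|M. of_real (\<phi> x) * complex_of_real (snd w * slope i x))"
    by (simp only: eq_neg_iff_add_eq_0)
qed

lemma trial_fn_H1: "trial_fn i \<in> H1 S"
  unfolding H1_def using trial_fn_L2 trial_fn_weak_partial slope_L2 by blast

lemma trial_fn_dirichlet: "dirichlet_form S (trial_fn i) (trial_fn k) = (LINT x|M. complex_of_real (slope i x * slope k x))"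
  unfolding dirichlet_form_def
proof (rule integral_cong_AE)
  show "(\<lambda>x. \<Sum>w\<in>Basis. weak_partial S w (trial_fn i) x * cnj (weak_partial S w (trial_fn k) x)) \<in> borel_measurable M"
    by (rule borel_measurable_integrable[OF dirichlet_integrable[OF trial_fn_H1 trial_fn_H1]])
  show "(\<lambda>x. complex_of_real (slope i x * slope k x)) \<in> borel_measurable M"
    by (intro borel_measurable_of_real_fun borel_M borel_measurable_times slope_borel)
  have unit: "(\<Sum>w\<in>(Basis :: ((real ^ 'm) \<times> real) set). snd w * snd w) = 1"
    using euclidean_inner[of "(0, 1) :: (real ^ 'm) \<times> real" "(0, 1)"] by (simp add: inner_prod_def)
  have wp: "AE x in M. weak_partial S w (trial_fn l) x = complex_of_real (snd w * slope l x)" if "w \<in> Basis" for w l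
    by (rule weak_partial_unique[OF weak_partial_D[OF trial_fn_H1 that] slope_L2 trial_fn_weak_partial])
  have "AE x in M. \<forall>w\<in>Basis. weak_partial S w (trial_fn i) x = complex_of_real (snd w * slope i x) \<and>
    weak_partial S w (trial_fn k) x = complex_of_real (snd w * slope k x)"
    by (rule eventually_ball_finite[OF finite_Basis]) (intro ballI eventually_conj wp)
  then show "AE x in M. (\<Sum>w\<in>Basis. weak_partial S w (trial_fn i) x * cnj (weak_partial S w (trial_fn k) x)) = complex_of_real (slope i x * slope k x)"
  proof eventually_elim
    case (elim x)
    then have "(\<Sum>w\<in>Basis. weak_partial S w (trial_fn i) x * cnj (weak_partial S w (trial_fn k) x))
      = (\<Sum>w\<in>(Basis :: ((real ^ 'm) \<times> real) set). complex_of_real ((snd w * snd w) * (slope i x * slope k x)))"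
      by (intro sum.cong) (auto simp: mult_ac)
    also have "\<dots> = complex_of_real ((\<Sum>w\<in>(Basis :: ((real ^ 'm) \<times> real) set). snd w * snd w) * (slope i x * slope k x))"
      unfolding sum_distrib_right of_real_sum ..
    finally show ?case unfolding unit by simp
  qed
qed

lemma trial_fn_orthogonal:
  assumes "i \<noteq> k"
  shows "weighted_inner S \<rho> (trial_fn i) (trial_fn k) = 0" "dirichlet_form S (trial_fn i) (trial_fn k) = 0"
proof -
  have "trial i x * trial k x = 0" "slope i x * slope k x = 0" for x
    using columns_disjoint[of x i k] assms by (auto simp: trial_def slope_def)
  then have z: "trial_fn i x * cnj (trial_fn k x) = 0" "slope i x * slope k x = 0" for x
    by (simp_all add: trial_fn_def flip: of_real_mult)
  show "weighted_inner S \<rho> (trial_fn i) (trial_fn k) = 0" "dirichlet_form S (trial_fn i) (trial_fn k) = 0"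
    unfolding trial_fn_dirichlet weighted_inner_def z by simp_all
qed

lemma measure_passage_base: "measure lborel (passage_base i) = d ^ CARD('m) * measure lebesgue D"
proof -
  have "passage_base i = (\<lambda>x. d *\<^sub>R x + lattice_point \<epsilon> i) ` D" by (auto simp: passage_base_def image_image add.commute)
  then have "measure lebesgue (passage_base i) = d ^ CARD('m) * measure lebesgue D"
    using measure_lebesgue_affine[of d "lattice_point \<epsilon> i" D] pos(2) by simp
  then show ?thesis using open_passage_base by simp
qed

lemma measure_open_passage: "measure lborel (open_passage i) = d ^ CARD('m) * measure lebesgue D * h"
proof -
  have "emeasure lborel (open_passage i) = emeasure lborel (passage_base i) * emeasure lborel {0<..<h}"
    unfolding open_passage_eq lborel_prod[symmetric]
    using open_passage_base by (intro lborel.emeasure_pair_measure_Times) auto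
  then have "measure lborel (open_passage i) = measure lborel (passage_base i) * measure lborel {0<..<h}"
    by (simp add: measure_def enn2real_mult)
  then show ?thesis using measure_passage_base pos(3) by simp
qed

lemma measure_room: "measure lebesgue (room_at i) = b ^ (CARD('m) + 1) * measure lebesgue B"
proof -
  have "room_at i = (\<lambda>x. b *\<^sub>R x + (lattice_point \<epsilon> i, h)) ` B" by (auto simp: room_image image_image add.commute)
  then show ?thesis
    using measure_lebesgue_affine[of b "(lattice_point \<epsilon> i, h)" B] pos(1) by simp
qed

lemma M_indicator:
  assumes "A \<in> sets borel" "A \<subseteq> S"
  shows "integrable M (indicator A :: _ \<Rightarrow> real)" "(LINT x|M. indicator A x) = measure lborel A"
proof -
  have m: "(indicator A :: _ \<Rightarrow> real) \<in> borel_measurable borel" using assms(1) by measurable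
  have A: "bounded A" by (rule bounded_subset[OF S_bounded assms(2)])
  have ae: "AE x in lborel. (indicator A x :: real) = (if x \<in> S then indicator A x else 0)"
    using assms(2) by (intro AE_I2) (auto split: split_indicator)
  have "integrable lborel (indicator A :: _ \<Rightarrow> real)"
    using assms(1) emeasure_bounded_finite[OF A] by simp
  then show "integrable M (indicator A :: _ \<Rightarrow> real)"
    using transfer_integral(2)[OF borel_M[OF m] m ae] by simp
  show "(LINT x|M. indicator A x) = measure lborel A"
    using transfer_integral(1)[OF borel_M[OF m] m ae] assms(1) by simp
qed

text \<open>
  On the domain the slope is nonzero only in the passage, whose volume is \<open>d ^ (n - 1) * |D| * h\<close>.
\<close>
lemma trial_fn_energy:
  assumes i: "i \<in> I"
  shows "en.sq (trial_fn i) \<le> d ^ CARD('m) * measure lebesgue D / h"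
proof -
  have sub: "open_passage i \<subseteq> S" using i open_passage_subset unfolding perturbed_domain_def by blast
  note ind = M_indicator[OF borel_open[OF open_open_passage] sub]
  have int: "integrable M (\<lambda>x. slope i x * slope i x)"
    using L2_D(2)[OF slope_L2[of 1 i]] by (simp add: power2_eq_square)
  have le: "slope i x * slope i x \<le> indicator (open_passage i) x * (1 / h\<^sup>2)" if x: "x \<in> S" for x
  proof (cases "x \<in> column i \<and> 0 < snd x \<and> snd x < h")
    case True
    have "x \<notin> \<Omega>" using True \<Omega>(4) by auto
    moreover have "x \<notin> room_at k" for k using True room_in_column[of x k] by auto
    ultimately obtain k where k: "x \<in> passage_at k" using x unfolding perturbed_domain_def by blast
    then have "x \<in> column k" using passage_in_column[of x k] unfolding passage_def by blast
    then have "k = i" using columns_disjoint True by blast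
    then have "x \<in> open_passage i" using k True by (auto simp: open_passage_eq passage_at_eq)
    then show ?thesis using True by (simp add: slope_def power2_eq_square)
  next
    case False
    then have "slope i x = 0" by (auto simp: slope_def)
    then show ?thesis by simp
  qed
  have "en.sq (trial_fn i) = (LINT x|M. slope i x * slope i x)"
    unfolding trial_fn_dirichlet integral_complex_of_real by (rule Re_complex_of_real)
  also have "\<dots> \<le> (LINT x|M. indicator (open_passage i) x * (1 / h\<^sup>2))"
    using le by (intro Bochner_Integration.integral_mono int integrable_mult_left ind(1)) (simp add: space_restrict_space)
  also have "\<dots> = measure lborel (open_passage i) * (1 / h\<^sup>2)" using ind by simp
  also have "\<dots> = d ^ CARD('m) * measure lebesgue D / h"
    unfolding measure_open_passage using pos(3) by (simp add: power2_eq_square)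
  finally show ?thesis .
qed

lemma trial_fn_mass:
  assumes i: "i \<in> I"
  shows "\<sigma> * (b ^ (CARD('m) + 1) * measure lebesgue B) \<le> ip.sq (trial_fn i)"
proof -
  have sub: "room_at i \<subseteq> S" using i unfolding perturbed_domain_def by blast
  note ind = M_indicator[OF borel_open[OF open_room] sub]
  have int: "integrable M (\<lambda>x. (norm (trial_fn i x))\<^sup>2 * \<rho> x)"
  proof (rule Bochner_Integration.integrable_bound)
    show "integrable M (\<lambda>x. (norm (trial_fn i x))\<^sup>2 * max \<sigma> 1)" using L2_D(2)[OF trial_fn_L2[of i]] by (rule integrable_mult_left)
    show "(\<lambda>x. (norm (trial_fn i x))\<^sup>2 * \<rho> x) \<in> borel_measurable M"
      by (intro borel_measurable_times borel_measurable_integrable[OF L2_D(2)[OF trial_fn_L2]] borel_M[OF \<rho>_borel])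
    have "\<bar>\<rho> x\<bar> \<le> \<bar>max \<sigma> 1\<bar>" for x using \<rho>[of x] \<rho>0 by linarith
    then show "AE x in M. norm ((norm (trial_fn i x))\<^sup>2 * \<rho> x) \<le> norm ((norm (trial_fn i x))\<^sup>2 * max \<sigma> 1)"
      by (intro AE_I2) (simp only: real_norm_def abs_mult, intro mult_left_mono, simp_all)
  qed
  have le: "indicator (room_at i) x * \<sigma> \<le> (norm (trial_fn i x))\<^sup>2 * \<rho> x" for x
  proof (cases "x \<in> room_at i")
    case True
    then have "trial i x = 1" using room_in_column[OF True] ramp_values(2)[of "snd x"] by (simp add: trial_def)
    moreover have "\<rho> x = \<sigma>" using True i by (auto simp: mass_density_def)
    ultimately show ?thesis using True by (simp add: trial_fn_def)
  next
    case False
    have "0 \<le> \<rho> x" using \<rho>(1)[of x] \<rho>0 by linarith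
    then show ?thesis using False by simp
  qed
  have "\<sigma> * (b ^ (CARD('m) + 1) * measure lebesgue B) = measure lborel (room_at i) * \<sigma>"
    using measure_room[of i] open_room[of i] by simp
  also have "\<dots> = (LINT x|M. indicator (room_at i) x * \<sigma>)" using ind by simp
  also have "\<dots> \<le> (LINT x|M. (norm (trial_fn i x))\<^sup>2 * \<rho> x)"
    by (intro Bochner_Integration.integral_mono int integrable_mult_left ind(1) le)
  also have "\<dots> = ip.sq (trial_fn i)" by (simp add: weighted_inner_diag)
  finally show ?thesis .
qed

lemma measure_B_pos: "0 < measure lebesgue B"
proof -
  have "\<not> negligible B" using B(1,4) by (rule open_not_negligible)
  moreover have "B \<in> lmeasurable" using B(1,2) by (rule lmeasurable_open[rotated])
  ultimately have "measure lebesgue B \<noteq> 0" by (simp add: negligible_iff_measure)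
  then show ?thesis by (simp add: less_le)
qed

theorem eigenvalue_bound_of_many_rooms:
  assumes \<iota>: "inj_on \<iota> {..k}" "\<iota> ` {..k} \<subseteq> I"
    and \<Lambda>: "eigenvalue_sequence S \<rho> \<Lambda>"
    and \<mu>: "d ^ CARD('m) * measure lebesgue D / (h * \<sigma> * b ^ (CARD('m) + 1) * measure lebesgue B) \<le> \<mu>"
  shows "\<Lambda> k \<le> \<mu>"
proof (rule eigenvalue_upper_bound[OF \<Lambda>, where v = "\<lambda>j. trial_fn (\<iota> j)"])
  define m where "m = \<sigma> * (b ^ (CARD('m) + 1) * measure lebesgue B)"
  have m: "m > 0" using pos measure_B_pos by (simp add: m_def)
  have "0 \<le> d ^ CARD('m) * measure lebesgue D / (h * \<sigma> * b ^ (CARD('m) + 1) * measure lebesgue B)"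
    using pos by simp
  then show \<mu>0: "0 \<le> \<mu>" using \<mu> by linarith
  have in_I: "\<iota> j \<in> I" if "j \<in> {..k}" for j using \<iota>(2) that by blast
  show "trial_fn (\<iota> j) \<in> H1 S" for j by (rule trial_fn_H1)
  show "weighted_inner S \<rho> (trial_fn (\<iota> i)) (trial_fn (\<iota> j)) = 0" "dirichlet_form S (trial_fn (\<iota> i)) (trial_fn (\<iota> j)) = 0"
    if "i \<in> {..k}" "j \<in> {..k}" "i \<noteq> j" for i j
    using inj_onD[OF \<iota>(1), of i j] that by (auto intro!: trial_fn_orthogonal)
  show "0 < ip.sq (trial_fn (\<iota> j))" if "j \<in> {..k}" for j
    using trial_fn_mass[OF in_I[OF that]] m unfolding m_def by linarith
  show "en.sq (trial_fn (\<iota> j)) \<le> \<mu> * ip.sq (trial_fn (\<iota> j))" if "j \<in> {..k}" for j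
  proof -
    have "d ^ CARD('m) * measure lebesgue D / (h * \<sigma> * b ^ (CARD('m) + 1) * measure lebesgue B) = (d ^ CARD('m) * measure lebesgue D / h) / m"
      by (simp add: m_def mult_ac)
    then have "d ^ CARD('m) * measure lebesgue D / h \<le> \<mu> * m" using \<mu> m by (simp only: pos_divide_le_eq)
    also have "\<mu> * m \<le> \<mu> * ip.sq (trial_fn (\<iota> j))"
      using trial_fn_mass[OF in_I[OF that]] \<mu>0 unfolding m_def by (rule mult_left_mono)
    finally show ?thesis using trial_fn_energy[OF in_I[OF that]] by linarith
  qed
qed

end

theorem theorem2p2:
  fixes \<Omega> B :: "((real ^ 'm) \<times> real) set"
    and D :: "(real ^ 'm) set"
    and R r :: real
    and b d h \<sigma> :: "real \<Rightarrow> real"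
    and q :: ereal
    and \<Lambda> :: "real \<Rightarrow> nat \<Rightarrow> real"
    and n :: nat
  assumes n: "n = CARD('m) + 1"
    and \<Omega>: "domain \<Omega>" "bounded \<Omega>" "lipschitz_boundary \<Omega>" "\<Omega> \<subseteq> {x. snd x < 0}"
    and \<Gamma>: "interior {x'. (x', 0) \<in> flat_part \<Omega>} \<noteq> {}"
    and R: "0 < R" "R < 1 / 2"
    and B: "domain B" "bounded B" "lipschitz_boundary B"
      "B \<subseteq> {x. (\<forall>j. - (1 / 2) < fst x $ j \<and> fst x $ j < 1 / 2) \<and> 0 < snd x}"
      "{x. norm (fst x) < R \<and> snd x = 0} \<subseteq> frontier B"
    and D: "domain D" "bounded D" "lipschitz_boundary D" "0 \<in> D" "D \<subseteq> {x'. norm x' < R}"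
    and pos: "\<forall>\<^sub>F \<epsilon> in at_right 0. 0 < b \<epsilon> \<and> 0 < d \<epsilon> \<and> 0 < h \<epsilon> \<and> 0 < \<sigma> \<epsilon>"
    and le: "\<forall>\<^sub>F \<epsilon> in at_right 0. d \<epsilon> \<le> b \<epsilon> \<and> b \<epsilon> \<le> \<epsilon>"
    and h: "(h \<longlongrightarrow> 0) (at_right 0)"
    and d: "((\<lambda>\<epsilon>. \<epsilon> ^ (n - 1) * passage_scale n (d \<epsilon>)) \<longlongrightarrow> 0) (at_right 0)"
    and q: "((\<lambda>\<epsilon>. ereal (d \<epsilon> ^ (n - 1) * measure lebesgue D /
                     (h \<epsilon> * \<sigma> \<epsilon> * b \<epsilon> ^ n * measure lebesgue B))) \<longlongrightarrow> q) (at_right 0)"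
    and r: "((\<lambda>\<epsilon>. \<sigma> \<epsilon> * b \<epsilon> ^ n * measure lebesgue B / \<epsilon> ^ (n - 1)) \<longlongrightarrow> r) (at_right 0)"
    and \<Lambda>: "\<forall>\<^sub>F \<epsilon> in at_right 0.
      eigenvalue_sequence (perturbed_domain \<Omega> B D \<epsilon> (b \<epsilon>) (d \<epsilon>) (h \<epsilon>))
        (mass_density \<Omega> B \<epsilon> (b \<epsilon>) (h \<epsilon>) (\<sigma> \<epsilon>)) (\<Lambda> \<epsilon>)"
    and q_finite: "q < \<infinity>"
  shows "(SUP k. Limsup (at_right 0) (\<lambda>\<epsilon>. ereal (\<Lambda> \<epsilon> k))) \<le> q"
proof (rule dense_ge)
  fix c assume c: "q < c"
  have "(0, 0) \<in> frontier B" using B(5) R(1) by auto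
  then have B_ne: "B \<noteq> {}" by auto
  have "\<forall>\<^sub>F \<epsilon> in at_right 0. ereal (\<Lambda> \<epsilon> k) \<le> c" for k
  proof -
    have "open \<Omega>" using \<Omega>(1) by (simp add: domain_def)
    then have "\<forall>\<^sub>F \<epsilon> in at_right 0. \<exists>\<iota> :: nat \<Rightarrow> int ^ 'm. inj_on \<iota> {..k} \<and> \<iota> ` {..k} \<subseteq> room_indices \<Omega> \<epsilon>"
      by (rule many_rooms[OF _ \<Omega>(2-4) \<Gamma>])
    then show "\<forall>\<^sub>F \<epsilon> in at_right 0. ereal (\<Lambda> \<epsilon> k) \<le> c"
      using pos le \<Lambda> order_tendstoD(2)[OF q c]
    proof eventually_elim
      case (elim \<epsilon>)
      interpret rooms_and_passages \<Omega> B D R \<epsilon> "b \<epsilon>" "d \<epsilon>" "h \<epsilon>" "\<sigma> \<epsilon>"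
        by unfold_locales (use \<Omega> B D R B_ne elim in \<open>auto simp: domain_def\<close>)
      obtain \<iota> :: "nat \<Rightarrow> int ^ 'm" where \<iota>: "inj_on \<iota> {..k}" "\<iota> ` {..k} \<subseteq> room_indices \<Omega> \<epsilon>"
        using elim by blast
      have "\<Lambda> \<epsilon> k \<le> d \<epsilon> ^ (n - 1) * measure lebesgue D / (h \<epsilon> * \<sigma> \<epsilon> * b \<epsilon> ^ n * measure lebesgue B)"
        by (rule eigenvalue_bound_of_many_rooms[OF \<iota>]) (use elim n in simp_all)
      then have "ereal (\<Lambda> \<epsilon> k) \<le> ereal (d \<epsilon> ^ (n - 1) * measure lebesgue D / (h \<epsilon> * \<sigma> \<epsilon> * b \<epsilon> ^ n * measure lebesgue B))"
        by simp
      also have "\<dots> \<le> c" using elim by (simp add: less_imp_le)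
      finally show ?case .
    qed
  qed
  then show "(SUP k. Limsup (at_right 0) (\<lambda>\<epsilon>. ereal (\<Lambda> \<epsilon> k))) \<le> c"
    by (intro SUP_least Limsup_bounded)
qed

end
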